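(* Let $\Delta$ be a $(d-1)$-dimensional homology manifold without boundary ($d\ge4$, connected, pure) with nonzero first Betti number. Then $f_i(\Delta)\ge f_i(M^d)$ for all $i$, where $f_0(M^d)=2d+1$ and, for $1\le i\le d-1$, $f_i(M^d)=\frac{2d+1}{i+1}\,\phi_{i-1}(2d,d-1)$.
   Context: $f_i$ denotes the number of $i$-dimensional faces. For integers $N,e$: $\phi_0(N,e)=N$, $\phi_j(N,e)=\binom{e}{j}N-\binom{e+1}{j+1}j$ for $1\le j\le e-2$, and $\phi_{e-1}(N,e)=(e-1)N-(e+1)(e-2)$; $\phi_j(N,e)$ is the number of $j$-faces of an $(e-1)$-dimensional stacked sphere with $N$ vertices. The numbers $f_i(M^d)$ are the face numbers of Kühnel's triangulation $M^d$: a $2$-neighborly complex with $2d+1$ vertices, homeomorphic to $S^1\times S^{d-2}$ ($d$ odd) or the nonorientable $S^{d-2}$-bundle over $S^1$ ($d$ even), in which every vertex link is a stacked $(d-2)$-sphere with $2d$ vertices. Homology manifold (over a field $k$): for every nonempty face $\rho$, the link $\operatorname{lk}\rho=\{\tau:\tau\cap\rho=\emptyset,\tau\cup\rho\in\Delta\}$ has the $k$-homology of $S^{d-|\rho|-1}$ or $B^{d-|\rho|-1}$; without boundary means every link has the homology of a sphere. Betti numbers are over $k$. *)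

theory Defs
  imports Complex_Main "HOL-Library.Function_Algebras"
begin

definition simplicial_complex :: "'v set set \<Rightarrow> bool" where
  "simplicial_complex \<Delta> \<longleftrightarrow>
     finite \<Delta> \<and> {} \<in> \<Delta> \<and> (\<forall>\<sigma>\<in>\<Delta>. finite \<sigma>) \<and> (\<forall>\<sigma>\<in>\<Delta>. \<forall>\<tau>. \<tau> \<subseteq> \<sigma> \<longrightarrow> \<tau> \<in> \<Delta>)"

definition complex_dim :: "'v set set \<Rightarrow> int" where
  "complex_dim \<Delta> = Max ((\<lambda>\<sigma>. int (card \<sigma>) - 1) ` \<Delta>)"

definition face_number :: "'v set set \<Rightarrow> nat \<Rightarrow> nat" where
  "face_number \<Delta> i = card {\<sigma>\<in>\<Delta>. card \<sigma> = i + 1}"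

definition facets :: "'v set set \<Rightarrow> 'v set set" where
  "facets \<Delta> = {\<sigma>\<in>\<Delta>. \<forall>\<tau>\<in>\<Delta>. \<sigma> \<subseteq> \<tau> \<longrightarrow> \<tau> = \<sigma>}"

definition pure_complex :: "'v set set \<Rightarrow> bool" where
  "pure_complex \<Delta> \<longleftrightarrow> (\<forall>\<sigma>\<in>facets \<Delta>. int (card \<sigma>) - 1 = complex_dim \<Delta>)"

definition connected_complex :: "'v set set \<Rightarrow> bool" where
  "connected_complex \<Delta> \<longleftrightarrow> (\<forall>u\<in>\<Union>\<Delta>. \<forall>v\<in>\<Union>\<Delta>. (u, v) \<in> {(a, b). {a, b} \<in> \<Delta>}\<^sup>*)"

definition link :: "'v set set \<Rightarrow> 'v set \<Rightarrow> 'v set set" where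
  "link \<Delta> \<rho> = {\<tau>. \<tau> \<inter> \<rho> = {} \<and> \<tau> \<union> \<rho> \<in> \<Delta>}"

text \<open>
  Oriented simplicial chains with coefficients in a field, without choosing an order on the
  vertices. A chain of dimension \<open>j\<close> assigns to the oriented simplex \<open>[x0,...,xj]\<close>, given as a
  list of length \<open>j + 1\<close>, its coefficient; reversing the orientation changes the sign, and it
  is enough to require this for transpositions of neighbouring entries. (Distinctness has to be
  required separately because of characteristic 2.) The list \<open>[]\<close> stands for the empty face, in
  dimension \<open>-1\<close>, so this is the augmented complex, computing reduced homology.
\<close>

definition simplicial_chains :: "'v set set \<Rightarrow> int \<Rightarrow> ('v list \<Rightarrow> 'k::field) set" where
  "simplicial_chains \<Delta> j =
     {c. (\<forall>xs. c xs \<noteq> 0 \<longrightarrow> distinct xs \<and> set xs \<in> \<Delta> \<and> int (length xs) = j + 1) \<and>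
         (\<forall>xs u v ys. c (xs @ u # v # ys) = - c (xs @ v # u # ys))}"

text \<open>
  This is the linear map sending the elementary chain of \<open>[x0,...,xj]\<close> to the alternating sum
  over \<open>i\<close> of the elementary chains of \<open>[x0,...,xj]\<close> with \<open>xi\<close> omitted: the coefficient of
  \<open>xs\<close> in the boundary collects the coefficients of all \<open>v # xs\<close>, since moving the omitted
  vertex from position \<open>i\<close> to the front costs the sign \<open>(-1)^i\<close>.
\<close>

definition boundary :: "'v set set \<Rightarrow> ('v list \<Rightarrow> 'k::field) \<Rightarrow> 'v list \<Rightarrow> 'k" where
  "boundary \<Delta> c xs = (\<Sum>v\<in>\<Union>\<Delta>. c (v # xs))"

definition cycles :: "'v set set \<Rightarrow> int \<Rightarrow> ('v list \<Rightarrow> 'k::field) set" where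
  "cycles \<Delta> j = {c \<in> simplicial_chains \<Delta> j. boundary \<Delta> c = 0}"

definition boundaries :: "'v set set \<Rightarrow> int \<Rightarrow> ('v list \<Rightarrow> 'k::field) set" where
  "boundaries \<Delta> j = boundary \<Delta> ` simplicial_chains \<Delta> (j + 1)"

definition chain_scale :: "'k::field \<Rightarrow> ('v list \<Rightarrow> 'k) \<Rightarrow> 'v list \<Rightarrow> 'k" where
  "chain_scale a c = (\<lambda>xs. a * c xs)"

global_interpretation chain_space: vector_space "chain_scale :: 'k::field \<Rightarrow> ('v list \<Rightarrow> 'k) \<Rightarrow> 'v list \<Rightarrow> 'k"
  by unfold_locales (auto simp: chain_scale_def fun_eq_iff algebra_simps)

lemma boundary_add: "boundary \<Delta> (c + c') = boundary \<Delta> c + boundary \<Delta> c'"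
  by (auto simp: boundary_def fun_eq_iff sum.distrib)

lemma boundary_scale: "boundary \<Delta> (chain_scale a c) = chain_scale a (boundary \<Delta> c)"
  by (auto simp: boundary_def chain_scale_def fun_eq_iff sum_distrib_left)

lemma boundary_zero: "boundary \<Delta> 0 = 0"
  by (auto simp: boundary_def fun_eq_iff)

lemma subspace_simplicial_chains:
  fixes \<Delta> :: "'v set set"
  shows "chain_space.subspace (simplicial_chains \<Delta> j :: ('v list \<Rightarrow> 'k::field) set)"
proof (rule chain_space.subspaceI)
  show "(0 :: 'v list \<Rightarrow> 'k) \<in> simplicial_chains \<Delta> j"
    by (simp add: simplicial_chains_def)
next
  fix c c' :: "'v list \<Rightarrow> 'k"
  assume c: "c \<in> simplicial_chains \<Delta> j" and c': "c' \<in> simplicial_chains \<Delta> j"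
  have "distinct xs \<and> set xs \<in> \<Delta> \<and> int (length xs) = j + 1" if "(c + c') xs \<noteq> 0" for xs
  proof -
    from that have "c xs \<noteq> 0 \<or> c' xs \<noteq> 0" by auto
    with c c' show ?thesis unfolding simplicial_chains_def by blast
  qed
  moreover have "(c + c') (xs @ u # v # ys) = - (c + c') (xs @ v # u # ys)" for xs u v ys
  proof -
    have "c (xs @ u # v # ys) = - c (xs @ v # u # ys)" "c' (xs @ u # v # ys) = - c' (xs @ v # u # ys)"
      using c c' unfolding simplicial_chains_def by blast+
    then show ?thesis by simp
  qed
  ultimately show "c + c' \<in> simplicial_chains \<Delta> j"
    unfolding simplicial_chains_def by blast
next
  fix a and c :: "'v list \<Rightarrow> 'k"
  assume c: "c \<in> simplicial_chains \<Delta> j"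
  have "distinct xs \<and> set xs \<in> \<Delta> \<and> int (length xs) = j + 1" if "chain_scale a c xs \<noteq> 0" for xs
  proof -
    from that have "c xs \<noteq> 0" by (auto simp: chain_scale_def)
    with c show ?thesis unfolding simplicial_chains_def by blast
  qed
  moreover have "chain_scale a c (xs @ u # v # ys) = - chain_scale a c (xs @ v # u # ys)" for xs u v ys
  proof -
    have "c (xs @ u # v # ys) = - c (xs @ v # u # ys)"
      using c unfolding simplicial_chains_def by blast
    then show ?thesis by (simp add: chain_scale_def)
  qed
  ultimately show "chain_scale a c \<in> simplicial_chains \<Delta> j"
    unfolding simplicial_chains_def by blast
qed

lemma subspace_cycles: "chain_space.subspace (cycles \<Delta> j)"
  using subspace_simplicial_chains[of \<Delta> j]
  by (auto simp: chain_space.subspace_def cycles_def boundary_add boundary_scale boundary_zero)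

lemma subspace_boundaries:
  fixes \<Delta> :: "'v set set"
  shows "chain_space.subspace (boundaries \<Delta> j :: ('v list \<Rightarrow> 'k::field) set)"
proof (rule chain_space.subspaceI)
  note sub = subspace_simplicial_chains[of \<Delta> "j + 1", where 'k = 'k]
  show "(0 :: 'v list \<Rightarrow> 'k) \<in> boundaries \<Delta> j"
    unfolding boundaries_def using boundary_zero chain_space.subspace_0[OF sub]
    by (intro image_eqI[of _ _ 0]) auto
  show "b + b' \<in> boundaries \<Delta> j" if "b \<in> boundaries \<Delta> j" "b' \<in> boundaries \<Delta> j"
    for b b' :: "'v list \<Rightarrow> 'k"
    using that chain_space.subspace_add[OF sub] unfolding boundaries_def
    by (auto simp flip: boundary_add)
  show "chain_scale a b \<in> boundaries \<Delta> j" if "b \<in> boundaries \<Delta> j"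
    for a and b :: "'v list \<Rightarrow> 'k"
    using that chain_space.subspace_scale[OF sub] unfolding boundaries_def
    by (auto simp flip: boundary_scale)
qed

lemma boundary_in_chains:
  assumes "simplicial_complex \<Delta>" "c \<in> simplicial_chains \<Delta> (j + 1)"
  shows "boundary \<Delta> c \<in> simplicial_chains \<Delta> j"
proof -
  have supp: "distinct (v # xs) \<and> set (v # xs) \<in> \<Delta> \<and> int (length (v # xs)) = j + 1 + 1"
    if "c (v # xs) \<noteq> 0" for v xs
    using assms(2) that unfolding simplicial_chains_def by blast
  have alt: "c (w # xs @ u # v # ys) = - c (w # xs @ v # u # ys)" for w xs u v ys
    proof -
    have "c ((w # xs) @ u # v # ys) = - c ((w # xs) @ v # u # ys)"
      using assms(2) unfolding simplicial_chains_def by blast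
    then show ?thesis by simp
  qed
  have "distinct xs \<and> set xs \<in> \<Delta> \<and> int (length xs) = j + 1" if nz: "boundary \<Delta> c xs \<noteq> 0" for xs
  proof -
    obtain v where "c (v # xs) \<noteq> 0"
      using nz unfolding boundary_def by (meson sum.neutral)
    note s = supp[OF this]
    have "set xs \<subseteq> set (v # xs)" by auto
    with s assms(1) have "set xs \<in> \<Delta>" unfolding simplicial_complex_def by blast
    with s show ?thesis by simp
  qed
  moreover have "boundary \<Delta> c (xs @ u # v # ys) = - boundary \<Delta> c (xs @ v # u # ys)" for xs u v ys
    unfolding boundary_def sum_negf[symmetric] by (rule sum.cong[OF refl]) (rule alt)
  ultimately show ?thesis
    unfolding simplicial_chains_def by blast
qed

lemma sum_alternating_eq_0:
  fixes g :: "'v \<Rightarrow> 'v \<Rightarrow> 'k::field"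
  assumes "finite V" and diag: "\<And>v. g v v = 0" and alt: "\<And>u v. g u v = - g v u"
  shows "(\<Sum>u\<in>V. \<Sum>v\<in>V. g u v) = 0"
  using assms(1)
proof (induction V)
  case (insert a V)
  have "(\<Sum>u\<in>insert a V. \<Sum>v\<in>insert a V. g u v) =
      (\<Sum>v\<in>V. g a v) + (\<Sum>u\<in>V. g u a) + (\<Sum>u\<in>V. \<Sum>v\<in>V. g u v)"
    using insert.hyps by (simp add: diag sum.distrib)
  also have "(\<Sum>u\<in>V. g u a) = - (\<Sum>v\<in>V. g a v)"
    unfolding sum_negf[symmetric] by (rule sum.cong[OF refl]) (rule alt)
  finally show ?case using insert.IH by simp
qed simp

lemma boundary_boundary:
  assumes "simplicial_complex \<Delta>" "c \<in> simplicial_chains \<Delta> j"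
  shows "boundary \<Delta> (boundary \<Delta> c) = 0"
proof
  fix xs
  have "finite (\<Union>\<Delta>)"
    using assms(1) unfolding simplicial_complex_def by blast
  moreover have "c (v # v # xs) = 0" for v
    proof -
    have "c (v # v # xs) \<noteq> 0 \<longrightarrow> distinct (v # v # xs)"
      using assms(2) unfolding simplicial_chains_def by blast
    then show ?thesis by auto
  qed
  moreover have "c (v # u # xs) = - c (u # v # xs)" for u v
    proof -
    have "c ([] @ v # u # xs) = - c ([] @ u # v # xs)"
      using assms(2) unfolding simplicial_chains_def by blast
    then show ?thesis by simp
  qed
  ultimately have "(\<Sum>u\<in>\<Union>\<Delta>. \<Sum>v\<in>\<Union>\<Delta>. c (v # u # xs)) = 0"
    by (intro sum_alternating_eq_0)
  then show "boundary \<Delta> (boundary \<Delta> c) xs = 0 xs"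
    by (simp add: boundary_def)
qed

lemma boundaries_subset_cycles:
  assumes "simplicial_complex \<Delta>"
  shows "boundaries \<Delta> j \<subseteq> cycles \<Delta> j"
  using boundary_in_chains[OF assms] boundary_boundary[OF assms]
  by (auto simp: boundaries_def cycles_def)

lemma finite_dimensional_simplicial_chains:
  assumes "simplicial_complex \<Delta>"
  shows "\<exists>B. finite B \<and> (simplicial_chains \<Delta> j :: ('v list \<Rightarrow> 'k::field) set) \<subseteq> chain_space.span B"
proof -
  define A where "A = {xs. distinct xs \<and> set xs \<in> \<Delta>}"
  define \<delta> :: "'v list \<Rightarrow> 'v list \<Rightarrow> 'k" where "\<delta> = (\<lambda>xs ys. if ys = xs then 1 else 0)"
  have fin: "finite (\<Union>\<Delta>)" "finite \<Delta>"
    using assms unfolding simplicial_complex_def by blast+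
  have "A \<subseteq> {xs. set xs \<subseteq> \<Union>\<Delta> \<and> length xs \<le> card (\<Union>\<Delta>)}"
    using fin(1) card_mono[OF fin(1), OF Union_upper] distinct_card
    by (fastforce simp: A_def)
  then have A: "finite A"
    using finite_lists_length_le[OF fin(1)] by (rule finite_subset)
  have "c \<in> chain_space.span (\<delta> ` A)" if c: "c \<in> simplicial_chains \<Delta> j" for c
  proof -
    have "c = (\<Sum>xs\<in>A. chain_scale (c xs) (\<delta> xs))"
    proof
      fix ys
      have "(\<Sum>xs\<in>A. chain_scale (c xs) (\<delta> xs)) ys = (\<Sum>xs\<in>A. chain_scale (c xs) (\<delta> xs) ys)"
        using A by (induction A) auto
      also have "\<dots> = (\<Sum>xs\<in>A. if ys = xs then c xs else 0)"
        by (rule sum.cong) (auto simp: chain_scale_def \<delta>_def)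
      also have "\<dots> = (if ys \<in> A then c ys else 0)"
        using A by simp
      also have "\<dots> = c ys"
      proof -
        have "c ys \<noteq> 0 \<longrightarrow> distinct ys \<and> set ys \<in> \<Delta>"
          using c unfolding simplicial_chains_def by blast
        then show ?thesis by (auto simp: A_def)
      qed
      finally show "c ys = (\<Sum>xs\<in>A. chain_scale (c xs) (\<delta> xs)) ys" ..
    qed
    moreover have "(\<Sum>xs\<in>A. chain_scale (c xs) (\<delta> xs)) \<in> chain_space.span (\<delta> ` A)"
      by (intro chain_space.span_sum chain_space.span_scale chain_space.span_base imageI)
    ultimately show ?thesis by simp
  qed
  then show ?thesis using A by blast
qed

text \<open>
  The dimension over \<open>'k\<close> of the \<open>j\<close>-th reduced homology, cycles modulo boundaries; the
  subtraction of natural numbers is harmless by the lemmas above. For \<open>j \<ge> 1\<close> this is the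
  ordinary Betti number.
\<close>

definition reduced_betti :: "'k::field itself \<Rightarrow> 'v set set \<Rightarrow> int \<Rightarrow> nat" where
  "reduced_betti K \<Delta> j =
     chain_space.dim (cycles \<Delta> j :: ('v list \<Rightarrow> 'k) set) -
     chain_space.dim (boundaries \<Delta> j :: ('v list \<Rightarrow> 'k) set)"

text \<open>For \<open>n = -1\<close> the sphere is empty, and its only homology is in dimension \<open>-1\<close>.\<close>

definition homology_of_sphere :: "'k::field itself \<Rightarrow> 'v set set \<Rightarrow> int \<Rightarrow> bool" where
  "homology_of_sphere K \<Delta> n \<longleftrightarrow> (\<forall>j. reduced_betti K \<Delta> j = (if j = n then 1 else 0))"

definition homology_of_ball :: "'k::field itself \<Rightarrow> 'v set set \<Rightarrow> bool" where
  "homology_of_ball K \<Delta> \<longleftrightarrow> (\<forall>j. reduced_betti K \<Delta> j = 0)"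

text \<open>
  With \<open>complex_dim \<Delta> = d - 1\<close> the dimension \<open>d - |\<rho>| - 1\<close> expected of the link of \<open>\<rho>\<close> is
  \<open>complex_dim \<Delta> - |\<rho>|\<close>. Homology manifolds are connected and pure by convention.
\<close>

definition homology_manifold :: "'k::field itself \<Rightarrow> 'v set set \<Rightarrow> bool" where
  "homology_manifold K \<Delta> \<longleftrightarrow>
     simplicial_complex \<Delta> \<and> connected_complex \<Delta> \<and> pure_complex \<Delta> \<and>
     (\<forall>\<rho>\<in>\<Delta>. \<rho> \<noteq> {} \<longrightarrow>
        homology_of_sphere K (link \<Delta> \<rho>) (complex_dim \<Delta> - int (card \<rho>)) \<or>
        homology_of_ball K (link \<Delta> \<rho>))"

definition homology_manifold_without_boundary :: "'k::field itself \<Rightarrow> 'v set set \<Rightarrow> bool" where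
  "homology_manifold_without_boundary K \<Delta> \<longleftrightarrow>
     homology_manifold K \<Delta> \<and>
     (\<forall>\<rho>\<in>\<Delta>. \<rho> \<noteq> {} \<longrightarrow>
        homology_of_sphere K (link \<Delta> \<rho>) (complex_dim \<Delta> - int (card \<rho>)))"

text \<open>
  The number of \<open>j\<close>-faces of an \<open>(e - 1)\<close>-dimensional stacked sphere with \<open>N\<close> vertices
  (\<open>0\<close> for \<open>j \<ge> e\<close>). The values are integers because the formulas involve subtraction.
\<close>

definition stacked_phi :: "nat \<Rightarrow> nat \<Rightarrow> nat \<Rightarrow> int" where
  "stacked_phi j N e =
     (if j = 0 then int N
      else if j + 2 \<le> e then int (e choose j) * int N - int ((e + 1) choose (j + 1)) * int j
      else if j + 1 = e then (int e - 1) * int N - (int e + 1) * (int e - 2)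
      else 0)"

text \<open>
  The face numbers of Kuehnel's triangulation \<open>M^d\<close> of a sphere bundle over the circle: it has
  \<open>2d + 1\<close> vertices, all of whose links are stacked \<open>(d - 2)\<close>-spheres with \<open>2d\<close> vertices, and
  the formula for \<open>i \<ge> 1\<close> counts incident pairs of a vertex and an \<open>i\<close>-face.
\<close>

definition kuehnel_face_number :: "nat \<Rightarrow> nat \<Rightarrow> real" where
  "kuehnel_face_number d i =
     (if i = 0 then 2 * real d + 1
      else (2 * real d + 1) / (real i + 1) * of_int (stacked_phi (i - 1) (2 * d) (d - 1)))"

end

theory Submission
  imports Defs "HOL-Computational_Algebra.Polynomial" "HOL-Library.Z2"
begin

text \<open>
  A generic placement of the vertices makes minimal cycles modulo 2 rigid (Fogelsanger), in
  particular the links of \<open>\<Delta>\<close>, since links of codimension at least 2 are connected and ridges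
  lie in two facets. Counting equations gives \<open>f\<^sub>1 \<ge> e f\<^sub>0 - (e + 1 choose 2)\<close> for links of
  dimension \<open>e - 1 \<ge> 2\<close>. A nonzero first Betti number yields a complex rank one local system with
  nontrivial monodromy. Twisted by it, \<open>\<Delta>\<close> has no trivial motions left, hence no motions at
  all, which gives \<open>f\<^sub>1 \<ge> d f\<^sub>0\<close> and therefore \<open>f\<^sub>0 \<ge> 2 d + 1\<close>. The other face numbers
  follow by summing the bounds for vertex links (McMullen, Perles, Walkup).
\<close>

section \<open>Polynomial genericity\<close>

text \<open>Two characteristics have to coexist. The field of the Betti numbers is arbitrary,
  possibly finite, while generic placements are taken over a field of characteristic 0. Therefore
  the additive cocycle with values in \<open>'k\<close> is composed with a character of a finitely
  generated subgroup of \<open>'k\<close> into the nonzero complex numbers, chosen to differ from 1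
  on one period. The cycles are taken modulo 2 because \<Delta> may be nonorientable, as M^d is for
  even d.

  The constant (e + 1 choose 2) is the dimension of the space of symmetric e by e matrices, that is,
  of the trivial motions. A twisted motion needs such a matrix at every vertex, compatible with the
  local system, and a rank one system with nontrivial monodromy on a connected complex has no
  nonzero section; so the constant disappears. Since there are at most (f0 choose 2) edges, f0 >= 2
  d + 1 follows. The average degree is then at least 2 d, and 2 d is the number of vertices of the
  stacked spheres that are the vertex links of M^d. The rigidity theorem needs e >= 3, which d >= 4
  provides for vertex links.\<close>

inductive_set polyfun :: "(('v \<Rightarrow> nat \<Rightarrow> 'a::field) \<Rightarrow> 'a) set" where
  polyfun_const: "(\<lambda>p. c) \<in> polyfun"
| polyfun_coord: "(\<lambda>p. p x i) \<in> polyfun"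
| polyfun_add: "D \<in> polyfun \<Longrightarrow> E \<in> polyfun \<Longrightarrow> (\<lambda>p. D p + E p) \<in> polyfun"
| polyfun_mult: "D \<in> polyfun \<Longrightarrow> E \<in> polyfun \<Longrightarrow> (\<lambda>p. D p * E p) \<in> polyfun"

lemma polyfun_diff:
  assumes "D \<in> polyfun" "E \<in> polyfun"
  shows "(\<lambda>p. D p - E p) \<in> polyfun"
  using polyfun_add[OF assms(1) polyfun_mult[OF polyfun_const[of "-1"] assms(2)]] by simp

lemma polyfun_if:
  assumes "D \<in> polyfun" "E \<in> polyfun"
  shows "(\<lambda>p. if b then D p else E p) \<in> polyfun"
  using assms by (cases b) auto

text \<open>On a line a polynomial function becomes a polynomial in one variable. Together with the
  finiteness of its roots this is all that genericity uses, so \<open>polyfun\<close> can stay a set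
  of functions without a type of multivariate polynomials.\<close>

lemma polyfun_line:
  assumes "D \<in> polyfun"
  shows "\<exists>r. \<forall>t. D (\<lambda>x i. p x i + t * (q x i - p x i)) = poly r t"
  using assms
proof induction
  case (polyfun_const c)
  show ?case by (rule exI[of _ "[:c:]"]) simp
next
  case (polyfun_coord x i)
  show ?case by (rule exI[of _ "[:p x i, q x i - p x i:]"]) simp
next
  case (polyfun_add D E)
  then obtain r s where "\<forall>t. D (\<lambda>x i. p x i + t * (q x i - p x i)) = poly r t"
    "\<forall>t. E (\<lambda>x i. p x i + t * (q x i - p x i)) = poly s t" by blast
  then show ?case by (intro exI[of _ "r + s"]) simp
next
  case (polyfun_mult D E)
  then obtain r s where "\<forall>t. D (\<lambda>x i. p x i + t * (q x i - p x i)) = poly r t"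
    "\<forall>t. E (\<lambda>x i. p x i + t * (q x i - p x i)) = poly s t" by blast
  then show ?case by (intro exI[of _ "r * s"]) simp
qed

text \<open>On the line that joins a point with \<open>D\<close> nonzero to a point with
  \<open>E\<close> nonzero, the restrictions are nonzero at 0 and at 1. Their product has finitely
  many roots, and a field of characteristic 0 is infinite.\<close>

lemma polyfun_mult_nonzero:
  fixes D E :: "('v \<Rightarrow> nat \<Rightarrow> 'a::field_char_0) \<Rightarrow> 'a"
  assumes "D \<in> polyfun" "E \<in> polyfun" "D p \<noteq> 0" "E q \<noteq> 0"
  shows "\<exists>w. D w * E w \<noteq> 0"
proof -
  obtain r where r: "\<And>t. D (\<lambda>x i. p x i + t * (q x i - p x i)) = poly r t"
    using polyfun_line[OF assms(1)] by blast
  obtain s where s: "\<And>t. E (\<lambda>x i. p x i + t * (q x i - p x i)) = poly s t"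
    using polyfun_line[OF assms(2)] by blast
  have "poly r 0 \<noteq> 0" "poly s 1 \<noteq> 0"
    using r[of 0] s[of 1] assms(3,4) by auto
  then have "r * s \<noteq> 0" by auto
  then have "finite {t. poly (r * s) t = 0}" by (rule poly_roots_finite)
  then have "{t. poly (r * s) t = 0} \<noteq> UNIV" using infinite_UNIV_char_0 by metis
  then obtain t where "poly (r * s) t \<noteq> 0" by blast
  then have "D (\<lambda>x i. p x i + t * (q x i - p x i)) * E (\<lambda>x i. p x i + t * (q x i - p x i)) \<noteq> 0"
    unfolding r s by simp
  then show ?thesis by (intro exI[of _ "\<lambda>x i. p x i + t * (q x i - p x i)"])
qed

text \<open>A nonempty principal Zariski open set on which \<open>P\<close> holds. Finite
  conjunctions stay generic, so finitely many rigidity conditions can be imposed on a single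
  placement.\<close>

definition generic :: "(('v \<Rightarrow> nat \<Rightarrow> 'a::field) \<Rightarrow> bool) \<Rightarrow> bool" where
  "generic P \<longleftrightarrow> (\<exists>D\<in>polyfun. (\<exists>p. D p \<noteq> 0) \<and> (\<forall>p. D p \<noteq> 0 \<longrightarrow> P p))"

lemma genericI: "D \<in> polyfun \<Longrightarrow> D p \<noteq> 0 \<Longrightarrow> (\<And>p. D p \<noteq> 0 \<Longrightarrow> P p) \<Longrightarrow> generic P"
  unfolding generic_def by (rule bexI[of _ D]) auto

lemma genericE:
  assumes "generic P"
  obtains D p where "D \<in> polyfun" "D p \<noteq> 0" "\<And>p. D p \<noteq> 0 \<Longrightarrow> P p"
proof -
  from assms[unfolded generic_def] obtain D where "D \<in> polyfun"
    and D: "(\<exists>p. D p \<noteq> 0) \<and> (\<forall>p. D p \<noteq> 0 \<longrightarrow> P p)" ..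
  from D obtain p where "D p \<noteq> 0" by auto
  from that[OF \<open>D \<in> polyfun\<close> this] D show thesis by simp
qed

lemma generic_ex: "generic P \<Longrightarrow> \<exists>p. P p"
  by (erule genericE) auto

lemma generic_mono:
  assumes "generic P" "\<And>p. P p \<Longrightarrow> Q p"
  shows "generic Q"
  using assms(1)
proof (rule genericE)
  fix D :: "('a \<Rightarrow> nat \<Rightarrow> 'b) \<Rightarrow> 'b" and p
  assume D: "D \<in> polyfun" "D p \<noteq> 0" and P: "\<And>p. D p \<noteq> 0 \<Longrightarrow> P p"
  show ?thesis by (rule genericI[OF D]) (rule assms(2), rule P)
qed

lemma generic_True: "generic (\<lambda>_. True)"
  by (rule genericI[OF polyfun_const[of 1]]) simp_all

lemma generic_conj:
  fixes P Q :: "('v \<Rightarrow> nat \<Rightarrow> 'a::field_char_0) \<Rightarrow> bool"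
  assumes "generic P" "generic Q"
  shows "generic (\<lambda>p. P p \<and> Q p)"
  using assms(1)
proof (rule genericE)
  fix D :: "('v \<Rightarrow> nat \<Rightarrow> 'a) \<Rightarrow> 'a" and p
  assume D: "D \<in> polyfun" "D p \<noteq> 0" and P: "\<And>p. D p \<noteq> 0 \<Longrightarrow> P p"
  show ?thesis
    using assms(2)
  proof (rule genericE)
    fix E :: "('v \<Rightarrow> nat \<Rightarrow> 'a) \<Rightarrow> 'a" and q
    assume E: "E \<in> polyfun" "E q \<noteq> 0" and Q: "\<And>p. E p \<noteq> 0 \<Longrightarrow> Q p"
    obtain w where w: "D w * E w \<noteq> 0"
      using polyfun_mult_nonzero[of D E p q] D E by blast
    have "(\<lambda>p. D p * E p) \<in> polyfun" by (rule polyfun_mult[OF D(1) E(1)])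
    then show ?thesis
    proof (rule genericI[of "\<lambda>p. D p * E p", OF _ w])
      fix p assume "D p * E p \<noteq> 0"
      then show "P p \<and> Q p" using P[of p] Q[of p] by simp
    qed
  qed
qed

lemma generic_ball:
  fixes P :: "'b \<Rightarrow> ('v \<Rightarrow> nat \<Rightarrow> 'a::field_char_0) \<Rightarrow> bool"
  assumes "finite A" "\<And>a. a \<in> A \<Longrightarrow> generic (P a)"
  shows "generic (\<lambda>p. \<forall>a\<in>A. P a p)"
  using assms
proof (induction A)
  case empty
  show ?case using generic_True by simp
next
  case (insert a A)
  then have "generic (\<lambda>p. P a p \<and> (\<forall>a\<in>A. P a p))"
    by (intro generic_conj) auto
  then show ?case by (rule generic_mono) auto
qed

section \<open>Homogeneous linear systems\<close>

text \<open>Injectivity of a matrix with arbitrary index sets: later the equations are edges and the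
  unknowns are coordinates of vertices. Injectivity instead of rank lets elimination proceed one
  column at a time.\<close>

definition trivial_kernel :: "'i set \<Rightarrow> 'j set \<Rightarrow> ('i \<Rightarrow> 'j \<Rightarrow> 'a::field) \<Rightarrow> bool" where
  "trivial_kernel I J A \<longleftrightarrow>
     (\<forall>\<mu>. (\<forall>i\<in>I. (\<Sum>j\<in>J. A i j * \<mu> j) = 0) \<longrightarrow> (\<forall>j\<in>J. \<mu> j = 0))"

text \<open>Fraction-free elimination: rows are cleared by cross multiplication, so entries that are
  polynomial in the placement stay polynomial.\<close>

definition eliminate :: "'i \<Rightarrow> 'j \<Rightarrow> ('i \<Rightarrow> 'j \<Rightarrow> 'a::field) \<Rightarrow> 'i \<Rightarrow> 'j \<Rightarrow> 'a" where
  "eliminate i j A i' j' = A i j * A i' j' - A i' j * A i j'"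

lemma sum_eliminate:
  assumes "finite J" "j \<notin> J"
  shows "(\<Sum>j'\<in>J. eliminate i j A i' j' * \<mu> j') =
    A i j * (\<Sum>j'\<in>insert j J. A i' j' * \<mu> j') - A i' j * (\<Sum>j'\<in>insert j J. A i j' * \<mu> j')"
  using assms
  by (simp add: eliminate_def algebra_simps sum_subtractf sum_distrib_left)

lemma trivial_kernel_eliminate:
  fixes A :: "'i \<Rightarrow> 'j \<Rightarrow> 'a::field"
  assumes "finite J" "j \<notin> J" "i \<in> I" "A i j \<noteq> 0"
  shows "trivial_kernel I (insert j J) A \<longleftrightarrow> trivial_kernel (I - {i}) J (eliminate i j A)"
proof
  assume L: "trivial_kernel I (insert j J) A"
  show "trivial_kernel (I - {i}) J (eliminate i j A)"
    unfolding trivial_kernel_def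
  proof (intro allI impI)
    fix \<mu> assume mu: "\<forall>i'\<in>I - {i}. (\<Sum>j'\<in>J. eliminate i j A i' j' * \<mu> j') = 0"
    \<comment> \<open>The unknown \<open>j\<close> is recovered by solving the pivot row
      \<open>i\<close> for it.\<close>
    define \<nu> where "\<nu> = \<mu>(j := - (\<Sum>j'\<in>J. A i j' * \<mu> j') / A i j)"
    have \<nu>J: "(\<Sum>j'\<in>J. B j' * \<nu> j') = (\<Sum>j'\<in>J. B j' * \<mu> j')" for B :: "'j \<Rightarrow> 'a"
      using assms(2) by (intro sum.cong) (auto simp: \<nu>_def)
    have i0: "(\<Sum>j'\<in>insert j J. A i j' * \<nu> j') = 0"
      using assms by (simp add: \<nu>J) (simp add: \<nu>_def)
    have "(\<Sum>j'\<in>insert j J. A i' j' * \<nu> j') = 0" if "i' \<in> I" for i'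
    proof (cases "i' = i")
      case False
      then have "(\<Sum>j'\<in>J. eliminate i j A i' j' * \<nu> j') = 0"
        using mu that by (simp add: \<nu>J)
      then show ?thesis using sum_eliminate[OF assms(1,2), of i A i' \<nu>] i0 assms(4) by simp
    qed (use i0 in simp)
    then have "\<forall>j'\<in>insert j J. \<nu> j' = 0"
      using L unfolding trivial_kernel_def by blast
    then show "\<forall>j\<in>J. \<mu> j = 0" using assms(2) by (auto simp: \<nu>_def split: if_splits)
  qed
next
  assume R: "trivial_kernel (I - {i}) J (eliminate i j A)"
  show "trivial_kernel I (insert j J) A"
    unfolding trivial_kernel_def
  proof (intro allI impI)
    fix \<mu> assume mu: "\<forall>i\<in>I. (\<Sum>j\<in>insert j J. A i j * \<mu> j) = 0"
    then have "\<forall>i'\<in>I - {i}. (\<Sum>j'\<in>J. eliminate i j A i' j' * \<mu> j') = 0"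
      using assms by (simp add: sum_eliminate del: sum.insert)
    then have J0: "\<forall>j\<in>J. \<mu> j = 0" using R unfolding trivial_kernel_def by blast
    have "A i j * \<mu> j + (\<Sum>j\<in>J. A i j * \<mu> j) = 0" using mu assms by auto
    moreover have "(\<Sum>j\<in>J. A i j * \<mu> j) = 0" using J0 by simp
    ultimately show "\<forall>j\<in>insert j J. \<mu> j = 0" using J0 assms(4) by simp
  qed
qed

lemma trivial_kernel_pivot:
  fixes A :: "'i \<Rightarrow> 'j \<Rightarrow> 'a::field"
  assumes "finite J" "j \<notin> J" "trivial_kernel I (insert j J) A"
  obtains i where "i \<in> I" "A i j \<noteq> 0"
proof -
  have "\<exists>i\<in>I. A i j \<noteq> 0"
  proof (rule ccontr)
    assume "\<not> (\<exists>i\<in>I. A i j \<noteq> 0)"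
    then have z: "A i j = 0" if "i \<in> I" for i using that by blast
    define \<mu> :: "'j \<Rightarrow> 'a" where "\<mu> j' = (if j' = j then 1 else 0)" for j'
    have "(\<Sum>j'\<in>insert j J. A i j' * \<mu> j') = 0" if "i \<in> I" for i
      using z[OF that] by (intro sum.neutral) (auto simp: \<mu>_def)
    then have "\<mu> j = 0" using assms(3) unfolding trivial_kernel_def by blast
    then show False by (simp add: \<mu>_def)
  qed
  then show thesis using that by blast
qed

text \<open>Each pivot consumes one column and one row.\<close>

lemma trivial_kernel_card:
  assumes "finite J" "finite I" "trivial_kernel I J A"
  shows "card J \<le> card I"
  using assms
proof (induction J arbitrary: I A)
  case (insert j J)
  obtain i where i: "i \<in> I" "A i j \<noteq> 0"
    using trivial_kernel_pivot[OF insert.hyps insert.prems(2)] .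
  then have "trivial_kernel (I - {i}) J (eliminate i j A)"
    using trivial_kernel_eliminate[of J j i I A] insert.hyps insert.prems(2) by simp
  then have "card J \<le> card (I - {i})"
    using insert.IH[of "I - {i}" "eliminate i j A"] insert.prems(1) by simp
  moreover have "card I = Suc (card (I - {i}))"
    using insert.prems(1) i(1) by (metis card.remove)
  ultimately show ?case using insert.hyps by simp
qed simp

text \<open>Elimination at \<open>p0\<close> chooses the pivots. The product of these pivot entries,
  read as polynomials in \<open>p\<close>, serves as \<open>D\<close>: wherever it is nonzero the
  same pivots work.\<close>

lemma trivial_kernel_open:
  assumes "finite J" "\<And>i j. (\<lambda>p. A p i j) \<in> polyfun" "trivial_kernel I J (A p0)"
  shows "\<exists>D\<in>polyfun. D p0 \<noteq> 0 \<and> (\<forall>p. D p \<noteq> 0 \<longrightarrow> trivial_kernel I J (A p))"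
  using assms
proof (induction J arbitrary: I A)
  case empty
  show ?case
    using polyfun_const[of 1] by (intro bexI[of _ "\<lambda>_. 1"]) (auto simp: trivial_kernel_def)
next
  case (insert j J)
  obtain i where i: "i \<in> I" "A p0 i j \<noteq> 0"
    using trivial_kernel_pivot[OF insert.hyps insert.prems(2)] .
  then have "trivial_kernel (I - {i}) J (eliminate i j (A p0))"
    using trivial_kernel_eliminate[of J j i I "A p0"] insert.hyps insert.prems(2) by simp
  then have "\<exists>D\<in>polyfun. D p0 \<noteq> 0 \<and>
      (\<forall>p. D p \<noteq> 0 \<longrightarrow> trivial_kernel (I - {i}) J (eliminate i j (A p)))"
  proof (rule insert.IH[of "\<lambda>p. eliminate i j (A p)" "I - {i}", rotated])
    show "(\<lambda>p. eliminate i j (A p) i' j') \<in> polyfun" for i' j'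
      unfolding eliminate_def
      by (rule polyfun_diff; rule polyfun_mult) (rule insert.prems(1))+
  qed
  then obtain D where D: "D \<in> polyfun" "D p0 \<noteq> 0"
    "\<And>p. D p \<noteq> 0 \<Longrightarrow> trivial_kernel (I - {i}) J (eliminate i j (A p))"
    by blast
  show ?case
  proof (intro bexI conjI allI impI)
    show "(\<lambda>p. D p * A p i j) \<in> polyfun" by (intro polyfun_mult D(1) insert.prems(1))
    show "D p0 * A p0 i j \<noteq> 0" using D i by simp
    show "trivial_kernel I (insert j J) (A p)" if "D p * A p i j \<noteq> 0" for p
      using that D(3)[of p] trivial_kernel_eliminate[of J j i I "A p"] insert.hyps i(1) by simp
  qed
qed

section \<open>Symmetric rigidity\<close>

definition dot :: "nat \<Rightarrow> (nat \<Rightarrow> 'a::field) \<Rightarrow> (nat \<Rightarrow> 'a) \<Rightarrow> 'a" where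
  "dot e x y = (\<Sum>i<e. x i * y i)"

lemma dot_commute: "dot e x y = dot e y x"
  by (simp add: dot_def mult.commute)

lemma dot_diff_right: "dot e x (\<lambda>i. y i - z i) = dot e x y - dot e x z"
  by (simp add: dot_def right_diff_distrib sum_subtractf)

lemma dot_zero: "(\<And>i. i < e \<Longrightarrow> y i = 0) \<Longrightarrow> dot e x y = 0"
  by (simp add: dot_def)

lemma dot_cong:
  "(\<And>i. i < e \<Longrightarrow> x i = x' i) \<Longrightarrow> (\<And>i. i < e \<Longrightarrow> y i = y' i) \<Longrightarrow> dot e x y = dot e x' y'"
  by (simp add: dot_def)

text \<open>The vectors \<open>p x\<close> with x in \<sigma> span the whole space; orthogonality
  expresses this as a trivial kernel. For a simplex with \<open>e\<close> vertices it says that the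
  vectors form a basis.\<close>

definition separating :: "nat \<Rightarrow> ('v \<Rightarrow> nat \<Rightarrow> 'a::field) \<Rightarrow> 'v set \<Rightarrow> bool" where
  "separating e p \<sigma> \<longleftrightarrow> (\<forall>y. (\<forall>x\<in>\<sigma>. dot e (p x) y = 0) \<longrightarrow> (\<forall>i<e. y i = 0))"

lemma separating_iff: "separating e p \<sigma> \<longleftrightarrow> trivial_kernel \<sigma> {..<e} p"
  by (auto simp: separating_def trivial_kernel_def dot_def)

lemma separatingD:
  "separating e p \<sigma> \<Longrightarrow> (\<And>x. x \<in> \<sigma> \<Longrightarrow> dot e (p x) y = 0) \<Longrightarrow> i < e \<Longrightarrow> y i = 0"
  unfolding separating_def by blast

lemma generic_separating:
  assumes "finite \<sigma>" "card \<sigma> = e"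
  shows "generic (\<lambda>p :: 'v \<Rightarrow> nat \<Rightarrow> 'a::field. separating e p \<sigma>)"
proof -
  obtain h where h: "bij_betw h {..<e} \<sigma>"
    using ex_bij_betw_nat_finite[OF assms(1)] assms(2) by (auto simp: atLeast0LessThan)
  \<comment> \<open>A bijection with the coordinates places the simplex on the standard
    basis.\<close>
  define p0 :: "'v \<Rightarrow> nat \<Rightarrow> 'a" where "p0 x i = (if x = h i then 1 else 0)" for x i
  have "separating e p0 \<sigma>"
    unfolding separating_def
  proof (intro allI impI)
    fix y :: "nat \<Rightarrow> 'a" and i assume y: "\<forall>x\<in>\<sigma>. dot e (p0 x) y = 0" and i: "i < e"
    have "dot e (p0 (h i)) y = (\<Sum>j<e. if j = i then y j else 0)"
      unfolding dot_def p0_def using h i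
      by (intro sum.cong) (auto simp: bij_betw_def inj_on_def)
    then have "dot e (p0 (h i)) y = y i" using i by simp
    moreover have "h i \<in> \<sigma>" using h i by (auto simp: bij_betw_def)
    ultimately show "y i = 0" using y by simp
  qed
  then have "trivial_kernel \<sigma> {..<e} p0" by (simp add: separating_iff)
  from trivial_kernel_open[of _ "\<lambda>p. p", OF _ polyfun_coord this] show ?thesis
    unfolding generic_def separating_iff by (auto intro: polyfun_coord)
qed

lemma separating_solvable:
  fixes p :: "'v \<Rightarrow> nat \<Rightarrow> 'a::field"
  assumes "finite \<sigma>" "card \<sigma> = e" "separating e p \<sigma>"
  obtains y where "\<And>x. x \<in> \<sigma> \<Longrightarrow> dot e (p x) y = b x"
proof -
  \<comment> \<open>The right-hand side becomes an extra column with index \<open>e\<close>: e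
    equations in e + 1 unknowns have a nonzero solution, and its last entry cannot vanish because
    \<sigma> separates.\<close>
  define A where "A x i = (if i = e then - b x else p x i)" for x i
  have "\<not> trivial_kernel \<sigma> {..<Suc e} A"
    using trivial_kernel_card[of "{..<Suc e}" \<sigma> A] assms by auto
  then obtain \<mu> where \<mu>: "\<forall>x\<in>\<sigma>. (\<Sum>i<Suc e. A x i * \<mu> i) = 0" "\<exists>i<Suc e. \<mu> i \<noteq> 0"
    unfolding trivial_kernel_def by blast
  have eq: "dot e (p x) \<mu> = b x * \<mu> e" if "x \<in> \<sigma>" for x
    using \<mu>(1) that by (auto simp: dot_def A_def)
  have nz: "\<mu> e \<noteq> 0"
  proof
    assume z: "\<mu> e = 0"
    then have "\<forall>i<e. \<mu> i = 0" using separatingD[OF assms(3), of \<mu>] eq by simp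
    then show False using \<mu>(2) z by (auto simp: less_Suc_eq)
  qed
  have "dot e (p x) (\<lambda>i. \<mu> i / \<mu> e) = b x" if "x \<in> \<sigma>" for x
    using eq[OF that] nz by (simp add: dot_def sum_divide_distrib[symmetric])
  then show thesis by (rule that)
qed

text \<open>
  For \<open>p : V \<rightarrow> F\<^sup>e\<close> a motion of a complex assigns vectors \<open>m\<close> to the vertices such that
  \<open>p x \<bullet> m y = p y \<bullet> m x\<close> on every edge (Kalai's hyperconnectivity). The trivial motions are
  \<open>m = S p\<close> with \<open>S\<close> symmetric. Compared with infinitesimal rigidity, a vertex split can be
  treated without a limit argument, by placing both vertices at the same point.
\<close>

definition motion :: "nat \<Rightarrow> ('v \<Rightarrow> nat \<Rightarrow> 'a::field) \<Rightarrow> 'v set set \<Rightarrow> ('v \<Rightarrow> nat \<Rightarrow> 'a) \<Rightarrow> bool" where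
  "motion e p X m \<longleftrightarrow> (\<forall>\<sigma>\<in>X. \<forall>x\<in>\<sigma>. \<forall>y\<in>\<sigma>. dot e (p x) (m y) = dot e (p y) (m x))"

definition symmetric_mat :: "nat \<Rightarrow> (nat \<Rightarrow> nat \<Rightarrow> 'a) \<Rightarrow> bool" where
  "symmetric_mat e S \<longleftrightarrow> (\<forall>i<e. \<forall>j<e. S i j = S j i)"

definition agrees ::
  "nat \<Rightarrow> ('v \<Rightarrow> nat \<Rightarrow> 'a::field) \<Rightarrow> ('v \<Rightarrow> nat \<Rightarrow> 'a) \<Rightarrow> (nat \<Rightarrow> nat \<Rightarrow> 'a) \<Rightarrow> 'v set \<Rightarrow> bool" where
  "agrees e p m S W \<longleftrightarrow> (\<forall>x\<in>W. \<forall>i<e. m x i = dot e (S i) (p x))"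

definition rigid :: "nat \<Rightarrow> ('v \<Rightarrow> nat \<Rightarrow> 'a::field) \<Rightarrow> 'v set set \<Rightarrow> bool" where
  "rigid e p X \<longleftrightarrow> (\<forall>m. motion e p X m \<longrightarrow> (\<exists>S. symmetric_mat e S \<and> agrees e p m S (\<Union>X)))"

text \<open>Rigidity is not itself a trivial kernel, since trivial motions always exist. Setting the
  motion to 0 on a simplex placed on a basis removes exactly these, and what remains is a
  homogeneous system to which openness and counting apply.\<close>

definition pinned :: "nat \<Rightarrow> ('v \<Rightarrow> nat \<Rightarrow> 'a::field) \<Rightarrow> 'v set set \<Rightarrow> 'v set \<Rightarrow> bool" where
  "pinned e p X \<sigma> \<longleftrightarrow> (\<forall>m. motion e p X m \<longrightarrow> (\<forall>x\<in>\<sigma>. \<forall>i<e. m x i = 0) \<longrightarrow>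
     (\<forall>x\<in>\<Union>X. \<forall>i<e. m x i = 0))"

lemma dot_symmetric_mat:
  assumes "symmetric_mat e S"
  shows "dot e x (\<lambda>i. dot e (S i) y) = dot e y (\<lambda>i. dot e (S i) x)"
proof -
  have "dot e x (\<lambda>i. dot e (S i) y) = (\<Sum>i<e. \<Sum>j<e. x i * S i j * y j)"
    by (simp add: dot_def sum_distrib_left mult.assoc)
  also have "\<dots> = (\<Sum>j<e. \<Sum>i<e. x i * S i j * y j)" by (rule sum.swap)
  also have "\<dots> = (\<Sum>j<e. \<Sum>i<e. y j * S j i * x i)"
    using assms by (intro sum.cong) (auto simp: symmetric_mat_def)
  also have "\<dots> = dot e y (\<lambda>i. dot e (S i) x)"
    by (simp add: dot_def sum_distrib_left mult.assoc)
  finally show ?thesis .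
qed

lemma agrees_mono: "agrees e p m S W \<Longrightarrow> W' \<subseteq> W \<Longrightarrow> agrees e p m S W'"
  unfolding agrees_def by blast

lemma agrees_unique:
  assumes "agrees e p m S \<sigma>" "agrees e p m T \<sigma>" "separating e p \<sigma>" "i < e" "j < e"
  shows "S i j = T i j"
proof -
  have "dot e (p x) (\<lambda>j. S i j - T i j) = 0" if "x \<in> \<sigma>" for x
  proof -
    have "dot e (S i) (p x) = dot e (T i) (p x)"
      using assms(1,2,4) that unfolding agrees_def by metis
    then show ?thesis by (simp add: dot_diff_right dot_commute[of e "p x"])
  qed
  from separatingD[OF assms(3) this assms(5)] show ?thesis by simp
qed

text \<open>Two matrices that describe the same motion on a spanning set have equal entries. This is
  how matrices found on overlapping pieces are identified.\<close>

lemma agrees_transfer: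
  assumes "agrees e p m S \<sigma>" "agrees e p m T \<sigma>" "separating e p \<sigma>" "agrees e p m S W"
  shows "agrees e p m T W"
proof -
  have "dot e (S i) (p x) = dot e (T i) (p x)" if "i < e" for i x
    using agrees_unique[OF assms(1-3) that] by (intro dot_cong) auto
  then show ?thesis using assms(4) unfolding agrees_def by simp
qed

text \<open>Since the vectors \<open>p x\<close> form a basis, each row of the matrix can be
  prescribed by its values on \<sigma>. The equations of the motion say that the difference from the
  transpose, as a bilinear form, vanishes on all pairs of basis vectors.\<close>

lemma simplex_agrees:
  fixes p :: "'v \<Rightarrow> nat \<Rightarrow> 'a::field"
  assumes "finite \<sigma>" "card \<sigma> = e" "separating e p \<sigma>" "motion e p {\<sigma>} m"
  obtains S where "symmetric_mat e S" "agrees e p m S \<sigma>"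
proof -
  have "\<exists>y. \<forall>x\<in>\<sigma>. dot e (p x) y = m x i" for i
    using separating_solvable[OF assms(1-3), of "\<lambda>x. m x i"] by metis
  then obtain S where S: "\<And>i x. x \<in> \<sigma> \<Longrightarrow> dot e (p x) (S i) = m x i" by metis
  have ag: "agrees e p m S \<sigma>" by (simp add: agrees_def S dot_commute[of e "S _"])
  have "S i j - S j i = 0" if i: "i < e" and j: "j < e" for i j
  proof -
    have "dot e (p y) (\<lambda>j. S i j - S j i) = 0" if y: "y \<in> \<sigma>" for y
    proof -
      have "dot e (p x) (\<lambda>i. dot e (p y) (\<lambda>j. S i j - S j i)) = 0" if x: "x \<in> \<sigma>" for x
      proof -
        have "dot e (p x) (\<lambda>i. dot e (p y) (\<lambda>j. S j i)) = (\<Sum>i<e. \<Sum>j<e. p x i * p y j * S j i)"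
          by (simp add: dot_def sum_distrib_left mult.assoc)
        also have "\<dots> = (\<Sum>j<e. \<Sum>i<e. p x i * p y j * S j i)" by (rule sum.swap)
        also have "\<dots> = dot e (p y) (\<lambda>i. dot e (p x) (S i))"
          by (simp add: dot_def sum_distrib_left mult_ac)
        also have "\<dots> = dot e (p y) (m x)" by (simp add: S x)
        also have "\<dots> = dot e (p x) (m y)" using assms(4) x y by (auto simp: motion_def)
        also have "\<dots> = dot e (p x) (\<lambda>i. dot e (p y) (S i))" by (simp add: S y)
        finally show ?thesis by (simp add: dot_diff_right)
      qed
      from separatingD[OF assms(3) this i] show ?thesis .
    qed
    from separatingD[OF assms(3) this j] show ?thesis .
  qed
  then have "symmetric_mat e S" by (simp add: symmetric_mat_def)
  then show thesis using ag that by blast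
qed

lemma motionD:
  assumes "motion e p X m" "\<sigma> \<in> X" "x \<in> \<sigma>" "y \<in> \<sigma>"
  shows "dot e (p x) (m y) = dot e (p y) (m x)"
  using assms unfolding motion_def by blast

lemma motion_mono: "motion e p Y m \<Longrightarrow> (\<And>\<sigma>. \<sigma> \<in> X \<Longrightarrow> \<exists>\<tau>\<in>Y. \<sigma> \<subseteq> \<tau>) \<Longrightarrow> motion e p X m"
  unfolding motion_def by (meson subsetD)

lemma motion_diff_symmetric:
  assumes "motion e p X m" "symmetric_mat e S"
  shows "motion e p X (\<lambda>x i. m x i - dot e (S i) (p x))"
  using assms(1) dot_symmetric_mat[OF assms(2)] unfolding motion_def by (auto simp: dot_diff_right)

text \<open>Subtracting the trivial motion that matches \<open>m\<close> on \<sigma> leaves a motion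
  that vanishes there, hence everywhere by pinning.\<close>

lemma pinned_imp_rigid:
  assumes "finite \<sigma>" "card \<sigma> = e" "separating e p \<sigma>" "\<sigma> \<in> X" "pinned e p X \<sigma>"
  shows "rigid e p X"
  unfolding rigid_def
proof (intro allI impI)
  fix m assume m: "motion e p X m"
  then have "motion e p {\<sigma>} m" by (rule motion_mono) (use assms(4) in auto)
  then obtain S where S: "symmetric_mat e S" "agrees e p m S \<sigma>"
    using simplex_agrees[OF assms(1-3)] by blast
  define n where "n x i = m x i - dot e (S i) (p x)" for x i
  have "motion e p X n" unfolding n_def using motion_diff_symmetric[OF m S(1)] .
  moreover have "\<forall>x\<in>\<sigma>. \<forall>i<e. n x i = 0" using S(2) by (simp add: n_def agrees_def)
  ultimately have "\<forall>x\<in>\<Union>X. \<forall>i<e. n x i = 0" using assms(5) unfolding pinned_def by blast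
  then have "agrees e p m S (\<Union>X)" by (simp add: n_def agrees_def)
  with S show "\<exists>S. symmetric_mat e S \<and> agrees e p m S (\<Union>X)" by blast
qed

lemma rigid_imp_pinned:
  assumes "rigid e p X" "separating e p \<sigma>" "\<sigma> \<subseteq> \<Union>X"
  shows "pinned e p X \<sigma>"
  unfolding pinned_def
proof (intro allI impI)
  fix m assume m: "motion e p X m" and z: "\<forall>x\<in>\<sigma>. \<forall>i<e. m x i = 0"
  obtain S where S: "agrees e p m S (\<Union>X)" using assms(1) m unfolding rigid_def by blast
  have "agrees e p m (\<lambda>i j. 0) \<sigma>" using z by (simp add: agrees_def dot_def)
  from agrees_transfer[OF agrees_mono[OF S assms(3)] this assms(2) S]
  show "\<forall>x\<in>\<Union>X. \<forall>i<e. m x i = 0" by (simp add: agrees_def dot_def)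
qed

text \<open>Row \<open>(x, y)\<close> encodes \<open>dot e (p x) (m y) - dot e (p y) (m x)\<close>,
  and column \<open>(z, i)\<close> stands for the unknown \<open>m z i\<close>.\<close>

definition rigidity_coeff :: "('v \<Rightarrow> nat \<Rightarrow> 'a::field) \<Rightarrow> 'v \<times> 'v \<Rightarrow> 'v \<times> nat \<Rightarrow> 'a" where
  "rigidity_coeff p xy zi =
     (if fst zi = snd xy then p (fst xy) (snd zi) else 0) - (if fst zi = fst xy then p (snd xy) (snd zi) else 0)"

text \<open>The second alternative of the assumption allows pinned vertices to be left out of
  \<open>W\<close>: the motion is 0 there, so their columns contribute nothing.\<close>

lemma sum_unit_row:
  assumes "finite W" "w \<in> W \<or> (\<forall>i<e. m w i = 0)"
  shows "(\<Sum>z\<in>W. \<Sum>i<e. (if z = w then q i else 0) * m z i) = dot e q (m w)"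
proof -
  have "(\<Sum>z\<in>W. \<Sum>i<e. (if z = w then q i else 0) * m z i) = (\<Sum>z\<in>W. if z = w then dot e q (m w) else 0)"
    by (intro sum.cong) (auto simp: dot_def)
  also have "\<dots> = dot e q (m w)"
    using assms by (auto simp: dot_zero)
  finally show ?thesis .
qed

lemma sum_rigidity_coeff:
  assumes "finite W" "x \<in> W \<or> (\<forall>i<e. m x i = 0)" "y \<in> W \<or> (\<forall>i<e. m y i = 0)"
  shows "(\<Sum>zi\<in>W \<times> {..<e}. rigidity_coeff p (x, y) zi * m (fst zi) (snd zi)) =
    dot e (p x) (m y) - dot e (p y) (m x)"
proof -
  have "(\<Sum>zi\<in>W \<times> {..<e}. rigidity_coeff p (x, y) zi * m (fst zi) (snd zi)) =
    (\<Sum>z\<in>W. \<Sum>i<e. ((if z = y then p x i else 0) - (if z = x then p y i else 0)) * m z i)"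
    by (simp add: sum.cartesian_product rigidity_coeff_def case_prod_beta cong: if_cong)
  also have "\<dots> = (\<Sum>z\<in>W. \<Sum>i<e. (if z = y then p x i else 0) * m z i) -
     (\<Sum>z\<in>W. \<Sum>i<e. (if z = x then p y i else 0) * m z i)"
    by (simp add: left_diff_distrib sum_subtractf)
  also have "\<dots> = dot e (p x) (m y) - dot e (p y) (m x)"
    using sum_unit_row[of W x e m, OF assms(1,2)] sum_unit_row[of W y e m, OF assms(1,3)] by simp
  finally show ?thesis .
qed

text \<open>The equation of \<open>(y, x)\<close> is that of \<open>(x, y)\<close> up to sign, and
  pairs inside \<sigma> become trivial by pinning. \<open>I\<close> is left flexible: all pairs when
  genericity is the aim, one orientation of each edge when equations are counted.\<close>

lemma pinned_iff_trivial_kernel: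
  assumes "finite (\<Union>X)"
    and I: "I \<subseteq> {(x, y). \<exists>\<tau>\<in>X. x \<in> \<tau> \<and> y \<in> \<tau>}"
      "\<And>\<tau> x y. \<tau> \<in> X \<Longrightarrow> x \<in> \<tau> \<Longrightarrow> y \<in> \<tau> \<Longrightarrow>
         x = y \<or> (x \<in> \<sigma> \<and> y \<in> \<sigma>) \<or> (x, y) \<in> I \<or> (y, x) \<in> I"
  shows "pinned e p X \<sigma> \<longleftrightarrow> trivial_kernel I ((\<Union>X - \<sigma>) \<times> {..<e}) (rigidity_coeff p)"
proof
  have fin: "finite (\<Union>X - \<sigma>)" using assms(1) by blast
  assume P: "pinned e p X \<sigma>"
  show "trivial_kernel I ((\<Union>X - \<sigma>) \<times> {..<e}) (rigidity_coeff p)"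
    unfolding trivial_kernel_def
  proof (intro allI impI)
    fix \<mu>
    assume mu: "\<forall>xy\<in>I. (\<Sum>zi\<in>(\<Union>X - \<sigma>) \<times> {..<e}. rigidity_coeff p xy zi * \<mu> zi) = 0"
    define m where "m x i = (if x \<in> \<Union>X - \<sigma> then \<mu> (x, i) else 0)" for x i
    have eq: "dot e (p x) (m y) = dot e (p y) (m x)" if "(x, y) \<in> I" for x y
    proof -
      have "(\<Sum>zi\<in>(\<Union>X - \<sigma>) \<times> {..<e}. rigidity_coeff p (x, y) zi * m (fst zi) (snd zi)) =
        (\<Sum>zi\<in>(\<Union>X - \<sigma>) \<times> {..<e}. rigidity_coeff p (x, y) zi * \<mu> zi)"
        by (intro sum.cong) (auto simp: m_def)
      also have "\<dots> = 0" using mu that by blast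
      finally show ?thesis
        by (subst (asm) sum_rigidity_coeff[OF fin]) (auto simp: m_def)
    qed
    have "motion e p X m"
      unfolding motion_def
    proof (intro ballI)
      fix \<tau> x y assume "\<tau> \<in> X" "x \<in> \<tau>" "y \<in> \<tau>"
      from I(2)[OF this] show "dot e (p x) (m y) = dot e (p y) (m x)"
        using eq eq[symmetric] by (auto simp: m_def dot_zero)
    qed
    moreover have "\<forall>x\<in>\<sigma>. \<forall>i<e. m x i = 0" by (simp add: m_def)
    ultimately have "\<forall>x\<in>\<Union>X. \<forall>i<e. m x i = 0" using P unfolding pinned_def by blast
    then show "\<forall>zi\<in>(\<Union>X - \<sigma>) \<times> {..<e}. \<mu> zi = 0" by (fastforce simp: m_def)
  qed
next
  have fin: "finite (\<Union>X - \<sigma>)" using assms(1) by blast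
  assume T: "trivial_kernel I ((\<Union>X - \<sigma>) \<times> {..<e}) (rigidity_coeff p)"
  show "pinned e p X \<sigma>"
    unfolding pinned_def
  proof (intro allI impI)
    fix m assume m: "motion e p X m" and z: "\<forall>x\<in>\<sigma>. \<forall>i<e. m x i = 0"
    have "(\<Sum>zi\<in>(\<Union>X - \<sigma>) \<times> {..<e}. rigidity_coeff p xy zi * m (fst zi) (snd zi)) = 0" if "xy \<in> I" for xy
    proof -
      obtain x y where xy: "xy = (x, y)" by force
      have "xy \<in> {(x, y). \<exists>\<tau>\<in>X. x \<in> \<tau> \<and> y \<in> \<tau>}" using I(1) that by blast
      then obtain \<tau> where \<tau>: "\<tau> \<in> X" "x \<in> \<tau>" "y \<in> \<tau>" unfolding xy by auto
      then have "dot e (p x) (m y) - dot e (p y) (m x) = 0" using m unfolding motion_def by auto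
      then show ?thesis unfolding xy
        by (subst sum_rigidity_coeff[OF fin]) (use z \<tau> in auto)
    qed
    with T have "\<forall>zi\<in>(\<Union>X - \<sigma>) \<times> {..<e}. m (fst zi) (snd zi) = 0"
      unfolding trivial_kernel_def by (elim allE[of _ "\<lambda>zi. m (fst zi) (snd zi)"]) auto
    then show "\<forall>x\<in>\<Union>X. \<forall>i<e. m x i = 0" using z by fastforce
  qed
qed

lemma generic_pinned:
  fixes p0 :: "'v \<Rightarrow> nat \<Rightarrow> 'a::field"
  assumes "finite (\<Union>X)" "pinned e p0 X \<sigma>"
  shows "generic (\<lambda>p :: 'v \<Rightarrow> nat \<Rightarrow> 'a. pinned e p X \<sigma>)"
proof -
  define I where "I = {(x, y). \<exists>\<tau>\<in>X. x \<in> \<tau> \<and> y \<in> \<tau>}"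
  have eq: "pinned e p X \<sigma> \<longleftrightarrow> trivial_kernel I ((\<Union>X - \<sigma>) \<times> {..<e}) (rigidity_coeff p)"
    for p :: "'v \<Rightarrow> nat \<Rightarrow> 'a"
    using assms(1) by (rule pinned_iff_trivial_kernel) (auto simp: I_def)
  have "finite ((\<Union>X - \<sigma>) \<times> {..<e})" using assms(1) by blast
  moreover have "(\<lambda>p. rigidity_coeff p i j) \<in> polyfun" for i j
    unfolding rigidity_coeff_def by (intro polyfun_diff polyfun_if polyfun_coord polyfun_const)
  ultimately have "\<exists>D\<in>polyfun. D p0 \<noteq> 0 \<and>
      (\<forall>p. D p \<noteq> 0 \<longrightarrow> trivial_kernel I ((\<Union>X - \<sigma>) \<times> {..<e}) (rigidity_coeff p))"
    by (rule trivial_kernel_open) (use assms(2) eq in simp)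
  then show ?thesis unfolding generic_def eq by blast
qed

text \<open>One rigid placement suffices, even a special one, as long as some simplex is placed on a
  basis: pinning that simplex turns rigidity into an open condition.\<close>

lemma generic_rigid_of_rigid:
  fixes p0 :: "'v \<Rightarrow> nat \<Rightarrow> 'a::field_char_0"
  assumes "finite (\<Union>X)" "rigid e p0 X" "\<sigma> \<in> X" "card \<sigma> = e" "separating e p0 \<sigma>"
  shows "generic (\<lambda>p :: 'v \<Rightarrow> nat \<Rightarrow> 'a. rigid e p X)"
proof -
  have fin: "finite \<sigma>" using assms(1,3) by (meson Union_upper finite_subset)
  have "pinned e p0 X \<sigma>" using rigid_imp_pinned[OF assms(2,5)] assms(3) by blast
  from generic_conj[OF generic_pinned[OF assms(1) this] generic_separating[OF fin assms(4)]]
  show ?thesis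
    by (rule generic_mono) (use pinned_imp_rigid fin assms in blast)
qed

text \<open>The cone point is placed at a new basis vector orthogonal to the base. Its edges kill
  the new coordinate of a pinned motion, and the other coordinates form a motion of the base in
  dimension \<open>e\<close>.\<close>

lemma generic_rigid_cone:
  assumes "finite (\<Union>X)" "\<sigma> \<in> X" "card \<sigma> = e" "v \<notin> \<Union>X"
    and gen: "generic (\<lambda>p :: 'v \<Rightarrow> nat \<Rightarrow> 'a::field_char_0. rigid e p X)"
  shows "generic (\<lambda>p :: 'v \<Rightarrow> nat \<Rightarrow> 'a. rigid (Suc e) p (insert v ` X))"
proof -
  have fin: "finite \<sigma>" using assms(1,2) by (meson Union_upper finite_subset)
  have "generic (\<lambda>p :: 'v \<Rightarrow> nat \<Rightarrow> 'a. rigid e p X \<and> separating e p \<sigma>)"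
    by (intro generic_conj gen generic_separating fin assms(3))
  then obtain q :: "'v \<Rightarrow> nat \<Rightarrow> 'a" where q: "rigid e q X" "separating e q \<sigma>"
    using generic_ex by blast
  then have pq: "pinned e q X \<sigma>" using rigid_imp_pinned assms(2) by blast
  \<comment> \<open>Coordinates are numbered from 0, so \<open>e\<close> is the new one:
    \<open>v\<close> becomes the unit vector there, and all other vertices have entry 0.\<close>
  define q' where "q' x i = (if x = v then (if i = e then 1 else 0) else if i = e then 0 else q x i)" for x i
  have "pinned (Suc e) q' (insert v ` X) (insert v \<sigma>)"
    unfolding pinned_def
  proof (intro allI impI)
    fix m assume m: "motion (Suc e) q' (insert v ` X) m"
      and z: "\<forall>x\<in>insert v \<sigma>. \<forall>i<Suc e. m x i = 0"
    have me: "m x e = 0" if "x \<in> \<tau>" "\<tau> \<in> X" for x \<tau>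
    proof -
      have "dot (Suc e) (q' v) (m x) = dot (Suc e) (q' x) (m v)"
        using that by (intro motionD[OF m, of "insert v \<tau>"]) auto
      also have "\<dots> = 0" using z by (simp add: dot_zero)
      finally show ?thesis by (simp add: dot_def q'_def)
    qed
    have "motion e q X m"
      unfolding motion_def
    proof (intro ballI)
      fix \<tau> x y assume \<tau>: "\<tau> \<in> X" "x \<in> \<tau>" "y \<in> \<tau>"
      have xv: "x \<noteq> v" "y \<noteq> v" using \<tau> assms(4) by auto
      have "dot (Suc e) (q' x) (m y) = dot (Suc e) (q' y) (m x)"
        using \<tau> by (intro motionD[OF m, of "insert v \<tau>"]) auto
      then show "dot e (q x) (m y) = dot e (q y) (m x)"
        using xv by (simp add: dot_def q'_def)
    qed
    then have "\<forall>x\<in>\<Union>X. \<forall>i<e. m x i = 0"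
      using pq z unfolding pinned_def by (metis insertCI less_SucI)
    then show "\<forall>x\<in>\<Union>(insert v ` X). \<forall>i<Suc e. m x i = 0"
      using me z by (auto simp: less_Suc_eq)
  qed
  moreover have "finite (\<Union>(insert v ` X))"
  proof -
    have "\<Union>(insert v ` X) \<subseteq> insert v (\<Union>X)" by blast
    then show ?thesis using assms(1) by (meson finite_insert finite_subset)
  qed
  ultimately have "generic (\<lambda>p :: 'v \<Rightarrow> nat \<Rightarrow> 'a. pinned (Suc e) p (insert v ` X) (insert v \<sigma>))"
    using generic_pinned by blast
  moreover have "v \<notin> \<sigma>" using assms by blast
  then have "card (insert v \<sigma>) = Suc e" using fin assms(3) by simp
  then have "generic (\<lambda>p :: 'v \<Rightarrow> nat \<Rightarrow> 'a. separating (Suc e) p (insert v \<sigma>))"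
    using fin by (intro generic_separating) auto
  ultimately have "generic (\<lambda>p :: 'v \<Rightarrow> nat \<Rightarrow> 'a. pinned (Suc e) p (insert v ` X) (insert v \<sigma>) \<and>
      separating (Suc e) p (insert v \<sigma>))"
    by (rule generic_conj)
  then show ?thesis
    by (rule generic_mono)
      (use pinned_imp_rigid[of "insert v \<sigma>" "Suc e"] fin assms(2) \<open>card (insert v \<sigma>) = Suc e\<close> in blast)
qed

section \<open>Cycles modulo 2 and edge contraction\<close>

text \<open>The coefficient of \<tau> in the boundary of the chain \<open>Z\<close> modulo
  2.\<close>

definition parity :: "'v set \<Rightarrow> 'v set set \<Rightarrow> 'v set \<Rightarrow> bit" where
  "parity V Z \<tau> = (\<Sum>x\<in>V - \<tau>. of_bool (insert x \<tau> \<in> Z))"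

text \<open>\<open>e\<close> is the number of vertices of the simplices, one more than their
  dimension. Quantifying over all sets \<tau> costs nothing, since the parity is 0 unless one more
  vertex completes \<tau> to a simplex of \<open>Z\<close>.\<close>

definition mod2_cycle :: "'v set \<Rightarrow> nat \<Rightarrow> 'v set set \<Rightarrow> bool" where
  "mod2_cycle V e Z \<longleftrightarrow> (\<forall>\<sigma>\<in>Z. \<sigma> \<subseteq> V \<and> card \<sigma> = e) \<and> (\<forall>\<tau>. parity V Z \<tau> = 0)"

definition minimal_cycle :: "'v set \<Rightarrow> nat \<Rightarrow> 'v set set \<Rightarrow> bool" where
  "minimal_cycle V e Z \<longleftrightarrow>
     mod2_cycle V e Z \<and> Z \<noteq> {} \<and> (\<forall>Y\<subseteq>Z. mod2_cycle V e Y \<longrightarrow> Y \<noteq> {} \<longrightarrow> Y = Z)"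

lemma bit_add_eq_0_iff: "a + b = 0 \<longleftrightarrow> a = (b :: bit)"
  by (cases a; cases b) simp_all

lemma of_bool_eq_bit: "(P \<longleftrightarrow> b \<noteq> 0) \<Longrightarrow> of_bool P = (b :: bit)"
  by (cases b; cases P) simp_all

lemma bit_add_self: "b + b = (0 :: bit)"
  by (simp add: bit_add_eq_0_iff)

lemma bit_cancel: "s = a + s + (a :: bit)"
  by (cases a; cases s) simp_all

lemma parity_nonzeroE:
  assumes "parity V Z \<tau> \<noteq> 0"
  obtains x where "x \<in> V" "x \<notin> \<tau>" "insert x \<tau> \<in> Z"
proof -
  have "\<exists>x\<in>V - \<tau>. insert x \<tau> \<in> Z"
    using assms unfolding parity_def by (rule contrapos_np) (auto intro: sum.neutral)
  then show thesis using that by blast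
qed

lemma parity_empty [simp]: "parity V {} \<tau> = 0"
  by (simp add: parity_def)

lemma parity_Diff: "Y \<subseteq> Z \<Longrightarrow> parity V (Z - Y) \<tau> = parity V Z \<tau> + parity V Y \<tau>"
  unfolding parity_def sum.distrib[symmetric] by (intro sum.cong) auto

lemma parity_Un: "Y \<inter> Z = {} \<Longrightarrow> parity V (Y \<union> Z) \<tau> = parity V Y \<tau> + parity V Z \<tau>"
  unfolding parity_def sum.distrib[symmetric] by (intro sum.cong) auto

lemma parity_Union:
  assumes "finite \<Q>" "pairwise disjnt \<Q>"
  shows "parity V (\<Union>\<Q>) \<tau> = (\<Sum>Q\<in>\<Q>. parity V Q \<tau>)"
  using assms
proof (induction \<Q>)
  case (insert Q \<Q>)
  have "Q \<inter> \<Union>\<Q> = {}"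
    using insert.prems insert.hyps by (auto simp: pairwise_insert disjnt_def)
  then show ?case using insert by (simp add: parity_Un pairwise_insert)
qed simp

text \<open>The square of the boundary is 0 modulo 2: every pair of vertices that completes \<eta>
  to a simplex is counted twice.\<close>

lemma sum_parity_insert:
  assumes "finite V"
  shows "(\<Sum>x\<in>V - \<eta>. parity V Z (insert x \<eta>)) = 0"
proof -
  define g :: "'a \<Rightarrow> 'a \<Rightarrow> bit" where
    "g x y = (if x = y then 0 else of_bool (insert y (insert x \<eta>) \<in> Z))" for x y
  have "parity V Z (insert x \<eta>) = (\<Sum>y\<in>V - \<eta>. g x y)" if "x \<in> V - \<eta>" for x
  proof -
    have "(\<Sum>y\<in>V - \<eta>. g x y) = g x x + (\<Sum>y\<in>V - \<eta> - {x}. g x y)"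
      using assms that by (intro sum.remove) auto
    also have "(\<Sum>y\<in>V - \<eta> - {x}. g x y) = parity V Z (insert x \<eta>)"
      unfolding parity_def by (intro sum.cong) (auto simp: g_def)
    finally show ?thesis by (simp add: g_def)
  qed
  then have "(\<Sum>x\<in>V - \<eta>. parity V Z (insert x \<eta>)) = (\<Sum>x\<in>V - \<eta>. \<Sum>y\<in>V - \<eta>. g x y)"
    by (intro sum.cong) auto
  also have "\<dots> = 0"
    using assms by (intro sum_alternating_eq_0) (auto simp: g_def insert_commute)
  finally show ?thesis .
qed

lemma mod2_cycle_Diff: "mod2_cycle V e Z \<Longrightarrow> mod2_cycle V e Y \<Longrightarrow> Y \<subseteq> Z \<Longrightarrow> mod2_cycle V e (Z - Y)"
  by (simp add: mod2_cycle_def parity_Diff)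

text \<open>A nonempty proper subcycle splits off, and its complement is again a cycle.\<close>

lemma mod2_cycle_partition:
  assumes "finite Z" "mod2_cycle V e Z"
  shows "\<exists>\<D>. (\<forall>B\<in>\<D>. minimal_cycle V e B) \<and> pairwise disjnt \<D> \<and> \<Union>\<D> = Z"
  using assms
proof (induction Z rule: finite_psubset_induct)
  case (psubset Z)
  have "minimal_cycle V e Z" if "Z \<noteq> {}" "\<not> (\<exists>Y\<subset>Z. mod2_cycle V e Y \<and> Y \<noteq> {})"
    using that psubset.prems by (auto simp: minimal_cycle_def)
  then consider "Z = {}" | "minimal_cycle V e Z" | Y where "Y \<subset> Z" "mod2_cycle V e Y" "Y \<noteq> {}"
    by blast
  then show ?case
  proof cases
    case 1
    then show ?thesis by (intro exI[of _ "{}"]) simp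
  next
    case 2
    then show ?thesis by (intro exI[of _ "{Z}"]) simp
  next
    case (3 Y)
    have "mod2_cycle V e (Z - Y)" using mod2_cycle_Diff psubset.prems 3 by blast
    moreover have "Z - Y \<subset> Z" using 3 by blast
    ultimately obtain \<E> where E: "\<forall>B\<in>\<E>. minimal_cycle V e B" "pairwise disjnt \<E>" "\<Union>\<E> = Z - Y"
      using psubset.IH[of "Z - Y"] by blast
    obtain \<D> where D: "\<forall>B\<in>\<D>. minimal_cycle V e B" "pairwise disjnt \<D>" "\<Union>\<D> = Y"
      using psubset.IH[of Y] 3 by blast
    have "disjnt A B" if "A \<in> \<D>" "B \<in> \<E>" for A B
      using that D(3) E(3) by (auto simp: disjnt_def)
    then have "pairwise disjnt (\<D> \<union> \<E>)"
      using D(2) E(2) unfolding pairwise_def by (auto simp: disjnt_sym)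
    moreover have "\<Union>(\<D> \<union> \<E>) = Z" using D(3) E(3) 3(1) by auto
    ultimately show ?thesis using D(1) E(1) by (intro exI[of _ "\<D> \<union> \<E>"]) auto
  qed
qed

text \<open>Of the simplices that contain both \<open>u\<close> and \<open>v\<close>, only
  \<open>insert v (insert u \<omega>)\<close> has \<open>insert u \<omega>\<close> as a face of
  codimension 1.\<close>

lemma parity_edge:
  assumes "finite V" "v \<in> V" "v \<notin> insert u \<omega>"
  shows "parity V Z (insert u \<omega>) =
    parity V {\<sigma>\<in>Z. \<not> (u \<in> \<sigma> \<and> v \<in> \<sigma>)} (insert u \<omega>) + of_bool (insert v (insert u \<omega>) \<in> Z)"
proof -
  define R where "R = V - insert u \<omega> - {v}"
  have R: "V - insert u \<omega> = insert v R" "v \<notin> R" "finite R"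
    using assms by (auto simp: R_def)
  have "(\<Sum>x\<in>R. of_bool (insert x (insert u \<omega>) \<in> Z) :: bit) =
    (\<Sum>x\<in>R. of_bool (insert x (insert u \<omega>) \<in> {\<sigma>\<in>Z. \<not> (u \<in> \<sigma> \<and> v \<in> \<sigma>)}))"
    using assms by (intro sum.cong) (auto simp: R_def)
  moreover have "of_bool (insert v (insert u \<omega>) \<in> {\<sigma>\<in>Z. \<not> (u \<in> \<sigma> \<and> v \<in> \<sigma>)}) = (0 :: bit)" by simp
  ultimately show ?thesis
    unfolding parity_def R(1) sum.insert[OF R(3,2)] by (simp only: add_0_left add.commute)
qed

lemma parity_no_edge:
  assumes "u \<notin> \<tau>" "v \<notin> \<tau>" "u \<noteq> v"
  shows "parity V {\<sigma>\<in>Z. \<not> (u \<in> \<sigma> \<and> v \<in> \<sigma>)} \<tau> = parity V Z \<tau>"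
  unfolding parity_def using assms by (intro sum.cong) auto

text \<open>
  The simplices on which a motion is given by one symmetric matrix \<open>S0\<close> form a cycle, so
  minimality makes them all of \<open>X\<close>. The pieces of the partition are the preimages of the minimal
  cycles of the contracted complex; the matrix on a simplex containing \<open>uv\<close> is forced by any
  piece that has this simplex, with \<open>u\<close> or \<open>v\<close> removed, in its boundary.
\<close>

lemma agrees_of_partition:
  assumes V: "finite V" "u \<in> V" "v \<in> V" "u \<noteq> v"
    and X: "minimal_cycle V e X"
    and part: "\<Union>\<Q> = {\<sigma>\<in>X. \<not> (u \<in> \<sigma> \<and> v \<in> \<sigma>)}" "pairwise disjnt \<Q>"
    and par0: "\<And>Q \<tau>. Q \<in> \<Q> \<Longrightarrow> u \<notin> \<tau> \<Longrightarrow> v \<notin> \<tau> \<Longrightarrow> parity V Q \<tau> = 0"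
    and par1: "\<And>Q \<omega>. Q \<in> \<Q> \<Longrightarrow> u \<notin> \<omega> \<Longrightarrow> v \<notin> \<omega> \<Longrightarrow>
      parity V Q (insert u \<omega>) = parity V Q (insert v \<omega>)"
    and rig: "\<And>Q. Q \<in> \<Q> \<Longrightarrow> \<exists>S. agrees e p m S (\<Union>Q)"
    and sep: "\<And>\<sigma>. \<sigma> \<subseteq> V \<Longrightarrow> card \<sigma> = e \<Longrightarrow> separating e p \<sigma>"
    and S0: "\<sigma>0 \<in> X" "agrees e p m S0 \<sigma>0"
  shows "agrees e p m S0 (\<Union>X)"
proof -
  have XV: "\<sigma> \<subseteq> V" "card \<sigma> = e" if "\<sigma> \<in> X" for \<sigma>
    using X that unfolding minimal_cycle_def mod2_cycle_def by auto
  have parX: "parity V X \<tau> = 0" for \<tau>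
    using X unfolding minimal_cycle_def mod2_cycle_def by auto
  have finX: "finite X" using XV(1) V(1) by (meson PowI finite_Pow_iff finite_subset subsetI)
  have QX: "\<Union>\<Q> \<subseteq> X" using part(1) by blast
  have finQ: "finite \<Q>" using QX finX by (meson Union_upper finite_Pow_iff finite_subset subset_trans PowI subsetI)
  define N where "N = {\<sigma>\<in>X. \<not> (u \<in> \<sigma> \<and> v \<in> \<sigma>)}"
  define Y where "Y = {\<sigma>\<in>X. agrees e p m S0 \<sigma>}"
  define NY where "NY = {\<sigma>\<in>Y. \<not> (u \<in> \<sigma> \<and> v \<in> \<sigma>)}"
  have YX: "Y \<subseteq> X" and NYN: "NY \<subseteq> N" by (auto simp: Y_def NY_def N_def)
  \<comment> \<open>One matrix describes the motion on all of \<open>Q\<close>. If \<open>S0\<close>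
    describes it on one simplex of \<open>Q\<close>, the two matrices coincide, because that simplex
    is placed on a basis.\<close>
  have dich: "Q \<subseteq> Y \<or> Q \<inter> Y = {}" if Q: "Q \<in> \<Q>" for Q
  proof (rule ccontr)
    assume "\<not> (Q \<subseteq> Y \<or> Q \<inter> Y = {})"
    then obtain \<sigma> \<rho> where s: "\<sigma> \<in> Q" "\<sigma> \<in> Y" "\<rho> \<in> Q" "\<rho> \<notin> Y" by blast
    obtain S where S: "agrees e p m S (\<Union>Q)" using rig[OF Q] ..
    have "\<sigma> \<in> X" using s YX by blast
    then have "separating e p \<sigma>" using sep XV by blast
    moreover have "agrees e p m S \<sigma>" using agrees_mono[OF S] s by blast
    moreover have "agrees e p m S0 \<sigma>" using s by (simp add: Y_def)
    moreover have "agrees e p m S \<rho>" using agrees_mono[OF S] s by blast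
    ultimately have "agrees e p m S0 \<rho>" using agrees_transfer by blast
    then show False using s QX Q by (auto simp: Y_def)
  qed
  define \<Y> where "\<Y> = {Q\<in>\<Q>. Q \<subseteq> Y}"
  define \<R> where "\<R> = {Q\<in>\<Q>. Q \<inter> Y = {}}"
  have UY: "NY = \<Union>\<Y>"
  proof -
    have "\<sigma> \<in> \<Union>\<Y>" if "\<sigma> \<in> NY" for \<sigma>
    proof -
      have "\<sigma> \<in> \<Union>\<Q>" using that part(1) by (auto simp: NY_def Y_def)
      then obtain Q where "Q \<in> \<Q>" "\<sigma> \<in> Q" by blast
      moreover from this have "Q \<subseteq> Y" using dich that by (auto simp: NY_def)
      ultimately show ?thesis by (auto simp: \<Y>_def)
    qed
    moreover have "\<Union>\<Y> \<subseteq> NY" using part(1) by (auto simp: \<Y>_def NY_def)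
    ultimately show ?thesis by blast
  qed
  have UR: "N - NY = \<Union>\<R>"
  proof -
    have "\<sigma> \<in> \<Union>\<R>" if "\<sigma> \<in> N - NY" for \<sigma>
    proof -
      have "\<sigma> \<in> \<Union>\<Q>" using that part(1) by (auto simp: N_def)
      then obtain Q where "Q \<in> \<Q>" "\<sigma> \<in> Q" by blast
      moreover from this have "Q \<inter> Y = {}" using dich[of Q] that by (auto simp: NY_def N_def)
      ultimately show ?thesis by (auto simp: \<R>_def)
    qed
    moreover have "\<Union>\<R> \<subseteq> N - NY" using part(1) by (auto simp: \<R>_def NY_def N_def)
    ultimately show ?thesis by blast
  qed
  have parY: "parity V NY \<tau> = (\<Sum>Q\<in>\<Y>. parity V Q \<tau>)" for \<tau>
    unfolding UY by (rule parity_Union)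
      (use finQ part(2) in \<open>auto simp: \<Y>_def intro: pairwise_subset\<close>)
  have parR: "parity V (N - NY) \<tau> = (\<Sum>Q\<in>\<R>. parity V Q \<tau>)" for \<tau>
    unfolding UR by (rule parity_Union)
      (use finQ part(2) in \<open>auto simp: \<R>_def intro: pairwise_subset\<close>)
  have h0: "parity V NY \<tau> = 0" if "u \<notin> \<tau>" "v \<notin> \<tau>" for \<tau>
    unfolding parY using par0 that by (intro sum.neutral) (auto simp: \<Y>_def)
  have h1: "parity V NY (insert u \<omega>) = parity V NY (insert v \<omega>)" if "u \<notin> \<omega>" "v \<notin> \<omega>" for \<omega>
    unfolding parY using par1 that by (intro sum.cong) (auto simp: \<Y>_def)
  \<comment> \<open>By \<open>h1\<close> the boundary of \<open>NY\<close> contains \<omega>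
    extended by \<open>u\<close> and also \<omega> extended by \<open>v\<close>; simplices of
    \<open>NY\<close> above these two faces cover \<omega>, \<open>u\<close> and
    \<open>v\<close>.\<close>
  have agree: "agrees e p m S0 (insert v (insert u \<omega>))"
    if w: "u \<notin> \<omega>" "v \<notin> \<omega>" "parity V NY (insert u \<omega>) \<noteq> 0" for \<omega>
  proof -
    obtain x where "insert x (insert u \<omega>) \<in> NY" using w(3) by (rule parity_nonzeroE)
    then have "agrees e p m S0 (insert x (insert u \<omega>))" by (auto simp: NY_def Y_def)
    moreover have "parity V NY (insert v \<omega>) \<noteq> 0" using w h1 by simp
    then obtain y where "insert y (insert v \<omega>) \<in> NY" by (rule parity_nonzeroE)
    then have "agrees e p m S0 (insert y (insert v \<omega>))" by (auto simp: NY_def Y_def)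
    ultimately show ?thesis unfolding agrees_def by blast
  qed
  \<comment> \<open>Some piece disjoint from \<open>Y\<close> has both of these faces in its
    boundary and therefore all vertices of the simplex. Agreement there would identify its matrix
    with \<open>S0\<close> and put the piece into \<open>Y\<close>.\<close>
  have disagree: "\<not> agrees e p m S0 (insert v (insert u \<omega>))"
    if w: "u \<notin> \<omega>" "v \<notin> \<omega>" "parity V (N - NY) (insert u \<omega>) \<noteq> 0" for \<omega>
  proof
    assume ag: "agrees e p m S0 (insert v (insert u \<omega>))"
    obtain Q where Q: "Q \<in> \<R>" "parity V Q (insert u \<omega>) \<noteq> 0"
      using w(3) unfolding parR by (meson sum.neutral)
    then have QQ: "Q \<in> \<Q>" "Q \<inter> Y = {}" by (auto simp: \<R>_def)
    obtain x where x: "x \<notin> insert u \<omega>" "insert x (insert u \<omega>) \<in> Q" using Q(2) by (rule parity_nonzeroE)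
    have "parity V Q (insert v \<omega>) \<noteq> 0" using Q w par1[OF QQ(1)] by simp
    then obtain y where y: "insert y (insert v \<omega>) \<in> Q" by (rule parity_nonzeroE)
    have xX: "insert x (insert u \<omega>) \<in> X" using x QQ QX by blast
    have "finite (insert x (insert u \<omega>))" using XV(1)[OF xX] V(1) by (rule finite_subset)
    then have "card (insert v (insert u \<omega>)) = card (insert x (insert u \<omega>))"
      using x w V(4) by simp
    then have "card (insert v (insert u \<omega>)) = e" using XV(2)[OF xX] by simp
    moreover have "insert v (insert u \<omega>) \<subseteq> V" using XV(1)[OF xX] V by auto
    ultimately have sepk: "separating e p (insert v (insert u \<omega>))" using sep by blast
    obtain S where S: "agrees e p m S (\<Union>Q)" using rig[OF QQ(1)] ..
    have "insert v (insert u \<omega>) \<subseteq> \<Union>Q" using x y by blast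
    then have "agrees e p m S (insert v (insert u \<omega>))" using agrees_mono[OF S] by blast
    from agrees_transfer[OF this ag sepk S] have "agrees e p m S0 (\<Union>Q)" .
    then have "agrees e p m S0 (insert x (insert u \<omega>))" using x by (auto intro: agrees_mono)
    then have "insert x (insert u \<omega>) \<in> Y" using xX by (simp add: Y_def)
    then show False using x QQ by blast
  qed
  \<comment> \<open>As \<open>X\<close> is a cycle, a simplex containing the edge lies in
    \<open>X\<close> exactly if the boundary coefficients of \<open>NY\<close> and of
    \<open>N - NY\<close> differ. By \<open>agree\<close> and \<open>disagree\<close> the
    coefficient of \<open>NY\<close> then decides membership in \<open>Y\<close>.\<close>
  have key: "insert v (insert u \<omega>) \<in> Y \<longleftrightarrow> parity V NY (insert u \<omega>) \<noteq> 0"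
    if w: "u \<notin> \<omega>" "v \<notin> \<omega>" for \<omega>
  proof -
    have "v \<notin> insert u \<omega>" using w V(4) by simp
    from parity_edge[OF V(1,3) this, of X]
    have "parity V N (insert u \<omega>) + of_bool (insert v (insert u \<omega>) \<in> X) = 0"
      unfolding N_def parX by (rule sym)
    then have "parity V N (insert u \<omega>) = of_bool (insert v (insert u \<omega>) \<in> X)"
      by (rule bit_add_eq_0_iff[THEN iffD1])
    moreover have "parity V (N - NY) (insert u \<omega>) =
        parity V N (insert u \<omega>) + parity V NY (insert u \<omega>)"
      by (rule parity_Diff[OF NYN])
    ultimately have eq: "parity V (N - NY) (insert u \<omega>) =
        of_bool (insert v (insert u \<omega>) \<in> X) + parity V NY (insert u \<omega>)" by simp
    show ?thesis
    proof
      assume L: "insert v (insert u \<omega>) \<in> Y"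
      then have "agrees e p m S0 (insert v (insert u \<omega>))" by (simp add: Y_def)
      then have "parity V (N - NY) (insert u \<omega>) = 0" using disagree[OF w] by blast
      moreover have "insert v (insert u \<omega>) \<in> X" using L by (simp add: Y_def)
      ultimately show "parity V NY (insert u \<omega>) \<noteq> 0" using eq by (auto simp: bit_add_eq_0_iff)
    next
      assume R: "parity V NY (insert u \<omega>) \<noteq> 0"
      have ag: "agrees e p m S0 (insert v (insert u \<omega>))" using agree[OF w R] .
      then have "parity V (N - NY) (insert u \<omega>) = 0" using disagree[OF w] by blast
      then have "insert v (insert u \<omega>) \<in> X" using eq R by (auto split: if_splits)
      then show "insert v (insert u \<omega>) \<in> Y" using ag by (simp add: Y_def)
    qed
  qed
  have keyb: "of_bool (insert v (insert u \<omega>) \<in> Y) = parity V NY (insert u \<omega>)"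
    if w: "u \<notin> \<omega>" "v \<notin> \<omega>" for \<omega>
    by (rule of_bool_eq_bit[OF key[OF w]])
  have "parity V Y \<tau> = 0" for \<tau>
  proof -
    consider "u \<notin> \<tau>" "v \<notin> \<tau>" | \<omega> where "\<tau> = insert u \<omega>" "u \<notin> \<omega>" "v \<notin> \<omega>"
      | \<omega> where "\<tau> = insert v \<omega>" "u \<notin> \<omega>" "v \<notin> \<omega>" | \<eta> where "\<tau> = insert v (insert u \<eta>)" "u \<notin> \<eta>" "v \<notin> \<eta>"
    proof -
      have "\<tau> = insert v (insert u (\<tau> - {u, v}))" if "u \<in> \<tau>" "v \<in> \<tau>" using that by blast
      then show thesis
        using that(1) that(2)[of "\<tau> - {u}"] that(3)[of "\<tau> - {v}"] that(4)[of "\<tau> - {u, v}"]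
        by (cases "u \<in> \<tau>"; cases "v \<in> \<tau>") (simp_all add: insert_absorb)
    qed
    then show ?thesis
    proof cases
      case 1
      then show ?thesis using parity_no_edge[OF 1 V(4), of V Y] h0 by (simp add: NY_def)
    next
      case (2 \<omega>)
      have "parity V Y \<tau> = parity V NY (insert u \<omega>) + of_bool (insert v (insert u \<omega>) \<in> Y)"
        unfolding 2(1) NY_def using 2 V(4) by (intro parity_edge V(1,3)) simp
      then show ?thesis unfolding keyb[OF 2(2,3)] bit_add_self .
    next
      case (3 \<omega>)
      have eq: "{\<sigma>\<in>Y. \<not> (v \<in> \<sigma> \<and> u \<in> \<sigma>)} = NY" by (auto simp: NY_def)
      have "u \<notin> insert v \<omega>" using 3 V(4) by simp
      from parity_edge[OF V(1,2) this, of Y]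
      have "parity V Y \<tau> = parity V NY (insert v \<omega>) + of_bool (insert v (insert u \<omega>) \<in> Y)"
        unfolding 3(1) eq insert_commute[of u v] .
      then show ?thesis unfolding keyb[OF 3(2,3)] h1[OF 3(2,3)] bit_add_self .
    next
      case (4 \<eta>)
      \<comment> \<open>Every simplex above this \<tau> contains the edge, so \<open>keyb\<close>
        turns the parity into the vanishing double boundary of \<open>NY\<close> at
        \<open>insert u \<eta>\<close>. Its extra term for \<open>v\<close> is 0, since no simplex
        of \<open>NY\<close> contains the edge.\<close>
      have V': "V - insert u \<eta> = insert v (V - \<tau>)" "v \<notin> V - \<tau>" using 4 V by auto
      have "parity V Y \<tau> = (\<Sum>x\<in>V - \<tau>. parity V NY (insert x (insert u \<eta>)))"
        unfolding parity_def[of V Y]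
      proof (rule sum.cong[OF refl])
        fix x assume x: "x \<in> V - \<tau>"
        then have "u \<notin> insert x \<eta>" "v \<notin> insert x \<eta>" using 4 by auto
        from keyb[OF this] show "of_bool (insert x \<tau> \<in> Y) = parity V NY (insert x (insert u \<eta>))"
          unfolding 4(1) by (simp only: insert_commute)
      qed
      also have "\<dots> = (\<Sum>x\<in>V - insert u \<eta>. parity V NY (insert x (insert u \<eta>))) +
          parity V NY (insert v (insert u \<eta>))"
        unfolding V'(1) sum.insert[OF finite_Diff[OF V(1)] V'(2)] by (rule bit_cancel)
      also have "(\<Sum>x\<in>V - insert u \<eta>. parity V NY (insert x (insert u \<eta>))) = 0"
        using V(1) by (rule sum_parity_insert)
      also have "parity V NY (insert v (insert u \<eta>)) = 0"
        by (rule ccontr, erule parity_nonzeroE) (auto simp: NY_def)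
      finally show ?thesis by simp
    qed
  qed
  then have "mod2_cycle V e Y" using XV YX by (auto simp: mod2_cycle_def)
  moreover have "\<sigma>0 \<in> Y" using S0 by (simp add: Y_def)
  ultimately have "Y = X" using X YX unfolding minimal_cycle_def by blast
  then show ?thesis unfolding agrees_def Y_def by blast
qed

section \<open>Edge contraction and vertex splitting\<close>

definition contract :: "'v \<Rightarrow> 'v \<Rightarrow> 'v set \<Rightarrow> 'v set" where
  "contract u v \<sigma> = (if v \<in> \<sigma> then insert u (\<sigma> - {v}) else \<sigma>)"

text \<open>Vertex splitting, with \<open>v\<close> placed at the position of \<open>u\<close>. The
  common neighbours \<open>C\<close> and the edge \<open>{u, v}\<close> give e equations against a
  basis, which force \<open>m u = m v\<close>, so the motion descends to the contracted
  complex.\<close>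

lemma generic_rigid_split:
  assumes V: "finite V" "u \<noteq> v" "u \<in> V" "v \<in> V"
    and Q: "Q \<noteq> {}" "\<And>\<sigma>. \<sigma> \<in> Q \<Longrightarrow> \<sigma> \<subseteq> V \<and> card \<sigma> = e \<and> card (contract u v \<sigma>) = e"
    and B: "generic (\<lambda>p :: 'v \<Rightarrow> nat \<Rightarrow> 'a::field_char_0. rigid e p (contract u v ` Q))"
    and C: "C \<subseteq> V" "card (insert u C) = e" "u \<notin> C" "v \<notin> C" "C \<noteq> {}"
      "\<And>c. c \<in> C \<Longrightarrow> \<exists>\<sigma>\<in>Q. u \<in> \<sigma> \<and> c \<in> \<sigma>"
      "\<And>c. c \<in> C \<Longrightarrow> \<exists>\<sigma>\<in>Q. v \<in> \<sigma> \<and> c \<in> \<sigma>"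
  shows "generic (\<lambda>p :: 'v \<Rightarrow> nat \<Rightarrow> 'a. rigid e p (insert {u, v} Q))"
proof -
  define g where "g = contract u v"
  have gv: "v \<notin> g \<sigma>" for \<sigma> using V(2) by (simp add: g_def contract_def)
  have gV: "g \<sigma> \<subseteq> V" if "\<sigma> \<in> Q" for \<sigma> using Q(2)[OF that] V(3) by (auto simp: g_def contract_def)
  have gm: "x \<in> g \<sigma> \<or> x = v" if "x \<in> \<sigma>" for x \<sigma> using that by (auto simp: g_def contract_def)
  have "generic (\<lambda>p :: 'v \<Rightarrow> nat \<Rightarrow> 'a. rigid e p (g ` Q) \<and>
      (\<forall>\<sigma>\<in>{\<sigma>. \<sigma> \<subseteq> V \<and> card \<sigma> = e}. separating e p \<sigma>))"
    using B V(1) unfolding g_def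
    by (intro generic_conj generic_ball generic_separating) (auto intro: finite_subset)
  then obtain q :: "'v \<Rightarrow> nat \<Rightarrow> 'a" where q: "rigid e q (g ` Q)"
    "\<And>\<sigma>. \<sigma> \<subseteq> V \<Longrightarrow> card \<sigma> = e \<Longrightarrow> separating e q \<sigma>"
    using generic_ex by blast
  define p where "p = q(v := q u)"
  have pq: "p x = q x" if "x \<noteq> v" for x using that by (simp add: p_def)
  have pv: "p v = q u" by (simp add: p_def)
  have lift: "\<exists>x'\<in>\<sigma>. x' = x \<or> (x = u \<and> x' = v)" if "x \<in> g \<sigma>" for x \<sigma>
    using that by (auto simp: g_def contract_def split: if_splits)
  have "rigid e p (insert {u, v} Q)"
    unfolding rigid_def
  proof (intro allI impI)
    fix m assume m: "motion e p (insert {u, v} Q) m"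
    have "dot e (q c) (\<lambda>i. m u i - m v i) = 0" if c: "c \<in> insert u C" for c
    proof -
      have "dot e (q c) (m u) = dot e (q u) (m c)" 
      proof (cases "c = u")
        case False
        then obtain \<sigma> where "\<sigma> \<in> Q" "u \<in> \<sigma>" "c \<in> \<sigma>" using c C(6) by auto
        then have "dot e (p c) (m u) = dot e (p u) (m c)" by (intro motionD[OF m]) auto
        moreover have "c \<noteq> v" using c C V by auto
        ultimately show ?thesis using V(2) by (simp add: pq)
      qed simp
      moreover have "dot e (q c) (m v) = dot e (q u) (m c)"
      proof -
        have "\<exists>\<sigma>\<in>insert {u, v} Q. v \<in> \<sigma> \<and> c \<in> \<sigma>" using c C(7) by auto
        then have "dot e (p c) (m v) = dot e (p v) (m c)" using motionD[OF m] by blast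
        moreover have "c \<noteq> v" using c C V by auto
        ultimately show ?thesis by (simp add: pq pv)
      qed
      ultimately show ?thesis by (simp add: dot_diff_right)
    qed
    moreover have "separating e q (insert u C)" using C V by (intro q(2)) auto
    ultimately have "m u i - m v i = 0" if "i < e" for i
      using separatingD[of e q "insert u C" "\<lambda>i. m u i - m v i"] that by blast
    then have muv: "m v i = m u i" if "i < e" for i using that by simp
    have "motion e q (g ` Q) m"
      unfolding motion_def
    proof (intro ballI)
      fix \<beta> x y assume b: "\<beta> \<in> g ` Q" and x: "x \<in> \<beta>" and y: "y \<in> \<beta>"
      obtain \<sigma> where s: "\<sigma> \<in> Q" "\<beta> = g \<sigma>" using b by blast
      have ne: "x \<noteq> v" "y \<noteq> v" using x y gv s by auto
      obtain x' where x': "x' \<in> \<sigma>" "x' = x \<or> (x = u \<and> x' = v)" using lift x s by blast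
      obtain y' where y': "y' \<in> \<sigma>" "y' = y \<or> (y = u \<and> y' = v)" using lift y s by blast
      have "dot e (p x') (m y') = dot e (p y') (m x')"
        using s x' y' by (intro motionD[OF m, of \<sigma>]) auto
      moreover have "p x' = q x" "p y' = q y" using x' y' ne pq pv by auto
      moreover have "dot e z (m x') = dot e z (m x)" "dot e z (m y') = dot e z (m y)" for z
        using x' y' muv by (auto intro!: dot_cong)
      ultimately show "dot e (q x) (m y) = dot e (q y) (m x)" by simp
    qed
    then obtain S where S: "symmetric_mat e S" "agrees e q m S (\<Union>(g ` Q))"
      using q(1) unfolding rigid_def by blast
    have uB: "u \<in> \<Union>(g ` Q)"
    proof -
      obtain c \<sigma> where "\<sigma> \<in> Q" "u \<in> \<sigma>" using C(5,6) by blast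
      then show ?thesis using gm V(2) by blast
    qed
    have "m x i = dot e (S i) (p x)" if x: "x \<in> \<Union>(insert {u, v} Q)" and i: "i < e" for x i
    proof (cases "x = v")
      case True
      have "m u i = dot e (S i) (q u)" using S(2) uB i unfolding agrees_def by blast
      then show ?thesis using True i muv pv by simp
    next
      case False
      then have "x \<in> \<Union>(g ` Q)" using x uB gm by auto
      then have "m x i = dot e (S i) (q x)" using S(2) i unfolding agrees_def by blast
      then show ?thesis using pq[OF False] by simp
    qed
    then have "agrees e p m S (\<Union>(insert {u, v} Q))" unfolding agrees_def by blast
    with S(1) show "\<exists>S. symmetric_mat e S \<and> agrees e p m S (\<Union>(insert {u, v} Q))" by blast
  qed
  moreover obtain \<sigma> where s: "\<sigma> \<in> Q" using Q(1) by blast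
  \<comment> \<open>The placement is special, but contraction keeps the size of \<sigma>; so
    \<sigma> does not contain both vertices of the doubled point, and its vectors still form a
    basis.\<close>
  have "separating e p \<sigma>"
    unfolding separating_def
  proof (intro allI impI)
    fix y i assume y: "\<forall>x\<in>\<sigma>. dot e (p x) y = 0" and i: "i < e"
    have "separating e q (g \<sigma>)" using q(2) gV[OF s] Q(2)[OF s] by (simp add: g_def)
    moreover have "dot e (q x) y = 0" if x: "x \<in> g \<sigma>" for x
    proof -
      obtain x' where x': "x' \<in> \<sigma>" "x' = x \<or> (x = u \<and> x' = v)" using lift x by blast
      have "x \<noteq> v" using x gv by blast
      then have "p x' = q x" using x' pq pv by auto
      then show ?thesis using y x' by metis
    qed
    ultimately show "y i = 0" using separatingD i by blast
  qed
  moreover have "finite (\<Union>(insert {u, v} Q))"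
    using Q(2) V by (intro finite_subset[OF _ V(1)]) auto
  ultimately show ?thesis
    using generic_rigid_of_rigid[of "insert {u, v} Q" e p \<sigma>] Q(2)[OF s] s by blast
qed

definition no_edge :: "'v \<Rightarrow> 'v \<Rightarrow> 'v set set \<Rightarrow> 'v set set" where
  "no_edge u v X = {\<sigma>\<in>X. \<not> (u \<in> \<sigma> \<and> v \<in> \<sigma>)}"

text \<open>The image of the chain \<open>X\<close> modulo 2 when \<open>v\<close> is identified
  with \<open>u\<close>. Simplices containing the edge degenerate, and a simplex with
  \<open>u\<close> survives only if exactly one of its two preimages lies in
  \<open>X\<close>.\<close>

definition contract_cycle :: "'v \<Rightarrow> 'v \<Rightarrow> 'v set set \<Rightarrow> 'v set set" where
  "contract_cycle u v X =
     {\<beta>. v \<notin> \<beta> \<and> (if u \<in> \<beta> then (\<beta> \<in> X) \<noteq> (insert v (\<beta> - {u}) \<in> X) else \<beta> \<in> X)}"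

definition contract_fibre :: "'v \<Rightarrow> 'v \<Rightarrow> 'v set set \<Rightarrow> 'v set set \<Rightarrow> 'v set set" where
  "contract_fibre u v X B = {\<sigma>\<in>no_edge u v X. contract u v \<sigma> \<in> B}"

lemma of_bool_bit_split: "P = (Q \<noteq> R) \<Longrightarrow> of_bool Q + of_bool R = (of_bool P :: bit)"
  by (cases Q; cases R) auto

text \<open>The chain map of the contraction commutes with the boundary, here on the part of the
  chain that lies over \<open>B\<close>. Faces with \<open>u\<close> and with \<open>v\<close> in
  its place have the same image, so their coefficients add up.\<close>

lemma parity_contract_fibre:
  assumes V: "finite V" "u \<in> V" "v \<in> V" "u \<noteq> v" and B: "\<And>\<beta>. \<beta> \<in> B \<Longrightarrow> v \<notin> \<beta>"
    and t: "u \<notin> \<tau>" "v \<notin> \<tau>"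
  shows "parity V (contract_fibre u v X B) \<tau> = parity V (B \<inter> contract_cycle u v X) \<tau>"
    and "parity V (contract_fibre u v X B) (insert u \<tau>) + parity V (contract_fibre u v X B) (insert v \<tau>)
      = parity V (B \<inter> contract_cycle u v X) (insert u \<tau>)"
proof -
  define R where "R = V - \<tau> - {u, v}"
  define Q where "Q = contract_fibre u v X B"
  define D where "D = B \<inter> contract_cycle u v X"
  have R: "finite R" "u \<notin> R" "v \<notin> R" using V by (auto simp: R_def)
  have VR: "V - \<tau> = insert u (insert v R)" using V t by (auto simp: R_def)
  have VRu: "V - insert u \<tau> = insert v R" using V t by (auto simp: R_def)
  have VRv: "V - insert v \<tau> = insert u R" using V t by (auto simp: R_def)
  have xQ: "insert x \<tau> \<in> Q \<longleftrightarrow> insert x \<tau> \<in> D" if "x \<in> R" for x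
    using that t V by (auto simp: Q_def D_def R_def contract_fibre_def no_edge_def contract_def contract_cycle_def)
  have uQ: "insert u \<tau> \<in> Q \<longleftrightarrow> insert u \<tau> \<in> X \<and> insert u \<tau> \<in> B"
    using t V by (auto simp: Q_def contract_fibre_def no_edge_def contract_def)
  have vQ: "insert v \<tau> \<in> Q \<longleftrightarrow> insert v \<tau> \<in> X \<and> insert u \<tau> \<in> B"
    using t V by (auto simp: Q_def contract_fibre_def no_edge_def contract_def)
  have uD: "insert u \<tau> \<in> D \<longleftrightarrow> insert u \<tau> \<in> B \<and> (insert u \<tau> \<in> X) \<noteq> (insert v \<tau> \<in> X)"
    using t V by (auto simp: D_def contract_cycle_def)
  have vD: "insert v \<omega> \<notin> D" for \<omega> using B by (auto simp: D_def)
  have "parity V Q \<tau> = of_bool (insert u \<tau> \<in> Q) + (of_bool (insert v \<tau> \<in> Q) +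
      (\<Sum>x\<in>R. of_bool (insert x \<tau> \<in> Q)))"
    unfolding parity_def VR using R V(4) by (simp only: sum.insert finite_insert insert_iff not_False_eq_True simp_thms)
  also have "\<dots> = (of_bool (insert u \<tau> \<in> Q) + of_bool (insert v \<tau> \<in> Q)) +
      (\<Sum>x\<in>R. of_bool (insert x \<tau> \<in> Q))" by (simp only: add.assoc)
  also have "of_bool (insert u \<tau> \<in> Q) + of_bool (insert v \<tau> \<in> Q) = (of_bool (insert u \<tau> \<in> D) :: bit)"
    by (rule of_bool_bit_split) (use uQ vQ uD in blast)
  also have "(\<Sum>x\<in>R. of_bool (insert x \<tau> \<in> Q)) = (\<Sum>x\<in>R. of_bool (insert x \<tau> \<in> D) :: bit)"
    by (rule sum.cong[OF refl]) (simp only: xQ)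
  also have "of_bool (insert u \<tau> \<in> D) + (\<Sum>x\<in>R. of_bool (insert x \<tau> \<in> D)) = parity V D \<tau>"
  proof -
    have "parity V D \<tau> = of_bool (insert u \<tau> \<in> D) + (of_bool (insert v \<tau> \<in> D) +
        (\<Sum>x\<in>R. of_bool (insert x \<tau> \<in> D)))"
      unfolding parity_def VR using R V(4) by (simp only: sum.insert finite_insert insert_iff not_False_eq_True simp_thms)
    then show ?thesis using vD by (simp only: of_bool_eq(1) add_0_left not_False_eq_True simp_thms)
  qed
  finally show "parity V (contract_fibre u v X B) \<tau> = parity V (B \<inter> contract_cycle u v X) \<tau>"
    unfolding Q_def D_def .
  have uvQ: "insert u (insert v \<tau>) \<notin> Q" by (auto simp: Q_def contract_fibre_def no_edge_def)
  have "parity V Q (insert u \<tau>) = of_bool (insert v (insert u \<tau>) \<in> Q) +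
      (\<Sum>x\<in>R. of_bool (insert x (insert u \<tau>) \<in> Q))"
    unfolding parity_def VRu sum.insert[OF R(1,3)] ..
  also have "\<dots> = (\<Sum>x\<in>R. of_bool (insert x (insert u \<tau>) \<in> Q))"
    using uvQ by (simp only: insert_commute[of v u] of_bool_eq(1) add_0_left not_False_eq_True simp_thms)
  finally have 1: "parity V Q (insert u \<tau>) = (\<Sum>x\<in>R. of_bool (insert x (insert u \<tau>) \<in> Q))" .
  have "parity V Q (insert v \<tau>) = of_bool (insert u (insert v \<tau>) \<in> Q) +
      (\<Sum>x\<in>R. of_bool (insert x (insert v \<tau>) \<in> Q))"
    unfolding parity_def VRv sum.insert[OF R(1,2)] ..
  also have "\<dots> = (\<Sum>x\<in>R. of_bool (insert x (insert v \<tau>) \<in> Q))"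
    using uvQ by (simp only: of_bool_eq(1) add_0_left not_False_eq_True simp_thms)
  finally have 2: "parity V Q (insert v \<tau>) = (\<Sum>x\<in>R. of_bool (insert x (insert v \<tau>) \<in> Q))" .
  have "parity V D (insert u \<tau>) = of_bool (insert v (insert u \<tau>) \<in> D) +
      (\<Sum>x\<in>R. of_bool (insert x (insert u \<tau>) \<in> D))"
    unfolding parity_def VRu sum.insert[OF R(1,3)] ..
  also have "\<dots> = (\<Sum>x\<in>R. of_bool (insert x (insert u \<tau>) \<in> D))"
    using vD by (simp only: of_bool_eq(1) add_0_left not_False_eq_True simp_thms)
  finally have 3: "parity V D (insert u \<tau>) = (\<Sum>x\<in>R. of_bool (insert x (insert u \<tau>) \<in> D))" .
  have "of_bool (insert x (insert u \<tau>) \<in> Q) + of_bool (insert x (insert v \<tau>) \<in> Q) =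
      (of_bool (insert x (insert u \<tau>) \<in> D) :: bit)" if x: "x \<in> R" for x
  proof (rule of_bool_bit_split)
    have a: "u \<notin> insert x \<tau>" "v \<notin> insert x \<tau>" using x t R by auto
    have "insert x (insert v \<tau>) - {v} = insert x \<tau>" "insert x (insert u \<tau>) - {u} = insert x \<tau>"
      using a by auto
    then show "(insert x (insert u \<tau>) \<in> D) =
        ((insert x (insert u \<tau>) \<in> Q) \<noteq> (insert x (insert v \<tau>) \<in> Q))"
      using a V(4) unfolding Q_def D_def contract_fibre_def no_edge_def contract_def contract_cycle_def
      by (simp add: insert_commute) blast
  qed
  then have "parity V Q (insert u \<tau>) + parity V Q (insert v \<tau>) = parity V D (insert u \<tau>)"
    unfolding 1 2 3 sum.distrib[symmetric] by (intro sum.cong) auto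
  then show "parity V (contract_fibre u v X B) (insert u \<tau>) +
      parity V (contract_fibre u v X B) (insert v \<tau>) = parity V (B \<inter> contract_cycle u v X) (insert u \<tau>)"
    unfolding Q_def D_def .
qed

lemma contract_cycle_simplex:
  assumes X: "\<And>\<sigma>. \<sigma> \<in> X \<Longrightarrow> \<sigma> \<subseteq> V \<and> card \<sigma> = e" and V: "finite V" "u \<in> V" "u \<noteq> v"
    and b: "\<beta> \<in> contract_cycle u v X"
  shows "\<beta> \<subseteq> V" "card \<beta> = e" "\<beta> \<subseteq> insert u (\<Union>X) - {v}"
proof -
  have v: "v \<notin> \<beta>" using b by (auto simp: contract_cycle_def)
  consider "\<beta> \<in> X" | "u \<in> \<beta>" "insert v (\<beta> - {u}) \<in> X"
    using b by (auto simp: contract_cycle_def split: if_splits)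
  then have "\<beta> \<subseteq> V \<and> card \<beta> = e \<and> \<beta> \<subseteq> insert u (\<Union>X) - {v}"
  proof cases
    case 1
    then show ?thesis using X[OF 1] v by auto
  next
    case 2
    have *: "insert v (\<beta> - {u}) \<subseteq> V" "card (insert v (\<beta> - {u})) = e" using X[OF 2(2)] by auto
    then have "finite (\<beta> - {u})" using V(1) finite_subset by fastforce
    then have "finite \<beta>" by simp
    then have "card \<beta> = card (insert v (\<beta> - {u}))" using v card_Suc_Diff1[OF _ 2(1)] by simp
    moreover have "\<beta> \<subseteq> V" using * V(2) by blast
    moreover have "\<beta> \<subseteq> insert u (\<Union>X) - {v}" using 2(2) v by blast
    ultimately show ?thesis using *(2) by simp
  qed
  then show "\<beta> \<subseteq> V" "card \<beta> = e" "\<beta> \<subseteq> insert u (\<Union>X) - {v}" by auto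
qed

text \<open>With all simplices avoiding \<open>v\<close> as \<open>B\<close>, the fibre is
  \<open>X\<close> without the simplices on the edge. Its boundary has the same coefficient at
  \<open>insert u \<tau>\<close> and \<open>insert v \<tau>\<close>, namely whether \<tau> together
  with the edge lies in \<open>X\<close>, and the two cancel.\<close>

lemma mod2_cycle_contract:
  assumes V: "finite V" "u \<in> V" "v \<in> V" "u \<noteq> v" and X: "mod2_cycle V e X"
  shows "mod2_cycle V e (contract_cycle u v X)"
proof -
  define D where "D = contract_cycle u v X"
  define N where "N = contract_fibre u v X {\<beta>. v \<notin> \<beta>}"
  have N: "N = {\<sigma>\<in>X. \<not> (u \<in> \<sigma> \<and> v \<in> \<sigma>)}"
    using V(4) by (auto simp: N_def contract_fibre_def no_edge_def contract_def)
  have D: "{\<beta>. v \<notin> \<beta>} \<inter> D = D" by (auto simp: D_def contract_cycle_def)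
  have parX: "parity V X \<tau> = 0" for \<tau> using X by (simp add: mod2_cycle_def)
  note par = parity_contract_fibre[OF V, of "{\<beta>. v \<notin> \<beta>}" _ X, folded N_def D_def, unfolded D]
  have Nedge: "parity V N (insert u \<tau>) = of_bool (insert v (insert u \<tau>) \<in> X)"
    "parity V N (insert v \<tau>) = of_bool (insert v (insert u \<tau>) \<in> X)" if t: "u \<notin> \<tau>" "v \<notin> \<tau>" for \<tau>
  proof -
    have "v \<notin> insert u \<tau>" using t V(4) by simp
    from parity_edge[OF V(1,3) this, of X]
    have "parity V N (insert u \<tau>) + of_bool (insert v (insert u \<tau>) \<in> X) = 0"
      unfolding N parX by (rule sym)
    then show "parity V N (insert u \<tau>) = of_bool (insert v (insert u \<tau>) \<in> X)"
      by (rule bit_add_eq_0_iff[THEN iffD1])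
    have N': "N = {\<sigma>\<in>X. \<not> (v \<in> \<sigma> \<and> u \<in> \<sigma>)}" using N by auto
    have "u \<notin> insert v \<tau>" using t V(4) by simp
    from parity_edge[OF V(1,2) this, of X]
    have "parity V N (insert v \<tau>) + of_bool (insert v (insert u \<tau>) \<in> X) = 0"
      unfolding N' parX insert_commute[of u v] by (rule sym)
    then show "parity V N (insert v \<tau>) = of_bool (insert v (insert u \<tau>) \<in> X)"
      by (rule bit_add_eq_0_iff[THEN iffD1])
  qed
  have "parity V D \<tau> = 0" for \<tau>
  proof -
    consider "v \<in> \<tau>" | "u \<notin> \<tau>" "v \<notin> \<tau>" | "u \<in> \<tau>" "v \<notin> \<tau>" by blast
    then show ?thesis
    proof cases
      case 1
      then show ?thesis
        by (intro ccontr[of "parity V D \<tau> = 0"]) (erule parity_nonzeroE, auto simp: D_def contract_cycle_def)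
    next
      case 2
      have "parity V D \<tau> = parity V N \<tau>" using par(1)[of \<tau>] 2 by simp
      also have "\<dots> = parity V X \<tau>" unfolding N by (rule parity_no_edge[OF 2 V(4)])
      finally show ?thesis using parX by simp
    next
      case 3
      define \<omega> where "\<omega> = \<tau> - {u}"
      have w: "\<tau> = insert u \<omega>" "u \<notin> \<omega>" "v \<notin> \<omega>" using 3 by (auto simp: \<omega>_def)
      have "parity V D \<tau> = parity V N (insert u \<omega>) + parity V N (insert v \<omega>)"
        unfolding w(1) using w(2,3) by (intro par(2)[symmetric]) auto
      then show ?thesis unfolding Nedge[OF w(2,3)] bit_add_self .
    qed
  qed
  moreover have "\<beta> \<subseteq> V \<and> card \<beta> = e" if "\<beta> \<in> D" for \<beta>
    using contract_cycle_simplex[of X V e u v \<beta>] X V that unfolding D_def mod2_cycle_def by blast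
  ultimately show ?thesis by (simp add: mod2_cycle_def D_def)
qed

text \<open>Without such common neighbours the preimage of \<open>B\<close> would be a cycle, against minimality of \<open>X\<close>.\<close>

lemma contract_fibre_common_neighbours:
  assumes V: "finite V" "u \<in> V" "v \<in> V" "u \<noteq> v" and e: "3 \<le> e"
    and X: "minimal_cycle V e X" and uv: "\<sigma>1 \<in> X" "u \<in> \<sigma>1" "v \<in> \<sigma>1"
    and B: "mod2_cycle V e B" "B \<subseteq> contract_cycle u v X"
    and ne: "contract_fibre u v X B \<noteq> {}"
  obtains C where "C \<subseteq> V" "card (insert u C) = e" "u \<notin> C" "v \<notin> C" "C \<noteq> {}"
    "\<And>c. c \<in> C \<Longrightarrow> \<exists>\<sigma>\<in>contract_fibre u v X B. u \<in> \<sigma> \<and> c \<in> \<sigma>"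
    "\<And>c. c \<in> C \<Longrightarrow> \<exists>\<sigma>\<in>contract_fibre u v X B. v \<in> \<sigma> \<and> c \<in> \<sigma>"
proof -
  define Q where "Q = contract_fibre u v X B"
  have QX: "Q \<subseteq> X" by (auto simp: Q_def contract_fibre_def no_edge_def)
  have Qe: "\<not> (u \<in> \<sigma> \<and> v \<in> \<sigma>)" if "\<sigma> \<in> Q" for \<sigma>
    using that by (auto simp: Q_def contract_fibre_def no_edge_def)
  have XV: "\<sigma> \<subseteq> V" "card \<sigma> = e" if "\<sigma> \<in> X" for \<sigma>
    using X that unfolding minimal_cycle_def mod2_cycle_def by auto
  have vB: "v \<notin> \<beta>" if "\<beta> \<in> B" for \<beta> using B(2) that by (auto simp: contract_cycle_def)
  have BB: "B \<inter> contract_cycle u v X = B" using B(2) by blast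
  have parB: "parity V B \<tau> = 0" for \<tau> using B(1) by (simp add: mod2_cycle_def)
  have par0: "parity V Q \<tau> = 0" if "u \<notin> \<tau>" "v \<notin> \<tau>" for \<tau>
    using parity_contract_fibre(1)[OF V vB that, of B X] unfolding BB parB Q_def by blast
  have par1: "parity V Q (insert u \<tau>) = parity V Q (insert v \<tau>)" if "u \<notin> \<tau>" "v \<notin> \<tau>" for \<tau>
  proof -
    have "parity V Q (insert u \<tau>) + parity V Q (insert v \<tau>) = 0"
      using parity_contract_fibre(2)[OF V vB that, of B X] unfolding BB parB Q_def by blast
    then show ?thesis by (rule bit_add_eq_0_iff[THEN iffD1])
  qed
  have "\<exists>\<omega>. u \<notin> \<omega> \<and> v \<notin> \<omega> \<and> parity V Q (insert u \<omega>) \<noteq> 0"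
  proof (rule ccontr)
    assume "\<not> ?thesis"
    then have no: "parity V Q (insert u \<omega>) = 0" if "u \<notin> \<omega>" "v \<notin> \<omega>" for \<omega> using that by blast
    have "parity V Q \<tau> = 0" for \<tau>
    proof -
      consider "u \<in> \<tau>" "v \<in> \<tau>" | "u \<notin> \<tau>" "v \<notin> \<tau>" | "u \<in> \<tau>" "v \<notin> \<tau>" | "u \<notin> \<tau>" "v \<in> \<tau>" by blast
      then show ?thesis
      proof cases
        case 1
        show ?thesis by (rule ccontr, erule parity_nonzeroE) (use Qe 1 in blast)
      next
        case 2
        then show ?thesis by (rule par0)
      next
        case 3
        then have "\<tau> = insert u (\<tau> - {u})" by blast
        moreover have "parity V Q (insert u (\<tau> - {u})) = 0" using 3 by (intro no) auto
        ultimately show ?thesis by metis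
      next
        case 4
        then have "\<tau> = insert v (\<tau> - {v})" by blast
        moreover have "parity V Q (insert u (\<tau> - {v})) = 0" using 4 by (intro no) auto
        moreover have "parity V Q (insert u (\<tau> - {v})) = parity V Q (insert v (\<tau> - {v}))"
          using 4 by (intro par1) auto
        ultimately show ?thesis by metis
      qed
    qed
    then have "mod2_cycle V e Q" using QX XV unfolding mod2_cycle_def by blast
    then have "Q = X" using X QX ne unfolding minimal_cycle_def Q_def by blast
    then show False using Qe uv by blast
  qed
  then obtain \<omega> where w: "u \<notin> \<omega>" "v \<notin> \<omega>" "parity V Q (insert u \<omega>) \<noteq> 0" by blast
  obtain x where x: "x \<notin> insert u \<omega>" "insert x (insert u \<omega>) \<in> Q" using w(3) by (rule parity_nonzeroE)
  have xX: "insert x (insert u \<omega>) \<in> X" using x QX by blast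
  have fw: "finite \<omega>" using finite_subset[OF XV(1)[OF xX] V(1)] by simp
  have cw: "card \<omega> + 2 = e" using XV(2)[OF xX] x w fw by simp
  \<comment> \<open>\<omega> has only e - 2 vertices, one too few for \<open>C\<close>. The
    vanishing double boundary of \<open>Q\<close> at \<open>insert u \<eta>\<close> produces a
    second set of the same kind, \<open>insert y \<eta>\<close>, and \<open>y\<close> is the missing
    neighbour. Removing \<open>z\<close> is possible because e is at least 3.\<close>
  then have "\<omega> \<noteq> {}" using e by auto
  then obtain z where z: "z \<in> \<omega>" by blast
  define \<eta> where "\<eta> = \<omega> - {z}"
  have we: "\<omega> = insert z \<eta>" "z \<notin> \<eta>" using z by (auto simp: \<eta>_def)
  have zV: "z \<in> V - insert u \<eta>" using XV(1)[OF xX] z w by (auto simp: \<eta>_def)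
  define f where "f y = parity V Q (insert y (insert u \<eta>))" for y
  have "(\<Sum>y\<in>V - insert u \<eta>. f y) = 0" unfolding f_def using V(1) by (rule sum_parity_insert)
  moreover have "f z \<noteq> 0" using w(3) unfolding f_def we(1) by (simp add: insert_commute)
  moreover have "(\<Sum>y\<in>V - insert u \<eta>. f y) = f z + (\<Sum>y\<in>V - insert u \<eta> - {z}. f y)"
    using V(1) zV by (intro sum.remove) auto
  ultimately have "(\<Sum>y\<in>V - insert u \<eta> - {z}. f y) \<noteq> 0" by (auto simp: bit_add_eq_0_iff)
  then obtain y where y: "y \<in> V - insert u \<eta> - {z}" "f y \<noteq> 0" by (meson sum.neutral)
  have "y \<noteq> v"
  proof
    assume "y = v"
    from y(2) obtain x where "insert x (insert y (insert u \<eta>)) \<in> Q"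
      unfolding f_def by (rule parity_nonzeroE)
    then show False using Qe \<open>y = v\<close> by blast
  qed
  define \<omega>' where "\<omega>' = insert y \<eta>"
  have w': "u \<notin> \<omega>'" "v \<notin> \<omega>'" "parity V Q (insert u \<omega>') \<noteq> 0"
    using y \<open>y \<noteq> v\<close> w by (auto simp: \<omega>'_def \<eta>_def f_def insert_commute)
  have nb: "(\<exists>\<sigma>\<in>Q. u \<in> \<sigma> \<and> c \<in> \<sigma>) \<and> (\<exists>\<sigma>\<in>Q. v \<in> \<sigma> \<and> c \<in> \<sigma>)"
    if w: "u \<notin> \<omega>" "v \<notin> \<omega>" "parity V Q (insert u \<omega>) \<noteq> 0" "c \<in> \<omega>" for c \<omega>
  proof -
    obtain x where x: "insert x (insert u \<omega>) \<in> Q" using w(3) by (rule parity_nonzeroE)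
    have "parity V Q (insert v \<omega>) \<noteq> 0" using par1[OF w(1,2)] w(3) by simp
    then obtain y where y: "insert y (insert v \<omega>) \<in> Q" by (rule parity_nonzeroE)
    show ?thesis using w(4) by (intro conjI bexI[OF _ x] bexI[OF _ y]) auto
  qed
  have yw: "y \<notin> \<omega>" using y we by blast
  show thesis
  proof (rule that[of "insert y \<omega>"])
    show "insert y \<omega> \<subseteq> V" using XV(1)[OF xX] y by blast
    show "u \<notin> insert y \<omega>" "v \<notin> insert y \<omega>" using w y \<open>y \<noteq> v\<close> by auto
    show "insert y \<omega> \<noteq> {}" by blast
    have "card (insert u (insert y \<omega>)) = card \<omega> + 2" using fw yw w(1) y by auto
    then show "card (insert u (insert y \<omega>)) = e" using cw by simp
    fix c assume "c \<in> insert y \<omega>"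
    then have "c \<in> \<omega> \<or> c \<in> \<omega>'" by (auto simp: \<omega>'_def)
    then show "\<exists>\<sigma>\<in>contract_fibre u v X B. u \<in> \<sigma> \<and> c \<in> \<sigma>" "\<exists>\<sigma>\<in>contract_fibre u v X B. v \<in> \<sigma> \<and> c \<in> \<sigma>"
      using nb[OF w] nb[OF w'] unfolding Q_def by blast+
  qed
qed

text \<open>This treats the simplices \<beta> whose two preimages cancel, so that \<beta> lies in no
  minimal piece of the contracted cycle. Then \<open>v\<close> is adjacent to every vertex of
  \<beta>, and e equations against a basis determine the motion at \<open>v\<close>.\<close>

lemma agrees_insert_of_neighbours:
  assumes V: "finite V" "u \<in> V" "v \<in> V" "u \<noteq> v" and ue: "separating e p \<beta>" "finite \<beta>" "card \<beta> = e"
    and b: "u \<in> \<beta>" "v \<notin> \<beta>" "\<beta> \<in> X" "insert v (\<beta> - {u}) \<in> X" and uv: "\<sigma>1 \<in> X" "u \<in> \<sigma>1" "v \<in> \<sigma>1"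
    and m: "motion e p X m"
  shows "\<exists>S. agrees e p m S (insert v \<beta>)"
proof -
  have "motion e p {\<beta>} m" by (rule motion_mono[OF m]) (use b in auto)
  then obtain S where S: "symmetric_mat e S" "agrees e p m S \<beta>"
    using simplex_agrees[OF ue(2,3,1)] by blast
  define n where "n x i = m x i - dot e (S i) (p x)" for x i
  have n: "motion e p X n" unfolding n_def using motion_diff_symmetric[OF m S(1)] .
  have n0: "n x i = 0" if "x \<in> \<beta>" "i < e" for x i
    using S(2) that unfolding agrees_def n_def by simp
  have "dot e (p y) (n v) = 0" if y: "y \<in> \<beta>" for y
  proof -
    have "\<exists>\<sigma>\<in>X. y \<in> \<sigma> \<and> v \<in> \<sigma>"
    proof (cases "y = u")
      case True
      then show ?thesis using uv by (intro bexI[OF _ uv(1)]) simp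
    next
      case False
      then show ?thesis using y by (intro bexI[OF _ b(4)]) simp
    qed
    then have "dot e (p y) (n v) = dot e (p v) (n y)" using motionD[OF n] by blast
    also have "\<dots> = 0" using n0[OF y] by (rule dot_zero)
    finally show ?thesis .
  qed
  then have "n v i = 0" if "i < e" for i using separatingD[OF ue(1)] that by blast
  then have "agrees e p m S (insert v \<beta>)" using S(2) unfolding agrees_def n_def by simp
  then show ?thesis by (rule exI[of _ S])
qed

text \<open>Fogelsanger's theorem, by contraction of an edge.\<close>

theorem minimal_cycle_generic_rigid:
  assumes V: "finite V" and e: "3 \<le> e" and "minimal_cycle V e X"
  shows "generic (\<lambda>p :: 'v \<Rightarrow> nat \<Rightarrow> 'a::field_char_0. rigid e p X)"
  using assms(3)
proof (induction "card (\<Union>X)" arbitrary: X rule: less_induct)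
  case less
  note X = less.prems
  have XV: "\<sigma> \<subseteq> V" "card \<sigma> = e" if "\<sigma> \<in> X" for \<sigma>
    using X that unfolding minimal_cycle_def mod2_cycle_def by auto
  have X2: "mod2_cycle V e X" using X by (simp add: minimal_cycle_def)
  obtain \<sigma>1 where s1: "\<sigma>1 \<in> X" using X unfolding minimal_cycle_def by blast
  obtain u v where uv: "u \<in> \<sigma>1" "v \<in> \<sigma>1" "u \<noteq> v"
  proof -
    have "2 \<le> card \<sigma>1" using XV(2)[OF s1] e by simp
    then show thesis using that by (metis card_2_iff' obtain_subset_with_card_n subsetD)
  qed
  have V': "u \<in> V" "v \<in> V" using uv XV(1)[OF s1] by auto
  define D where "D = contract_cycle u v X"
  define N where "N = no_edge u v X"
  define g where "g = contract u v"
  define Q where "Q = contract_fibre u v X"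
  have D: "mod2_cycle V e D" unfolding D_def using mod2_cycle_contract[OF V V' uv(3) X2] .
  have DV: "D \<subseteq> Pow V" using D by (auto simp: mod2_cycle_def)
  then have "finite D" using V by (meson finite_Pow_iff finite_subset)
  then obtain \<D> where DD: "\<forall>B\<in>\<D>. minimal_cycle V e B" "pairwise disjnt \<D>" "\<Union>\<D> = D"
    using mod2_cycle_partition[OF _ D] by blast
  have gN: "g \<sigma> \<in> g ` N" "v \<notin> g \<sigma>" if "\<sigma> \<in> N" for \<sigma>
    using that uv(3) by (auto simp: g_def contract_def)
  have gcard: "card (g \<sigma>) = e" "g \<sigma> \<subseteq> V" if "\<sigma> \<in> N" for \<sigma>
  proof -
    have s: "\<sigma> \<in> X" "\<not> (u \<in> \<sigma> \<and> v \<in> \<sigma>)" using that by (auto simp: N_def no_edge_def)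
    have "finite \<sigma>" using XV(1)[OF s(1)] V by (rule finite_subset)
    moreover have "g \<sigma> = insert u (\<sigma> - {v})" "u \<notin> \<sigma>" if "v \<in> \<sigma>"
      using s(2) that by (auto simp: g_def contract_def)
    moreover have "g \<sigma> = \<sigma>" if "v \<notin> \<sigma>" using that by (simp add: g_def contract_def)
    ultimately have "card (g \<sigma>) = card \<sigma>"
      using card_Suc_Diff1[of \<sigma> v] by (cases "v \<in> \<sigma>") simp_all
    then show "card (g \<sigma>) = e" using XV(2)[OF s(1)] by simp
    show "g \<sigma> \<subseteq> V" using XV(1)[OF s(1)] V'(1) by (auto simp: g_def contract_def)
  qed
  have DgN: "D \<subseteq> g ` N"
  proof
    fix \<beta> assume b: "\<beta> \<in> D"
    then have v: "v \<notin> \<beta>" by (auto simp: D_def contract_cycle_def)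
    consider "\<beta> \<in> X" | "u \<in> \<beta>" "insert v (\<beta> - {u}) \<in> X"
      using b by (auto simp: D_def contract_cycle_def split: if_splits)
    then show "\<beta> \<in> g ` N"
    proof cases
      case 1
      then have "\<beta> \<in> N" "g \<beta> = \<beta>" using v by (auto simp: N_def no_edge_def g_def contract_def)
      then show ?thesis by (metis image_eqI)
    next
      case 2
      then have "insert v (\<beta> - {u}) \<in> N" "g (insert v (\<beta> - {u})) = \<beta>"
        using v uv(3) by (auto simp: N_def no_edge_def g_def contract_def)
      then show ?thesis by (metis image_eqI)
    qed
  qed
  have QB: "\<sigma> \<in> Q B \<longleftrightarrow> \<sigma> \<in> N \<and> g \<sigma> \<in> B" for \<sigma> B
    by (simp add: Q_def contract_fibre_def N_def g_def)
  have gen: "generic (\<lambda>p :: 'v \<Rightarrow> nat \<Rightarrow> 'a. rigid e p (insert {u, v} (Q B)))" if B: "B \<in> \<D>" for B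
  proof -
    have Bm: "minimal_cycle V e B" using DD B by blast
    have B2: "mod2_cycle V e B" "B \<noteq> {}" using Bm by (auto simp: minimal_cycle_def)
    have BD: "B \<subseteq> D" using B DD(3) by blast
    have gQ: "g ` Q B = B" using BD DgN by (auto simp: QB)
    have "\<Union>B \<subseteq> \<Union>X - {v}"
    proof -
      have "\<beta> \<subseteq> insert u (\<Union>X) - {v}" if "\<beta> \<in> B" for \<beta>
        using that BD V V' uv(3) XV
        by (intro contract_cycle_simplex(3)[of X V e u v \<beta>]) (auto simp: D_def)
      moreover have "u \<in> \<Union>X" using s1 uv by blast
      ultimately show ?thesis by blast
    qed
    moreover have "v \<in> \<Union>X" using s1 uv by blast
    moreover have "finite (\<Union>X)" using XV V by (intro finite_subset[OF _ V]) auto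
    \<comment> \<open>Contraction loses the vertex \<open>v\<close>, so the induction hypothesis
      applies to every minimal piece of the image.\<close>
    ultimately have "card (\<Union>B) < card (\<Union>X)"
      by (meson Diff_subset card_Diff1_less card_mono finite_Diff le_less_trans)
    then have rB: "generic (\<lambda>p :: 'v \<Rightarrow> nat \<Rightarrow> 'a. rigid e p B)" using less.hyps Bm by blast
    have Qne: "Q B \<noteq> {}" using gQ B2(2) by auto
    obtain C where C: "C \<subseteq> V" "card (insert u C) = e" "u \<notin> C" "v \<notin> C" "C \<noteq> {}"
      "\<And>c. c \<in> C \<Longrightarrow> \<exists>\<sigma>\<in>Q B. u \<in> \<sigma> \<and> c \<in> \<sigma>" "\<And>c. c \<in> C \<Longrightarrow> \<exists>\<sigma>\<in>Q B. v \<in> \<sigma> \<and> c \<in> \<sigma>"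
      using contract_fibre_common_neighbours[OF V V' uv(3) e X s1 uv(1,2) B2(1) BD[unfolded D_def] Qne[unfolded Q_def]]
      unfolding Q_def by blast
    show ?thesis
    proof (rule generic_rigid_split[OF V uv(3) V' Qne _ _ C])
      show "\<sigma> \<subseteq> V \<and> card \<sigma> = e \<and> card (contract u v \<sigma>) = e" if "\<sigma> \<in> Q B" for \<sigma>
        using that gcard(1) XV[of \<sigma>] by (auto simp: QB g_def N_def no_edge_def)
      show "generic (\<lambda>p :: 'v \<Rightarrow> nat \<Rightarrow> 'a. rigid e p (contract u v ` Q B))"
        using rB gQ by (simp add: g_def)
    qed
  qed
  have finD: "finite \<D>" using DD(3) \<open>finite D\<close> by (metis finite_UnionD)
  have "generic (\<lambda>p :: 'v \<Rightarrow> nat \<Rightarrow> 'a. (\<forall>B\<in>\<D>. rigid e p (insert {u, v} (Q B))) \<and>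
      (\<forall>\<sigma>\<in>{\<sigma>. \<sigma> \<subseteq> V \<and> card \<sigma> = e}. separating e p \<sigma>))"
    using V finD gen
    by (intro generic_conj generic_ball generic_separating) (auto intro: finite_subset)
  then show ?case
  proof (rule generic_mono)
    fix p :: "'v \<Rightarrow> nat \<Rightarrow> 'a"
    assume p: "(\<forall>B\<in>\<D>. rigid e p (insert {u, v} (Q B))) \<and>
      (\<forall>\<sigma>\<in>{\<sigma>. \<sigma> \<subseteq> V \<and> card \<sigma> = e}. separating e p \<sigma>)"
    then have sep: "separating e p \<sigma>" if "\<sigma> \<subseteq> V" "card \<sigma> = e" for \<sigma> using that by blast
    show "rigid e p X"
      unfolding rigid_def
    proof (intro allI impI)
      fix m assume m: "motion e p X m"
      have "motion e p {\<sigma>1} m" by (rule motion_mono[OF m]) (use s1 in auto)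
      moreover have "finite \<sigma>1" using XV(1)[OF s1] V by (rule finite_subset)
      ultimately obtain S where S: "symmetric_mat e S" "agrees e p m S \<sigma>1"
        using simplex_agrees sep XV[OF s1] by blast
      \<comment> \<open>Image simplices with two cancelling preimages lie outside \<open>D\<close>;
        each becomes a piece of its own. It meets \<open>D\<close> in the empty chain, so the
        boundary conditions on its fibre hold as well.\<close>
      define \<P> where "\<P> = \<D> \<union> (\<lambda>\<beta>. {\<beta>}) ` (g ` N - D)"
      have UP: "\<Union>\<P> = g ` N" using DD(3) DgN by (auto simp: \<P>_def)
      have disP: "pairwise disjnt \<P>"
        using DD(2,3) unfolding \<P>_def pairwise_def disjnt_def by blast
      have P2: "mod2_cycle V e (B \<inter> D)" if "B \<in> \<P>" for B
      proof (cases "B \<in> \<D>")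
        case True
        then have "B \<inter> D = B" using DD(3) by blast
        then show ?thesis using True DD(1) by (simp add: minimal_cycle_def)
      next
        case False
        then have "B \<inter> D = {}" using that by (auto simp: \<P>_def)
        then show ?thesis by (simp add: mod2_cycle_def)
      qed
      have vP: "v \<notin> \<beta>" if "B \<in> \<P>" "\<beta> \<in> B" for B \<beta>
      proof -
        have "\<beta> \<in> g ` N" using that UP by blast
        then show ?thesis using gN by blast
      qed
      have "agrees e p m S (\<Union>X)"
      proof (rule agrees_of_partition[OF V V' uv(3) X, of "Q ` \<P>" p m \<sigma>1 S])
        have "\<Union>(Q ` \<P>) = N"
        proof -
          have "\<sigma> \<in> \<Union>(Q ` \<P>)" if "\<sigma> \<in> N" for \<sigma>
          proof -
            have "g \<sigma> \<in> \<Union>\<P>" using that UP by blast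
            then show ?thesis using that QB by blast
          qed
          then show ?thesis using QB by blast
        qed
        then show "\<Union>(Q ` \<P>) = {\<sigma>\<in>X. \<not> (u \<in> \<sigma> \<and> v \<in> \<sigma>)}" by (simp add: N_def no_edge_def)
        have "disjnt (Q B) (Q B')" if "B \<in> \<P>" "B' \<in> \<P>" "B \<noteq> B'" for B B'
          using that disP QB unfolding pairwise_def disjnt_def by blast
        then show "pairwise disjnt (Q ` \<P>)" unfolding pairwise_def by blast
      next
        fix R \<tau> assume "R \<in> Q ` \<P>" and t: "u \<notin> \<tau>" "v \<notin> \<tau>"
        then obtain B where B: "B \<in> \<P>" "R = Q B" by blast
        have p0: "parity V (B \<inter> D) \<tau>' = 0" for \<tau>' using P2[OF B(1)] by (simp add: mod2_cycle_def)
        show "parity V R \<tau> = 0"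
          using parity_contract_fibre(1)[OF V V' uv(3) _ t, of B X] vP[OF B(1)] p0[of \<tau>]
          unfolding B(2) Q_def D_def by simp
        have "parity V R (insert u \<tau>) + parity V R (insert v \<tau>) = 0"
          using parity_contract_fibre(2)[OF V V' uv(3) _ t, of B X] vP[OF B(1)] p0[of "insert u \<tau>"]
          unfolding B(2) Q_def D_def by simp
        then show "parity V R (insert u \<tau>) = parity V R (insert v \<tau>)"
          by (rule bit_add_eq_0_iff[THEN iffD1])
      next
        fix R assume "R \<in> Q ` \<P>"
        then obtain B where B: "B \<in> \<P>" "R = Q B" by blast
        show "\<exists>S. agrees e p m S (\<Union>R)"
        proof (cases "B \<in> \<D>")
          case True
          have "Q B \<subseteq> X" using QB by (auto simp: N_def no_edge_def)
          \<comment> \<open>The edge added for the vertex split lies in the simplex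
            \<open>\<sigma>1\<close> of \<open>X\<close>, so it imposes nothing new on
            \<open>m\<close>.\<close>
          then have "motion e p (insert {u, v} (Q B)) m"
            using s1 uv by (intro motion_mono[OF m]) auto
          then obtain S' where "agrees e p m S' (\<Union>(insert {u, v} (Q B)))"
            using p True unfolding rigid_def by blast
          then have "agrees e p m S' (\<Union>(Q B))" by (rule agrees_mono) blast
          then show ?thesis using B(2) by blast
        next
          case False
          then obtain \<beta> where b: "B = {\<beta>}" "\<beta> \<in> g ` N" "\<beta> \<notin> D" using B by (auto simp: \<P>_def)
          obtain \<sigma> where s: "\<sigma> \<in> N" "\<beta> = g \<sigma>" using b by blast
          have sX: "\<sigma> \<in> X" "\<not> (u \<in> \<sigma> \<and> v \<in> \<sigma>)" using s by (auto simp: N_def no_edge_def)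
          have v: "v \<notin> \<beta>" using gN s by blast
          have sb: "\<sigma> = \<beta> \<or> u \<in> \<beta> \<and> \<sigma> = insert v (\<beta> - {u})"
            using s(2) sX(2) unfolding g_def contract_def by (auto split: if_splits)
          have u: "u \<in> \<beta>"
          proof (rule ccontr)
            assume "u \<notin> \<beta>"
            then have "\<beta> \<in> D" using sb sX v by (auto simp: D_def contract_cycle_def)
            then show False using b by blast
          qed
          have bX: "\<beta> \<in> X" "insert v (\<beta> - {u}) \<in> X"
            using b(3) u v sb sX by (auto simp: D_def contract_cycle_def)
          have "finite \<beta>" using XV(1)[OF bX(1)] V by (rule finite_subset)
          then obtain S' where S': "agrees e p m S' (insert v \<beta>)"
            using agrees_insert_of_neighbours[OF V V' uv(3) sep[OF XV[OF bX(1)]] _ XV(2)[OF bX(1)] u v bX s1 uv(1,2) m]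
            by blast
          have "\<Union>(Q B) \<subseteq> insert v \<beta>"
            unfolding b(1) using QB[of _ "{\<beta>}"] by (auto simp: g_def contract_def split: if_splits)
          then show ?thesis using agrees_mono[OF S'] B(2) by blast
        qed
      qed (use sep s1 S in auto)
      then show "\<exists>S. symmetric_mat e S \<and> agrees e p m S (\<Union>X)" using S(1) by blast
    qed
  qed
qed

section \<open>Characters of finitely generated subgroups\<close>

text \<open>The graph of a character defined on a subgroup of the additive group of the field.\<close>

definition partial_character :: "('k::field \<times> complex) set \<Rightarrow> bool" where
  "partial_character \<Gamma> \<longleftrightarrow> (0, 1) \<in> \<Gamma> \<and>
     (\<forall>x z y w. (x, z) \<in> \<Gamma> \<longrightarrow> (y, w) \<in> \<Gamma> \<longrightarrow> (x - y, z / w) \<in> \<Gamma>) \<and>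
     (\<forall>x z. (x, z) \<in> \<Gamma> \<longrightarrow> z \<noteq> 0) \<and> (\<forall>z. (0, z) \<in> \<Gamma> \<longrightarrow> z = 1)"

context
  fixes \<Gamma> :: "('k::field \<times> complex) set"
  assumes G: "partial_character \<Gamma>"
begin

lemma partial_character_0: "(0, 1) \<in> \<Gamma>"
  using G unfolding partial_character_def by blast

lemma partial_character_diff: "(x, z) \<in> \<Gamma> \<Longrightarrow> (y, w) \<in> \<Gamma> \<Longrightarrow> (x - y, z / w) \<in> \<Gamma>"
  using G unfolding partial_character_def by blast

lemma partial_character_nonzero: "(x, z) \<in> \<Gamma> \<Longrightarrow> z \<noteq> 0"
  using G unfolding partial_character_def by blast

lemma partial_character_at_0: "(0, z) \<in> \<Gamma> \<Longrightarrow> z = 1"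
  using G unfolding partial_character_def by blast

lemma partial_character_add:
  assumes "(x, z) \<in> \<Gamma>" "(y, w) \<in> \<Gamma>"
  shows "(x + y, z * w) \<in> \<Gamma>"
  using partial_character_diff[OF assms(1) partial_character_diff[OF partial_character_0 assms(2)]]
  by simp

lemma partial_character_unique:
  assumes "(x, z) \<in> \<Gamma>" "(x, w) \<in> \<Gamma>"
  shows "z = w"
  using partial_character_at_0[of "z / w"] partial_character_diff[OF assms]
    partial_character_nonzero[OF assms(2)] by simp

lemma partial_character_multiple:
  assumes "(x, z) \<in> \<Gamma>"
  shows "(of_int j * x, z powi j) \<in> \<Gamma>"
proof -
  have nat: "(of_nat n * x, z ^ n) \<in> \<Gamma>" for n
  proof (induction n)
    case (Suc n)
    from partial_character_add[OF assms this] show ?case by (simp add: algebra_simps)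
  qed (use partial_character_0 in simp)
  show ?thesis
  proof (cases "j \<ge> 0")
    case True
    then show ?thesis using nat[of "nat j"] by (simp add: power_int_nonneg_exp)
  next
    case False
    then have "j = - int (nat (- j))" by simp
    then obtain n where j: "j = - int n" by blast
    show ?thesis
      using partial_character_diff[OF partial_character_0 nat[of n]]
      unfolding j by (simp add: power_int_minus inverse_eq_divide)
  qed
qed

text \<open>The nonzero complex numbers form a divisible group. If a positive multiple of
  \<open>x\<close> already has a value, an n-th root of the value at the least such multiple is
  assigned to \<open>x\<close>; otherwise the choice is free, and 1 is taken.\<close>

lemma partial_character_extend:
  "\<exists>\<Gamma>'. partial_character \<Gamma>' \<and> \<Gamma> \<subseteq> \<Gamma>' \<and> x \<in> fst ` \<Gamma>'"
proof -
  have "\<exists>z. z \<noteq> 0 \<and> (\<forall>j w. (of_int j * x, w) \<in> \<Gamma> \<longrightarrow> w = z powi j)"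
  proof (cases "\<exists>n>0. \<exists>w. (of_nat n * x, w) \<in> \<Gamma>")
    case False
    have "w = 1 powi j" if "(of_int j * x, w) \<in> \<Gamma>" for j w
    proof -
      have "j = 0"
      proof (rule ccontr)
        assume "j \<noteq> 0"
        have "(of_int (sgn j) * (of_int j * x), w powi sgn j) \<in> \<Gamma>"
          by (rule partial_character_multiple[OF that])
        moreover have "of_int (sgn j) * (of_int j * x) = of_int \<bar>j\<bar> * x"
          by (simp add: abs_sgn mult.assoc[symmetric] mult.commute[of "sgn j"]
              flip: of_int_mult)
        moreover have "of_int \<bar>j\<bar> = (of_nat (nat \<bar>j\<bar>) :: 'k)" by simp
        ultimately have "(of_nat (nat \<bar>j\<bar>) * x, w powi sgn j) \<in> \<Gamma>" by metis
        moreover have "nat \<bar>j\<bar> > 0" using \<open>j \<noteq> 0\<close> by simp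
        ultimately show False using False by blast
      qed
      then show ?thesis using that partial_character_at_0 by simp
    qed
    then show ?thesis by (intro exI[of _ 1]) simp
  next
    case True
    define n where "n = (LEAST n. n > 0 \<and> (\<exists>w. (of_nat n * x, w) \<in> \<Gamma>))"
    have n: "n > 0 \<and> (\<exists>w. (of_nat n * x, w) \<in> \<Gamma>)"
      unfolding n_def by (rule LeastI_ex) (use True in blast)
    then obtain wn where wn: "(of_nat n * x, wn) \<in> \<Gamma>" by blast
    have least: "n \<le> k" if "k > 0" "(of_nat k * x, w) \<in> \<Gamma>" for k w
      unfolding n_def by (rule Least_le) (use that in blast)
    define z where "z = rcis (root n (cmod wn)) (Arg wn / n)"
    have zn: "z ^ n = wn" using n by (simp add: z_def DeMoivre2 rcis_cmod_Arg)
    have z0: "z \<noteq> 0" using zn n partial_character_nonzero[OF wn] by auto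
    have "w = z powi j" if jw: "(of_int j * x, w) \<in> \<Gamma>" for j w
    proof -
      \<comment> \<open>Division with remainder by \<open>n\<close>: the remainder would give a
        smaller multiple of \<open>x\<close> in the domain, so minimality makes it 0.\<close>
      define q r where "q = j div int n" and "r = nat (j mod int n)"
      have j: "j = int n * q + int r" and r: "r < n"
        using n by (auto simp: q_def r_def nat_less_iff)
      have "(of_int q * (of_nat n * x), wn powi q) \<in> \<Gamma>" by (rule partial_character_multiple[OF wn])
      from partial_character_diff[OF jw this]
      have "(of_nat r * x, w / wn powi q) \<in> \<Gamma>" unfolding j by (simp add: algebra_simps)
      then have "r = 0" using least r by fastforce
      then have j': "j = int n * q" using j by simp
      have "wn powi q = z powi j" unfolding j' zn[symmetric] by (rule power_int_power)
      moreover have "w = wn powi q"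
        using \<open>(of_int q * (of_nat n * x), wn powi q) \<in> \<Gamma>\<close> jw unfolding j'
        by (intro partial_character_unique[of "of_int (int n * q) * x"]) (simp_all add: algebra_simps)
      ultimately show ?thesis by simp
    qed
    then show ?thesis using z0 by blast
  qed
  then obtain z where z: "z \<noteq> 0" "\<And>j w. (of_int j * x, w) \<in> \<Gamma> \<Longrightarrow> w = z powi j" by blast
  define \<Gamma>' where "\<Gamma>' = {(y + of_int j * x, w * z powi j) | y w j. (y, w) \<in> \<Gamma>}"
  have GE: "\<exists>y w j. a = y + of_int j * x \<and> s = w * z powi j \<and> (y, w) \<in> \<Gamma>" if "(a, s) \<in> \<Gamma>'" for a s
    using that unfolding \<Gamma>'_def by simp blast
  have "partial_character \<Gamma>'"
    unfolding partial_character_def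
  proof (intro conjI allI impI)
    show "(0, 1) \<in> \<Gamma>'"
      unfolding \<Gamma>'_def using partial_character_0 by (intro CollectI exI[of _ 0] exI[of _ 1]) auto
    show "(a - b, s / t) \<in> \<Gamma>'" if as: "(a, s) \<in> \<Gamma>'" and bt: "(b, t) \<in> \<Gamma>'" for a s b t
    proof -
      obtain y w j where 1: "a = y + of_int j * x" "s = w * z powi j" "(y, w) \<in> \<Gamma>"
        using GE[OF as] by (elim exE conjE)
      obtain y' w' j' where 2: "b = y' + of_int j' * x" "t = w' * z powi j'" "(y', w') \<in> \<Gamma>"
        using GE[OF bt] by (elim exE conjE)
      have "a - b = (y - y') + of_int (j - j') * x" by (simp add: 1 2 algebra_simps)
      moreover have "s / t = (w / w') * z powi (j - j')" using z(1) by (simp add: 1 2 power_int_diff)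
      ultimately show ?thesis
        unfolding \<Gamma>'_def using partial_character_diff[OF 1(3) 2(3)] by blast
    qed
    show "s \<noteq> 0" if "(a, s) \<in> \<Gamma>'" for a s
      using that partial_character_nonzero z(1) unfolding \<Gamma>'_def by auto
    show "s = 1" if as: "(0, s) \<in> \<Gamma>'" for s
    proof -
      obtain y w j where 1: "0 = y + of_int j * x" "s = w * z powi j" "(y, w) \<in> \<Gamma>"
        using GE[OF as] by (elim exE conjE)
      have "y = of_int (- j) * x" using 1(1) by (simp add: eq_neg_iff_add_eq_0)
      then have "w = z powi (- j)" using z(2) 1(3) by blast
      then show ?thesis using 1(2) z(1) by (simp add: power_int_minus)
    qed
  qed
  moreover have "\<Gamma> \<subseteq> \<Gamma>'"
  proof safe
    fix y w assume "(y, w) \<in> \<Gamma>"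
    then show "(y, w) \<in> \<Gamma>'"
      unfolding \<Gamma>'_def by (intro CollectI exI[of _ y] exI[of _ w] exI[of _ 0]) simp
  qed
  moreover have "(x, z) \<in> \<Gamma>'"
    unfolding \<Gamma>'_def using partial_character_0
    by (intro CollectI exI[of _ 0] exI[of _ 1]) (auto intro: exI[of _ 1])
  then have "x \<in> fst ` \<Gamma>'" by (force intro: image_eqI)
  ultimately show ?thesis by blast
qed

end

text \<open>\<open>a\<close> will be a period of a cocycle and \<open>C\<close> the finite set of
  its values. The character is fixed on the multiples of \<open>a\<close> and then extended to one
  element of \<open>C\<close> at a time.\<close>

lemma partial_character_exists:
  fixes a :: "'k::field"
  assumes "finite C" "a \<noteq> 0"
  shows "\<exists>\<Gamma> z. partial_character \<Gamma> \<and> (a, z) \<in> \<Gamma> \<and> z \<noteq> 1 \<and> C \<subseteq> fst ` \<Gamma>"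
proof -
  \<comment> \<open>The power of \<zeta> must be 1 whenever the corresponding multiple of
    \<open>a\<close> vanishes in \<open>'k\<close>. In characteristic 0 this allows the value 2; in
    characteristic p a p-th root of unity other than 1 is taken.\<close>
  have "\<exists>\<zeta>::complex. \<zeta> \<noteq> 0 \<and> \<zeta> \<noteq> 1 \<and> (\<forall>j. of_int j = (0 :: 'k) \<longrightarrow> \<zeta> powi j = 1)"
  proof (cases "CHAR('k) = 0")
    case True
    have "j = 0" if "of_int j = (0 :: 'k)" for j
    proof -
      have "of_int \<bar>j\<bar> = (0 :: 'k)" using that by (simp add: abs_if)
      then have "of_nat (nat \<bar>j\<bar>) = (0 :: 'k)" by simp
      then have "CHAR('k) dvd nat \<bar>j\<bar>" by (simp only: of_nat_eq_0_iff_char_dvd)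
      then show ?thesis using True by simp
    qed
    then have "2 powi j = (1 :: complex)" if "of_int j = (0 :: 'k)" for j using that by force
    then show ?thesis by (intro exI[of _ 2]) auto
  next
    case False
    define p where "p = CHAR('k)"
    have p: "2 \<le> p" using False CHAR_not_1[where 'a = 'k] unfolding p_def by linarith
    have card: "card {z::complex. z ^ p = 1} = p" using p by (intro card_roots_unity_eq) simp
    have "\<not> {z::complex. z ^ p = 1} \<subseteq> {1}"
    proof
      assume "{z::complex. z ^ p = 1} \<subseteq> {1}"
      then have "card {z::complex. z ^ p = 1} \<le> card {1::complex}" by (intro card_mono) auto
      then show False using card p by simp
    qed
    then obtain \<zeta> :: complex where z: "\<zeta> ^ p = 1" "\<zeta> \<noteq> 1" by blast
    have "\<zeta> powi j = 1" if "of_int j = (0 :: 'k)" for j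
    proof -
      have "of_int \<bar>j\<bar> = (0 :: 'k)" using that by (simp add: abs_if)
      then have "of_nat (nat \<bar>j\<bar>) = (0 :: 'k)" by simp
      then have "p dvd nat \<bar>j\<bar>" unfolding p_def by (simp only: of_nat_eq_0_iff_char_dvd)
      then have "int p dvd j" by (simp add: nat_dvd_iff int_dvd_int_iff[symmetric] split: if_splits) 
      then obtain q where "j = int p * q" by (elim dvdE)
      then show ?thesis using z(1) by (simp add: power_int_power[symmetric])
    qed
    moreover have "\<zeta> \<noteq> 0" using z(1) p by (auto simp: zero_power)
    ultimately show ?thesis using z by blast
  qed
  then obtain \<zeta> :: complex where z: "\<zeta> \<noteq> 0" "\<zeta> \<noteq> 1" "\<And>j. of_int j = (0 :: 'k) \<Longrightarrow> \<zeta> powi j = 1"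
    by blast
  have "\<exists>\<Gamma>. partial_character \<Gamma> \<and> (a, \<zeta>) \<in> \<Gamma> \<and> C \<subseteq> fst ` \<Gamma>"
    using assms(1)
  proof (induction C)
    case empty
    define \<Gamma> where "\<Gamma> = range (\<lambda>j. (of_int j * a, \<zeta> powi j))"
    have "partial_character \<Gamma>"
      unfolding partial_character_def
    proof (intro conjI allI impI)
      show "(0, 1) \<in> \<Gamma>" unfolding \<Gamma>_def by (rule range_eqI[of _ _ 0]) simp
      show "(x - y, s / t) \<in> \<Gamma>" if xy: "(x, s) \<in> \<Gamma>" "(y, t) \<in> \<Gamma>" for x s y t
      proof -
        obtain i j where "x = of_int i * a" "s = \<zeta> powi i" "y = of_int j * a" "t = \<zeta> powi j"
          using xy unfolding \<Gamma>_def by blast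
        then show ?thesis
          unfolding \<Gamma>_def using z(1)
          by (intro range_eqI[of _ _ "i - j"]) (simp add: algebra_simps power_int_diff)
      qed
      show "s \<noteq> 0" if "(x, s) \<in> \<Gamma>" for x s using that z(1) unfolding \<Gamma>_def by auto
      show "s = 1" if "(0, s) \<in> \<Gamma>" for s using that z(3) assms(2) unfolding \<Gamma>_def by auto
    qed
    moreover have "(a, \<zeta>) \<in> \<Gamma>" unfolding \<Gamma>_def by (rule range_eqI[of _ _ 1]) simp
    ultimately show ?case by blast
  next
    case (insert x C)
    then obtain \<Gamma> where G: "partial_character \<Gamma>" "(a, \<zeta>) \<in> \<Gamma>" "C \<subseteq> fst ` \<Gamma>" by blast
    obtain \<Gamma>' where "partial_character \<Gamma>'" "\<Gamma> \<subseteq> \<Gamma>'" "x \<in> fst ` \<Gamma>'"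
      using partial_character_extend[OF G(1)] by blast
    moreover from this have "fst ` \<Gamma> \<subseteq> fst ` \<Gamma>'" by blast
    ultimately show ?case using G(2,3) by (intro exI[of _ \<Gamma>']) blast
  qed
  then show ?thesis using z(2) by blast
qed

section \<open>Cocycles from the first Betti number\<close>

global_interpretation chain_functional: vector_space_pair
  "chain_scale :: 'k::field \<Rightarrow> ('v list \<Rightarrow> 'k) \<Rightarrow> 'v list \<Rightarrow> 'k" "(*) :: 'k \<Rightarrow> 'k \<Rightarrow> 'k"
  by unfold_locales (auto simp: algebra_simps)

text \<open>A basis of \<open>W\<close> stays independent when \<open>z\<close> is added, so the
  values of a functional can be prescribed on both.\<close>

lemma functional_separating_subspace:
  fixes z :: "'v list \<Rightarrow> 'k::field"
  assumes "chain_space.subspace W" "z \<notin> W"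
  shows "\<exists>g. Vector_Spaces.linear chain_scale ((*) :: 'k \<Rightarrow> 'k \<Rightarrow> 'k) g \<and> (\<forall>w\<in>W. g w = 0) \<and> g z = 1"
proof -
  obtain B where B: "B \<subseteq> W" "chain_space.independent B" "W \<subseteq> chain_space.span B"
    using chain_space.maximal_independent_subset[of W] by blast
  have "chain_space.span B \<subseteq> W" using chain_space.span_minimal[OF B(1) assms(1)] .
  then have "z \<notin> chain_space.span B" using assms(2) by blast
  then have ind: "chain_space.independent (insert z B)"
    using chain_space.independent_insertI B(2) by blast
  have zB: "z \<notin> B" using assms(2) B(1) by blast
  obtain g where g: "Vector_Spaces.linear chain_scale ((*) :: 'k \<Rightarrow> 'k \<Rightarrow> 'k) g"
    "\<forall>x\<in>insert z B. g x = (if x = z then 1 else 0)"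
    using chain_functional.linear_independent_extend[OF ind, of "\<lambda>x. if x = z then 1 else 0"] by blast
  have "g w = 0" if "w \<in> W" for w
  proof (rule chain_functional.linear_eq_0_on_span[OF g(1), of B])
    show "g x = 0" if "x \<in> B" for x using g(2) that zB by auto
    show "w \<in> chain_space.span B" using B(3) that by blast
  qed
  then show ?thesis using g by auto
qed

section \<open>Elementary edge and triangle chains\<close>

definition edge_chain :: "'v \<Rightarrow> 'v \<Rightarrow> 'v list \<Rightarrow> 'k::field" where
  "edge_chain u v = (\<lambda>xs. of_bool (xs = [u, v]) - of_bool (xs = [v, u]))"

definition triangle_chain :: "'v \<Rightarrow> 'v \<Rightarrow> 'v \<Rightarrow> 'v list \<Rightarrow> 'k::field" where
  "triangle_chain u v w = (\<lambda>xs.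
     of_bool (xs = [u, v, w]) + of_bool (xs = [v, w, u]) + of_bool (xs = [w, u, v]) -
     of_bool (xs = [v, u, w]) - of_bool (xs = [u, w, v]) - of_bool (xs = [w, v, u]))"

lemma append_two_eq_two: "xs @ a # b # ys = [c, d] \<longleftrightarrow> xs = [] \<and> ys = [] \<and> a = c \<and> b = d"
  by (cases xs) auto

lemma append_two_eq_three: "xs @ a # b # ys = [c, d, e] \<longleftrightarrow>
    (xs = [] \<and> ys = [e] \<and> a = c \<and> b = d) \<or> (xs = [c] \<and> ys = [] \<and> a = d \<and> b = e)"
proof (cases xs)
  case (Cons x xs')
  then show ?thesis by (cases xs') auto
qed auto

lemma edge_chain_in_chains:
  assumes "{u, v} \<in> \<Delta>" "u \<noteq> v"
  shows "(edge_chain u v :: 'v list \<Rightarrow> 'k::field) \<in> simplicial_chains \<Delta> 1"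
proof -
  have "distinct xs \<and> set xs \<in> \<Delta> \<and> int (length xs) = 1 + 1"
    if nz: "(edge_chain u v xs :: 'k) \<noteq> 0" for xs
  proof -
    have "xs = [u, v] \<or> xs = [v, u]" by (rule ccontr) (use nz in \<open>simp add: edge_chain_def\<close>)
    then show ?thesis using assms by (auto simp: insert_commute)
  qed
  moreover have "(edge_chain u v (xs @ a # b # ys) :: 'k) = - edge_chain u v (xs @ b # a # ys)" for xs a b ys
    unfolding edge_chain_def append_two_eq_two by (simp only: conj_ac minus_diff_eq)
  ultimately show ?thesis unfolding simplicial_chains_def by blast
qed

lemma triangle_chain_in_chains:
  assumes "{u, v, w} \<in> \<Delta>" "u \<noteq> v" "u \<noteq> w" "v \<noteq> w"
  shows "(triangle_chain u v w :: 'v list \<Rightarrow> 'k::field) \<in> simplicial_chains \<Delta> 2"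
proof -
  have "distinct xs \<and> set xs \<in> \<Delta> \<and> int (length xs) = 2 + 1"
    if "(triangle_chain u v w xs :: 'k) \<noteq> 0" for xs
  proof -
    have "xs \<in> {[u, v, w], [v, w, u], [w, u, v], [v, u, w], [u, w, v], [w, v, u]}"
      by (rule ccontr) (use that in \<open>simp add: triangle_chain_def\<close>)
    moreover have "set xs' = {u, v, w}"
      if "xs' \<in> {[u, v, w], [v, w, u], [w, u, v], [v, u, w], [u, w, v], [w, v, u]}" for xs'
      using that by auto
    ultimately have "set xs = {u, v, w}" by blast
    then show ?thesis using \<open>xs \<in> _\<close> assms by auto
  qed
  moreover have "(triangle_chain u v w (xs @ a # b # ys) :: 'k) =
      - triangle_chain u v w (xs @ b # a # ys)" for xs a b ys
    by (cases "xs = []"; simp only: triangle_chain_def append_two_eq_three list.distinct(1) simp_thms;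
        simp only: conj_ac diff_conv_add_uminus minus_add_distrib minus_minus add_ac)
  ultimately show ?thesis unfolding simplicial_chains_def by blast
qed

lemma boundary_triangle_chain:
  assumes "finite (\<Union>\<Delta>)" "u \<in> \<Union>\<Delta>" "v \<in> \<Union>\<Delta>" "w \<in> \<Union>\<Delta>" 
  shows "boundary \<Delta> (triangle_chain u v w :: 'v list \<Rightarrow> 'k::field) =
    edge_chain u v + edge_chain v w + edge_chain w u"
proof
  fix xs
  have *: "(\<Sum>x\<in>\<Union>\<Delta>. of_bool (x # xs = a # ys) :: 'k) = of_bool (xs = ys)" if "a \<in> \<Union>\<Delta>" for a ys
  proof -
    have "(\<Sum>x\<in>\<Union>\<Delta>. of_bool (x # xs = a # ys) :: 'k) = (\<Sum>x\<in>\<Union>\<Delta>. if x = a then of_bool (xs = ys) else 0)"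
      by (intro sum.cong) auto
    also have "\<dots> = of_bool (xs = ys)" using assms(1) that by simp
    finally show ?thesis .
  qed
  show "boundary \<Delta> (triangle_chain u v w :: 'v list \<Rightarrow> 'k) xs =
    (edge_chain u v + edge_chain v w + edge_chain w u) xs"
    unfolding boundary_def triangle_chain_def sum.distrib sum_subtractf
      *[OF assms(2)] *[OF assms(3)] *[OF assms(4)] plus_fun_apply edge_chain_def
    by (simp only: algebra_simps)
qed

lemma boundary_edge_chain_vertex:
  assumes "finite (\<Union>\<Delta>)" "u \<in> \<Union>\<Delta>" "v \<in> \<Union>\<Delta>"
  shows "boundary \<Delta> (edge_chain u v :: 'v list \<Rightarrow> 'k::field) [x] = of_bool (x = v) - of_bool (x = u)"
proof -
  have *: "(\<Sum>y\<in>\<Union>\<Delta>. of_bool ([y, x] = [a, b]) :: 'k) = of_bool (x = b)" if "a \<in> \<Union>\<Delta>" for a b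
  proof -
    have "(\<Sum>y\<in>\<Union>\<Delta>. of_bool ([y, x] = [a, b]) :: 'k) = (\<Sum>y\<in>\<Union>\<Delta>. if y = a then of_bool (x = b) else 0)"
      by (intro sum.cong) auto
    also have "\<dots> = of_bool (x = b)" using assms(1) that by simp
    finally show ?thesis .
  qed
  show ?thesis
    unfolding boundary_def edge_chain_def sum_subtractf *[OF assms(2)] *[OF assms(3)] ..
qed

text \<open>Edge chains span the 1-chains: subtracting a multiple of one of them removes both
  orderings of an edge from the support.\<close>

lemma functional_vanishes_on_chains:
  fixes L :: "('v list \<Rightarrow> 'k::field) \<Rightarrow> 'k"
  assumes fin: "finite (\<Union>\<Delta>)"
    and L: "Vector_Spaces.linear chain_scale (*) L"
    and zero: "\<And>u v. {u, v} \<in> \<Delta> \<Longrightarrow> u \<noteq> v \<Longrightarrow> L (edge_chain u v) = 0"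
    and b: "b \<in> simplicial_chains \<Delta> 1"
  shows "L b = 0"
proof -
  interpret L: Vector_Spaces.linear chain_scale "(*)" L by (rule L)
  define supp :: "('v list \<Rightarrow> 'k) \<Rightarrow> 'v list set" where "supp b = {xs. b xs \<noteq> 0}" for b
  have len: "distinct xs \<and> set xs \<in> \<Delta> \<and> length xs = 2"
    if "b \<in> simplicial_chains \<Delta> 1" "xs \<in> supp b" for b xs
  proof -
    have "distinct xs \<and> set xs \<in> \<Delta> \<and> int (length xs) = 1 + 1"
      using that unfolding simplicial_chains_def supp_def by blast
    then show ?thesis by simp
  qed
  have "finite (supp b)" if "b \<in> simplicial_chains \<Delta> 1" for b
    using len[OF that] by (intro finite_subset[OF _ finite_lists_length_eq[OF fin, of 2]]) blast
  then show ?thesis using b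
  proof (induction "card (supp b)" arbitrary: b rule: less_induct)
    case less
    show ?case
    proof (cases "supp b = {}")
      case True
      then have "b = 0" by (auto simp: supp_def fun_eq_iff)
      then show ?thesis using L.zero by simp
    next
      case False
      then obtain xs where xs: "xs \<in> supp b" by blast
      note l = len[OF less.prems(2) xs]
      then obtain u v where uv: "xs = [u, v]" by (metis length_Suc_conv length_0_conv numeral_2_eq_2)
      have e: "{u, v} \<in> \<Delta>" "u \<noteq> v" using l uv by auto
      define t where "t = b [u, v]"
      define b' where "b' = b - chain_scale t (edge_chain u v)"
      have ec: "edge_chain u v \<in> simplicial_chains \<Delta> 1" using edge_chain_in_chains[OF e] .
      have b': "b' \<in> simplicial_chains \<Delta> 1" unfolding b'_def
        by (intro chain_space.subspace_diff[OF subspace_simplicial_chains] less.prems(2)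
            chain_space.subspace_scale[OF subspace_simplicial_chains] ec)
      have alt: "b ([] @ v # u # []) = - b ([] @ u # v # [])"
        using less.prems(2) unfolding simplicial_chains_def by blast
      have "supp b' \<subset> supp b"
      proof -
        have "b' ys = (if ys = [u, v] \<or> ys = [v, u] then 0 else b ys)" for ys
          using alt e(2) by (auto simp: b'_def chain_scale_def edge_chain_def t_def)
        then have "supp b' \<subseteq> supp b" "[u, v] \<notin> supp b'" by (auto simp: supp_def)
        then show ?thesis using xs uv by blast
      qed
      then have "card (supp b') < card (supp b)" using less.prems(1)[OF less.prems(2)] by (rule psubset_card_mono[rotated])
      then have "L b' = 0" using less.hyps less.prems(1) b' by blast
      moreover have "L b' = L b - t * L (edge_chain u v)"
        unfolding b'_def by (simp add: L.diff L.scale)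
      ultimately show ?thesis using zero[OF e] by simp
    qed
  qed
qed

lemma simplicial_complex_subset:
  "simplicial_complex \<Delta> \<Longrightarrow> \<sigma> \<in> \<Delta> \<Longrightarrow> \<tau> \<subseteq> \<sigma> \<Longrightarrow> \<tau> \<in> \<Delta>"
  unfolding simplicial_complex_def by blast

text \<open>
  A linear functional on 1-chains that vanishes on boundaries is a cocycle; it is not a
  coboundary as soon as it is nonzero on some cycle.
\<close>

lemma cocycle_of_betti:
  fixes \<Delta> :: "'v set set"
  assumes sc: "simplicial_complex \<Delta>" and b1: "reduced_betti TYPE('k::field) \<Delta> 1 \<noteq> 0"
  obtains c :: "'v \<Rightarrow> 'v \<Rightarrow> 'k::field" where "\<And>u v. c v u = - c u v"
    "\<And>u v w. {u, v, w} \<in> \<Delta> \<Longrightarrow> c u v + c v w = c u w"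
    "\<not> (\<exists>h. \<forall>u v. {u, v} \<in> \<Delta> \<longrightarrow> c u v = h v - h u)"
proof -
  have fin: "finite (\<Union>\<Delta>)" using sc unfolding simplicial_complex_def by blast
  have "\<not> (cycles \<Delta> 1 :: ('v list \<Rightarrow> 'k) set) \<subseteq> boundaries \<Delta> 1"
  proof
    assume "(cycles \<Delta> 1 :: ('v list \<Rightarrow> 'k) set) \<subseteq> boundaries \<Delta> 1"
    then have "(cycles \<Delta> 1 :: ('v list \<Rightarrow> 'k) set) = boundaries \<Delta> 1"
      using boundaries_subset_cycles[OF sc] by blast
    then show False using b1 by (simp add: reduced_betti_def)
  qed
  then obtain z :: "'v list \<Rightarrow> 'k" where z: "z \<in> cycles \<Delta> 1" "z \<notin> boundaries \<Delta> 1" by blast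
  obtain g where g: "Vector_Spaces.linear chain_scale ((*) :: 'k \<Rightarrow> 'k \<Rightarrow> 'k) g"
    "\<forall>w\<in>boundaries \<Delta> 1. g w = 0" "g z = 1"
    using functional_separating_subspace[OF subspace_boundaries z(2)] by blast
  interpret g: Vector_Spaces.linear chain_scale "(*)" g by (rule g(1))
  define c where "c u v = g (edge_chain u v)" for u v
  have anti: "c v u = - c u v" for u v
  proof -
    have "edge_chain v u = - (edge_chain u v :: 'v list \<Rightarrow> 'k)" by (auto simp: edge_chain_def)
    then show ?thesis by (simp add: c_def g.neg)
  qed
  have diag: "c u u = 0" for u
  proof -
    have "edge_chain u u = (0 :: 'v list \<Rightarrow> 'k)" by (auto simp: edge_chain_def)
    then show ?thesis by (simp add: c_def g.zero)
  qed
  have "c u v + c v w = c u w" if t: "{u, v, w} \<in> \<Delta>" for u v w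
  proof (cases "u = v \<or> u = w \<or> v = w")
    case True
    then show ?thesis using diag anti[of u v] anti[of v u] by auto
  next
    case False
    have V: "u \<in> \<Union>\<Delta>" "v \<in> \<Union>\<Delta>" "w \<in> \<Union>\<Delta>" using t by blast+
    have "triangle_chain u v w \<in> (simplicial_chains \<Delta> (1 + 1) :: ('v list \<Rightarrow> 'k) set)"
      using triangle_chain_in_chains[OF t] False by simp
    then have "boundary \<Delta> (triangle_chain u v w :: 'v list \<Rightarrow> 'k) \<in> boundaries \<Delta> 1"
      unfolding boundaries_def by blast
    then have "g (edge_chain u v + edge_chain v w + edge_chain w u) = 0"
      using g(2) boundary_triangle_chain[OF fin V] by metis
    then have "c u v + c v w + c w u = 0" by (simp add: c_def g.add)
    then show ?thesis using anti[of w u] by (simp add: eq_neg_iff_add_eq_0 add.assoc)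
  qed
  moreover have "\<not> (\<exists>h. \<forall>u v. {u, v} \<in> \<Delta> \<longrightarrow> c u v = h v - h u)"
  proof
    assume "\<exists>h. \<forall>u v. {u, v} \<in> \<Delta> \<longrightarrow> c u v = h v - h u"
    then obtain h where h: "\<And>u v. {u, v} \<in> \<Delta> \<Longrightarrow> c u v = h v - h u" by blast
    \<comment> \<open>Correcting \<open>g\<close> by the coboundary of \<open>h\<close> gives a
      functional that vanishes on edge chains, hence on all 1-chains. On a cycle the correction is
      0, which contradicts \<open>g z = 1\<close>.\<close>
    define L where "L b = g b - (\<Sum>x\<in>\<Union>\<Delta>. h x * boundary \<Delta> b [x])" for b
    have "Vector_Spaces.linear chain_scale ((*) :: 'k \<Rightarrow> 'k \<Rightarrow> 'k) L"
    proof (unfold_locales)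
      show "L (b1 + b2) = L b1 + L b2" for b1 b2
        by (simp add: L_def boundary_add g.add algebra_simps sum.distrib)
      show "L (chain_scale r b) = r * L b" for r b
      proof -
        have "(\<Sum>x\<in>\<Union>\<Delta>. h x * boundary \<Delta> (chain_scale r b) [x]) = r * (\<Sum>x\<in>\<Union>\<Delta>. h x * boundary \<Delta> b [x])"
          unfolding boundary_scale unfolding chain_scale_def sum_distrib_left
          by (rule sum.cong[OF refl]) (rule mult.left_commute)
        then show ?thesis by (simp add: L_def g.scale right_diff_distrib)
      qed
    qed
    moreover have "L (edge_chain u v) = 0" if e: "{u, v} \<in> \<Delta>" "u \<noteq> v" for u v
    proof -
      have V: "u \<in> \<Union>\<Delta>" "v \<in> \<Union>\<Delta>" using e by blast+
      have "(\<Sum>x\<in>\<Union>\<Delta>. h x * boundary \<Delta> (edge_chain u v) [x]) =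
        (\<Sum>x\<in>\<Union>\<Delta>. (if x = v then h x else 0) - (if x = u then h x else 0))"
        unfolding boundary_edge_chain_vertex[OF fin V] by (intro sum.cong) auto
      also have "\<dots> = h v - h u" using fin V by (simp add: sum_subtractf)
      finally show ?thesis using h[OF e(1)] by (simp add: L_def c_def)
    qed
    moreover have "z \<in> simplicial_chains \<Delta> 1" using z by (simp add: cycles_def)
    ultimately have "L z = 0" using functional_vanishes_on_chains[OF fin] by blast
    moreover have "boundary \<Delta> z = 0" using z by (simp add: cycles_def)
    ultimately show False using g(3) by (simp add: L_def)
  qed
  ultimately show thesis using that anti by blast
qed

text \<open>The additive cocycle has a nonzero period \<open>a\<close> along some closed edge path,
  since otherwise integration along paths would give a potential. Composing it with a character that
  is not 1 at \<open>a\<close> yields a multiplicative cocycle without a nowhere vanishing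
  section.\<close>

lemma multiplicative_cocycle_of_betti:
  fixes \<Delta> :: "'v set set"
  assumes sc: "simplicial_complex \<Delta>" and conn: "connected_complex \<Delta>"
    and b1: "reduced_betti TYPE('k::field) \<Delta> 1 \<noteq> 0"
  obtains \<chi> :: "'v \<Rightarrow> 'v \<Rightarrow> complex" where "\<And>u v. {u, v} \<in> \<Delta> \<Longrightarrow> \<chi> u v \<noteq> 0"
    "\<And>u v w. {u, v, w} \<in> \<Delta> \<Longrightarrow> \<chi> u v * \<chi> v w = \<chi> u w"
    "\<not> (\<exists>s. \<forall>u v. {u, v} \<in> \<Delta> \<longrightarrow> s u \<noteq> 0 \<and> s u = \<chi> u v * s v)"
proof -
  obtain c :: "'v \<Rightarrow> 'v \<Rightarrow> 'k" where anti: "\<And>u v. c v u = - c u v"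
    and coc: "\<And>u v w. {u, v, w} \<in> \<Delta> \<Longrightarrow> c u v + c v w = c u w"
    and ncob: "\<not> (\<exists>h. \<forall>u v. {u, v} \<in> \<Delta> \<longrightarrow> c u v = h v - h u)"
    using cocycle_of_betti[OF sc b1] by metis
  have fin: "finite (\<Union>\<Delta>)" using sc unfolding simplicial_complex_def by blast
  obtain v0 where v0: "v0 \<in> \<Union>\<Delta>" using ncob by blast
  \<comment> \<open>The edges of the covering of the 1-skeleton with fibre \<open>'k\<close>: a walk
    lifted from \<open>(v0, 0)\<close> records in its second component the sum of \<open>c\<close>
    along it.\<close>
  define R where "R = {((u, a), (v, a + c u v)) | u v a. {u, v} \<in> \<Delta>}"
  have Rsym: "(y, x) \<in> R" if xy: "(x, y) \<in> R" for x y
  proof -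
    obtain u v a where "x = (u, a)" "y = (v, a + c u v)" "{u, v} \<in> \<Delta>" using xy unfolding R_def by blast
    then show ?thesis unfolding R_def using anti[of v u]
      by (intro CollectI exI[of _ v] exI[of _ u] exI[of _ "a + c u v"]) (simp add: insert_commute)
  qed
  have Rsym': "(y, x) \<in> R\<^sup>*" if "(x, y) \<in> R\<^sup>*" for x y
  proof -
    have "sym R" using Rsym by (rule symI)
    then show ?thesis using that by (meson sym_rtrancl symD)
  qed
  have Rtrans: "((u, a + t), (v, b + t)) \<in> R\<^sup>*" if "((u, a), (v, b)) \<in> R\<^sup>*" for u v a b t
  proof -
    have "((fst x, snd x + t), (fst y, snd y + t)) \<in> R\<^sup>*" if "(x, y) \<in> R\<^sup>*" for x y
      using that
    proof induction
      case (step y z)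
      have "((fst y, snd y + t), (fst z, snd z + t)) \<in> R"
        using step.hyps(2) unfolding R_def
      proof -
        assume "(y, z) \<in> {((u, a), (v, a + c u v)) | u v a. {u, v} \<in> \<Delta>}"
        then obtain u v a where "y = (u, a)" "z = (v, a + c u v)" "{u, v} \<in> \<Delta>" by blast
        then show "((fst y, snd y + t), (fst z, snd z + t)) \<in> {((u, a), (v, a + c u v)) | u v a. {u, v} \<in> \<Delta>}"
          by (intro CollectI exI[of _ u] exI[of _ v] exI[of _ "a + t"]) simp
      qed
      with step.IH show ?case by (rule rtrancl_into_rtrancl)
    qed simp
    from this[OF that] show ?thesis by simp
  qed
  have "\<exists>a. a \<noteq> 0 \<and> ((v0, 0), (v0, a)) \<in> R\<^sup>*"
  proof (rule ccontr)
    assume "\<not> ?thesis"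
    then have loop: "a = 0" if "((v0, 0), (v0, a)) \<in> R\<^sup>*" for a using that by blast
    have uniq: "a = b" if "((v0, 0), (v, a)) \<in> R\<^sup>*" "((v0, 0), (v, b)) \<in> R\<^sup>*" for v a b
    proof -
      have "((v, b), (v0, 0)) \<in> R\<^sup>*" using Rsym'[OF that(2)] .
      from Rtrans[OF this, of "a - b"] have "((v, a), (v0, a - b)) \<in> R\<^sup>*" by simp
      with that(1) have "((v0, 0), (v0, a - b)) \<in> R\<^sup>*" by (rule rtrancl_trans)
      from loop[OF this] show ?thesis by simp
    qed
    have ex: "\<exists>a. ((v0, 0), (v, a)) \<in> R\<^sup>*" if v: "v \<in> \<Union>\<Delta>" for v
    proof -
      have "(v0, v) \<in> {(a, b). {a, b} \<in> \<Delta>}\<^sup>*" using conn v0 v unfolding connected_complex_def by blast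
      then show ?thesis
      proof induction
        case (step y z)
        then obtain a where a: "((v0, 0), (y, a)) \<in> R\<^sup>*" by blast
        have "((y, a), (z, a + c y z)) \<in> R" using step.hyps(2) unfolding R_def by blast
        with a show ?case by (meson rtrancl_into_rtrancl)
      qed blast
    qed
    define h where "h v = (SOME a. ((v0, 0), (v, a)) \<in> R\<^sup>*)" for v
    have h: "((v0, 0), (v, h v)) \<in> R\<^sup>*" if "v \<in> \<Union>\<Delta>" for v
      unfolding h_def using ex[OF that] by (rule someI_ex)
    have "c u v = h v - h u" if e: "{u, v} \<in> \<Delta>" for u v
    proof -
      have "((u, h u), (v, h u + c u v)) \<in> R" using e unfolding R_def by blast
      moreover have "((v0, 0), (u, h u)) \<in> R\<^sup>*" using h e by blast
      ultimately have "((v0, 0), (v, h u + c u v)) \<in> R\<^sup>*" by (meson rtrancl_into_rtrancl)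
      moreover have "((v0, 0), (v, h v)) \<in> R\<^sup>*" using h e by blast
      ultimately have "h u + c u v = h v" by (rule uniq)
      then show ?thesis by (simp add: algebra_simps)
    qed
    then show False using ncob by blast
  qed
  then obtain a where a: "a \<noteq> 0" "((v0, 0), (v0, a)) \<in> R\<^sup>*" by blast
  define C where "C = (\<lambda>(u, v). c u v) ` (\<Union>\<Delta> \<times> \<Union>\<Delta>)"
  have "finite C" using fin unfolding C_def by blast
  then obtain \<Gamma> z where G: "partial_character \<Gamma>" "(a, z) \<in> \<Gamma>" "z \<noteq> 1" "C \<subseteq> fst ` \<Gamma>"
    using partial_character_exists[OF _ a(1), of C] by blast
  define \<chi> where "\<chi> u v = (SOME z. (c u v, z) \<in> \<Gamma>)" for u v
  have chi: "(c u v, \<chi> u v) \<in> \<Gamma>" if "u \<in> \<Union>\<Delta>" "v \<in> \<Union>\<Delta>" for u v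
  proof -
    have "c u v \<in> C" using that unfolding C_def by blast
    then have "c u v \<in> fst ` \<Gamma>" using G(4) by blast
    then have "\<exists>z. (c u v, z) \<in> \<Gamma>" by force
    then show ?thesis unfolding \<chi>_def by (rule someI_ex)
  qed
  show thesis
  proof (rule that[of \<chi>])
    show "\<chi> u v \<noteq> 0" if e: "{u, v} \<in> \<Delta>" for u v
    proof -
      have "(c u v, \<chi> u v) \<in> \<Gamma>" using e by (intro chi) blast+
      then show ?thesis by (rule partial_character_nonzero[OF G(1)])
    qed
    show "\<chi> u v * \<chi> v w = \<chi> u w" if t: "{u, v, w} \<in> \<Delta>" for u v w
    proof (rule partial_character_unique[OF G(1)])
      show "(c u w, \<chi> u w) \<in> \<Gamma>" using t by (intro chi) blast+
      have "(c u v, \<chi> u v) \<in> \<Gamma>" "(c v w, \<chi> v w) \<in> \<Gamma>" using t by (intro chi; blast)+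
      then have "(c u v + c v w, \<chi> u v * \<chi> v w) \<in> \<Gamma>" by (rule partial_character_add[OF G(1)])
      then show "(c u w, \<chi> u v * \<chi> v w) \<in> \<Gamma>" unfolding coc[OF t] .
    qed
    show "\<not> (\<exists>s. \<forall>u v. {u, v} \<in> \<Delta> \<longrightarrow> s u \<noteq> 0 \<and> s u = \<chi> u v * s v)"
    proof
      assume "\<exists>s. \<forall>u v. {u, v} \<in> \<Delta> \<longrightarrow> s u \<noteq> 0 \<and> s u = \<chi> u v * s v"
      then obtain s where s: "\<And>u v. {u, v} \<in> \<Delta> \<Longrightarrow> s u \<noteq> 0 \<and> s u = \<chi> u v * s v" by blast
      \<comment> \<open>Along a lifted walk a section changes by the character of the accumulated
        sum, so the closed walk with period \<open>a\<close> would force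
        \<open>z = 1\<close>.\<close>
      have "\<exists>w. (snd y, w) \<in> \<Gamma> \<and> s v0 = w * s (fst y)" if "((v0, 0), y) \<in> R\<^sup>*" for y
        using that
      proof induction
        case base
        show ?case using partial_character_0[OF G(1)] by (intro exI[of _ 1]) simp
      next
        case (step y y')
        then obtain w where w: "(snd y, w) \<in> \<Gamma>" "s v0 = w * s (fst y)" by blast
        obtain u v b where y: "y = (u, b)" "y' = (v, b + c u v)" "{u, v} \<in> \<Delta>"
          using step.hyps(2) unfolding R_def by blast
        have "(c u v, \<chi> u v) \<in> \<Gamma>" using y(3) by (intro chi) blast+
        then have "(b + c u v, w * \<chi> u v) \<in> \<Gamma>" using w(1) y(1) by (intro partial_character_add[OF G(1)]) simp_all
        moreover have "s v0 = w * \<chi> u v * s v"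
        proof -
          have "s u = \<chi> u v * s v" using s[OF y(3)] by (rule conjunct2)
          then show ?thesis using w(2) unfolding y(1) fst_conv by (metis mult.assoc)
        qed
        ultimately show ?case unfolding y(2) fst_conv snd_conv by (intro exI[of _ "w * \<chi> u v"] conjI)
      qed
      note this[OF a(2), unfolded fst_conv snd_conv]
      then obtain w where w: "(a, w) \<in> \<Gamma>" "s v0 = w * s v0" by (elim exE conjE)
      have "w = z" using partial_character_unique[OF G(1) w(1) G(2)] .
      moreover have "{v0, v0} \<in> \<Delta>"
      proof -
        obtain \<sigma> where "\<sigma> \<in> \<Delta>" "v0 \<in> \<sigma>" using v0 by blast
        then show ?thesis using simplicial_complex_subset[OF sc, of \<sigma> "{v0, v0}"] by simp
      qed
      then have "s v0 \<noteq> 0" by (rule s[THEN conjunct1])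
      ultimately show False using w(2) G(3) by (metis mult_cancel_right1)
    qed
  qed
qed

section \<open>Normal pseudomanifolds\<close>

text \<open>The combinatorial content of a homology manifold on which the rest is based.
  \<open>d\<close> is the number of vertices of a facet. Connectedness of the whole complex, the
  case of the empty face, is kept as a separate assumption.\<close>

definition normal_pseudomanifold :: "nat \<Rightarrow> 'v set set \<Rightarrow> bool" where
  "normal_pseudomanifold d \<Delta> \<longleftrightarrow> simplicial_complex \<Delta> \<and>
     (\<forall>\<sigma>\<in>\<Delta>. card \<sigma> \<le> d \<and> (\<exists>F\<in>\<Delta>. \<sigma> \<subseteq> F \<and> card F = d)) \<and>
     (\<forall>\<rho>\<in>\<Delta>. card \<rho> + 1 = d \<longrightarrow> card {x. x \<notin> \<rho> \<and> insert x \<rho> \<in> \<Delta>} = 2) \<and>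
     (\<forall>\<rho>\<in>\<Delta>. \<rho> \<noteq> {} \<longrightarrow> card \<rho> + 2 \<le> d \<longrightarrow> connected_complex (link \<Delta> \<rho>))"

lemma simplicial_complex_finite_Union: "simplicial_complex \<Delta> \<Longrightarrow> finite (\<Union>\<Delta>)"
  unfolding simplicial_complex_def by blast

lemma simplicial_complex_finite_face: "simplicial_complex \<Delta> \<Longrightarrow> \<sigma> \<in> \<Delta> \<Longrightarrow> finite \<sigma>"
  unfolding simplicial_complex_def by blast

lemma simplicial_complex_link:
  assumes sc: "simplicial_complex \<Delta>" and r: "\<rho> \<in> \<Delta>"
  shows "simplicial_complex (link \<Delta> \<rho>)"
  unfolding simplicial_complex_def
proof (intro conjI ballI allI impI)
  have sub: "\<tau> \<in> \<Delta>" if "\<tau> \<in> link \<Delta> \<rho>" for \<tau>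
    using that simplicial_complex_subset[OF sc, of "\<tau> \<union> \<rho>" \<tau>] by (simp add: link_def)
  then have "link \<Delta> \<rho> \<subseteq> \<Delta>" by blast
  then show "finite (link \<Delta> \<rho>)" using sc finite_subset unfolding simplicial_complex_def by metis
  show "{} \<in> link \<Delta> \<rho>" using r by (simp add: link_def)
  show "finite \<sigma>" if "\<sigma> \<in> link \<Delta> \<rho>" for \<sigma>
    using simplicial_complex_finite_face[OF sc sub[OF that]] .
  show "\<tau> \<in> link \<Delta> \<rho>" if "\<sigma> \<in> link \<Delta> \<rho>" "\<tau> \<subseteq> \<sigma>" for \<sigma> \<tau>
  proof -
    have "\<tau> \<union> \<rho> \<subseteq> \<sigma> \<union> \<rho>" using that(2) by blast
    then show ?thesis using that simplicial_complex_subset[OF sc, of "\<sigma> \<union> \<rho>" "\<tau> \<union> \<rho>"]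
      by (auto simp: link_def)
  qed
qed

section \<open>Reduced homology in degree 0\<close>

definition point_chain :: "'v \<Rightarrow> 'v list \<Rightarrow> 'k::field" where
  "point_chain x = (\<lambda>xs. of_bool (xs = [x]))"

lemma point_chain_in_chains:
  assumes "{x} \<in> L"
  shows "(point_chain x :: 'v list \<Rightarrow> 'k::field) \<in> simplicial_chains L 0"
proof -
  have "distinct xs \<and> set xs \<in> L \<and> int (length xs) = 0 + 1" if "(point_chain x xs :: 'k) \<noteq> 0" for xs
    using that assms by (auto simp: point_chain_def split: if_splits)
  moreover have "(point_chain x (xs @ u # v # ys) :: 'k) = - point_chain x (xs @ v # u # ys)" for xs u v ys
    by (simp add: point_chain_def append_eq_Cons_conv)
  ultimately show ?thesis unfolding simplicial_chains_def by blast
qed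

lemma point_diff_cycle:
  assumes sc: "simplicial_complex L" and x: "x \<in> \<Union>L" "y \<in> \<Union>L"
  shows "(point_chain x - point_chain y :: 'v list \<Rightarrow> 'k::field) \<in> cycles L 0"
proof -
  have fin: "finite (\<Union>L)" using simplicial_complex_finite_Union[OF sc] .
  have vert: "{z} \<in> L" if z: "z \<in> \<Union>L" for z
  proof -
    obtain \<sigma> where "\<sigma> \<in> L" "z \<in> \<sigma>" using z by blast
    then show ?thesis using simplicial_complex_subset[OF sc, of \<sigma> "{z}"] by simp
  qed
  have "boundary L (point_chain z :: 'v list \<Rightarrow> 'k) xs = of_bool (xs = [])" if "z \<in> \<Union>L" for z xs
  proof -
    have "boundary L (point_chain z :: 'v list \<Rightarrow> 'k) xs = (\<Sum>v\<in>\<Union>L. if v = z then of_bool (xs = []) else 0)"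
      unfolding boundary_def point_chain_def by (intro sum.cong) auto
    then show ?thesis using fin that by simp
  qed
  then have "boundary L (point_chain x - point_chain y :: 'v list \<Rightarrow> 'k) = 0"
    using x unfolding boundary_def by (auto simp: fun_eq_iff sum_subtractf)
  moreover have "(point_chain x - point_chain y :: 'v list \<Rightarrow> 'k) \<in> simplicial_chains L 0"
    by (intro chain_space.subspace_diff[OF subspace_simplicial_chains] point_chain_in_chains vert x)
  ultimately show ?thesis by (simp add: cycles_def)
qed

text \<open>The Betti number is a truncated difference of dimensions, so its vanishing only says
  that the cycles have at most the dimension of the boundaries. A cycle that is no boundary would
  enlarge a basis of the boundaries inside the finite-dimensional space of cycles.\<close>

lemma cycles_subset_boundaries:
  assumes sc: "simplicial_complex L" and b: "reduced_betti TYPE('k::field) L j = 0"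
  shows "(cycles L j :: ('v list \<Rightarrow> 'k) set) \<subseteq> boundaries L j"
proof
  fix z :: "'v list \<Rightarrow> 'k"
  assume z: "z \<in> cycles L j"
  let ?C = "cycles L j :: ('v list \<Rightarrow> 'k) set" and ?B = "boundaries L j :: ('v list \<Rightarrow> 'k) set"
  show "z \<in> ?B"
  proof (rule ccontr)
    assume zB: "z \<notin> ?B"
    obtain B where B: "B \<subseteq> ?B" "chain_space.independent B" "?B \<subseteq> chain_space.span B"
      "card B = chain_space.dim ?B"
      using chain_space.basis_exists[of ?B] by blast
    obtain D where D: "D \<subseteq> ?C" "chain_space.independent D" "?C \<subseteq> chain_space.span D"
      "card D = chain_space.dim ?C"
      using chain_space.basis_exists[of ?C] by blast
    obtain G where G: "finite G" "(simplicial_chains L j :: ('v list \<Rightarrow> 'k) set) \<subseteq> chain_space.span G"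
      using finite_dimensional_simplicial_chains[OF sc] by blast
    have "?C \<subseteq> simplicial_chains L j" by (auto simp: cycles_def)
    then have "D \<subseteq> chain_space.span G" using D(1) G(2) by blast
    then have finD: "finite D" using chain_space.independent_span_bound[OF G(1) D(2)] by blast
    have "chain_space.span B \<subseteq> ?B" using chain_space.span_minimal[OF B(1) subspace_boundaries] .
    then have "z \<notin> chain_space.span B" using zB by blast
    then have ind: "chain_space.independent (insert z B)"
      using chain_space.independent_insertI B(2) by blast
    have "insert z B \<subseteq> chain_space.span D"
      using z B(1) D(3) boundaries_subset_cycles[OF sc, of j, where 'b = 'k] by blast
    from chain_space.independent_span_bound[OF finD ind this]
    have "finite (insert z B)" "card (insert z B) \<le> card D" by auto
    moreover have "z \<notin> B" using zB B(1) by blast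
    ultimately have "Suc (card B) \<le> card D" by simp
    then show False using B(4) D(4) b by (simp add: reduced_betti_def)
  qed
qed

text \<open>The difference of two vertices is the boundary of a 1-chain. Summed over the component
  of \<open>u\<close> this boundary is 0, because no edge leaves the component and an edge inside
  contributes at its two ends with opposite signs; so \<open>w\<close> lies in the component as
  well.\<close>

lemma connected_of_betti_0:
  fixes L :: "'v set set"
  assumes sc: "simplicial_complex L" and b: "reduced_betti TYPE('k::field) L 0 = 0"
  shows "connected_complex L"
  unfolding connected_complex_def
proof (intro ballI)
  fix u w assume u: "u \<in> \<Union>L" and w: "w \<in> \<Union>L"
  have fin: "finite (\<Union>L)" using simplicial_complex_finite_Union[OF sc] .
  define E where "E = {(a, b). {a, b} \<in> L}"
  define K where "K = {v\<in>\<Union>L. (u, v) \<in> E\<^sup>*}"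
  have "(point_chain u - point_chain w :: 'v list \<Rightarrow> 'k) \<in> boundaries L 0"
    using cycles_subset_boundaries[OF sc b] point_diff_cycle[OF sc u w] by blast
  then obtain c :: "'v list \<Rightarrow> 'k" where c: "c \<in> simplicial_chains L (0 + 1)"
    "point_chain u - point_chain w = boundary L c"
    unfolding boundaries_def by blast
  have supp: "distinct xs \<and> set xs \<in> L" if "c xs \<noteq> 0" for xs
    using c(1) that unfolding simplicial_chains_def by blast
  have alt: "c [x, y] = - c [y, x]" for x y
  proof -
    have "c ([] @ x # y # []) = - c ([] @ y # x # [])" using c(1) unfolding simplicial_chains_def by blast
    then show ?thesis by simp
  qed
  have finK: "finite K" by (rule finite_subset[OF _ fin]) (auto simp: K_def)
  have "(\<Sum>v\<in>K. boundary L c [v]) = (\<Sum>v\<in>K. \<Sum>y\<in>K. c [y, v])"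
  proof (rule sum.cong[OF refl])
    fix v assume v: "v \<in> K"
    have "c [y, v] = 0" if y: "y \<in> \<Union>L - K" for y
    proof (rule ccontr)
      assume "c [y, v] \<noteq> 0"
      then have "{v, y} \<in> L" using supp[of "[y, v]"] by (simp add: insert_commute)
      then have "(v, y) \<in> E" by (simp add: E_def)
      moreover have "(u, v) \<in> E\<^sup>*" using v by (simp add: K_def)
      ultimately have "(u, y) \<in> E\<^sup>*" by (rule rtrancl_into_rtrancl[rotated])
      then show False using y unfolding K_def by blast
    qed
    then show "boundary L c [v] = (\<Sum>y\<in>K. c [y, v])"
      unfolding boundary_def using fin by (intro sum.mono_neutral_right) (auto simp: K_def)
  qed
  also have "\<dots> = 0"
  proof (rule sum_alternating_eq_0[OF finK])
    show "c [x, x] = 0" for x using supp[of "[x, x]"] by auto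
    show "c [y, x] = - c [x, y]" for x y by (rule alt)
  qed
  finally have 0: "(\<Sum>v\<in>K. boundary L c [v]) = 0" .
  have "boundary L c [v] = of_bool (v = u) - of_bool (v = w)" for v
    unfolding c(2)[symmetric] by (simp add: point_chain_def)
  then have "(\<Sum>v\<in>K. (if v = u then 1 else 0) - (if v = w then 1 else 0) :: 'k) = 0"
    using 0 by (simp add: of_bool_def)
  moreover have "u \<in> K" using u by (simp add: K_def)
  ultimately have "w \<in> K" using finK by (simp add: sum_subtractf split: if_splits)
  then show "(u, w) \<in> {(a, b). {a, b} \<in> L}\<^sup>*" by (simp add: K_def E_def)
qed

lemma dim_zero_space: "chain_space.dim ({0} :: ('v list \<Rightarrow> 'k::field) set) = 0"
  by (rule chain_space.dim_unique[of "{}"]) (auto simp: chain_space.independent_empty)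

text \<open>Without edges there are no 1-chains, so the reduced homology is the space of 0-cycles,
  of dimension one less than the number of points.\<close>

lemma two_points_of_betti_0:
  fixes L :: "'v set set"
  assumes sc: "simplicial_complex L" and b: "reduced_betti TYPE('k::field) L 0 = 1"
    and dim: "\<And>\<sigma>. \<sigma> \<in> L \<Longrightarrow> card \<sigma> \<le> 1"
  shows "card (\<Union>L) = 2"
proof -
  have fin: "finite (\<Union>L)" using simplicial_complex_finite_Union[OF sc] .
  have "(simplicial_chains L (0 + 1) :: ('v list \<Rightarrow> 'k) set) \<subseteq> {0}"
  proof
    fix c :: "'v list \<Rightarrow> 'k" assume c: "c \<in> simplicial_chains L (0 + 1)"
    have "c xs = 0" for xs
    proof (rule ccontr)
      assume "c xs \<noteq> 0"
      then have "distinct xs \<and> set xs \<in> L \<and> int (length xs) = 0 + 1 + 1"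
        using c unfolding simplicial_chains_def by blast
      then show False using dim[of "set xs"] distinct_card[of xs] by simp
    qed
    then show "c \<in> {0}" by (simp add: fun_eq_iff)
  qed
  then have "(boundaries L 0 :: ('v list \<Rightarrow> 'k) set) \<subseteq> {0}"
    unfolding boundaries_def using boundary_zero by fastforce
  then have "(boundaries L 0 :: ('v list \<Rightarrow> 'k) set) = {0}"
    using chain_space.subspace_0[OF subspace_boundaries] by blast
  then have dimC: "chain_space.dim (cycles L 0 :: ('v list \<Rightarrow> 'k) set) = 1"
    using b by (simp add: reduced_betti_def dim_zero_space)
  have "\<not> card (\<Union>L) \<le> 1"
  proof
    assume le: "card (\<Union>L) \<le> 1"
    have "(cycles L 0 :: ('v list \<Rightarrow> 'k) set) \<subseteq> {0}"
    proof
      fix c :: "'v list \<Rightarrow> 'k" assume c: "c \<in> cycles L 0"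
      have "c xs = 0" for xs
      proof (rule ccontr)
        assume nz: "c xs \<noteq> 0"
        then have "distinct xs \<and> set xs \<in> L \<and> int (length xs) = 0 + 1"
          using c unfolding cycles_def simplicial_chains_def by blast
        then obtain x where x: "xs = [x]" "{x} \<in> L" by (cases xs) auto
        then have "\<Union>L = {x}" using le fin by (metis Union_iff card_le_Suc0_iff_eq is_singletonI' is_singleton_the_elem One_nat_def singletonI singletonD empty_iff)
        then have "boundary L c [] = c [x]" by (simp add: boundary_def)
        moreover have "boundary L c = 0" using c by (simp add: cycles_def)
        ultimately show False using nz x by simp
      qed
      then show "c \<in> {0}" by (simp add: fun_eq_iff)
    qed
    then have "(cycles L 0 :: ('v list \<Rightarrow> 'k) set) = {0}"
      using chain_space.subspace_0[OF subspace_cycles] by blast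
    then show False using dimC by (simp add: dim_zero_space)
  qed
  moreover have "\<not> 3 \<le> card (\<Union>L)"
  proof
    assume "3 \<le> card (\<Union>L)"
    then obtain T where T: "T \<subseteq> \<Union>L" "card T = 3" by (meson obtain_subset_with_card_n)
    then obtain x y z where xyz: "T = {x, y, z}" "x \<noteq> y" "x \<noteq> z" "y \<noteq> z"
      by (metis card_3_iff)
    have V: "x \<in> \<Union>L" "y \<in> \<Union>L" "z \<in> \<Union>L" using T xyz by auto
    \<comment> \<open>In a space of dimension 1, \<open>x - y\<close> and \<open>y - z\<close> are
      multiples of one vector; that vector is nonzero at \<open>x\<close>, which forces the second
      multiple to be 0.\<close>
    obtain B where B: "B \<subseteq> (cycles L 0 :: ('v list \<Rightarrow> 'k) set)"
      "(cycles L 0 :: ('v list \<Rightarrow> 'k) set) \<subseteq> chain_space.span B" "card B = 1"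
      using chain_space.basis_exists[of "cycles L 0 :: ('v list \<Rightarrow> 'k) set"] dimC by metis
    then obtain w where w: "B = {w}" using card_1_singletonE by blast
    have *: "\<exists>k. c = chain_scale k w" if "c \<in> cycles L 0" for c
      using that B(2) unfolding w chain_space.span_singleton by blast
    obtain k where k: "point_chain x - point_chain y = chain_scale k w"
      using *[OF point_diff_cycle[OF sc V(1,2)]] by blast
    obtain l where l: "point_chain y - point_chain z = chain_scale l w"
      using *[OF point_diff_cycle[OF sc V(2,3)]] by blast
    have "k * w [x] = 1" using fun_cong[OF k, of "[x]"] xyz by (simp add: point_chain_def chain_scale_def)
    moreover have "l * w [x] = 0" using fun_cong[OF l, of "[x]"] xyz by (simp add: point_chain_def chain_scale_def)
    moreover have "l * w [y] = 1" using fun_cong[OF l, of "[y]"] xyz by (simp add: point_chain_def chain_scale_def)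
    ultimately show False by auto
  qed
  ultimately show ?thesis by linarith
qed

text \<open>The link of a ridge is a homology 0-sphere consisting of vertices, hence two points. The
  link of a nonempty face of codimension at least 2 is a homology sphere of positive dimension,
  hence connected.\<close>

lemma normal_pseudomanifold_of_homology_manifold:
  fixes \<Delta> :: "'v set set"
  assumes m: "homology_manifold_without_boundary TYPE('k::field) \<Delta>"
    and dim: "complex_dim \<Delta> = int d - 1" and d: "2 \<le> d"
  shows "normal_pseudomanifold d \<Delta>"
proof -
  have sc: "simplicial_complex \<Delta>" and pure: "pure_complex \<Delta>"
    and sphere: "\<And>\<rho>. \<rho> \<in> \<Delta> \<Longrightarrow> \<rho> \<noteq> {} \<Longrightarrow>
      homology_of_sphere TYPE('k) (link \<Delta> \<rho>) (int d - 1 - int (card \<rho>))"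
    using m dim unfolding homology_manifold_without_boundary_def homology_manifold_def by auto
  have fin: "finite \<Delta>" using sc unfolding simplicial_complex_def by blast
  have le: "card \<sigma> \<le> d" if "\<sigma> \<in> \<Delta>" for \<sigma>
  proof -
    have "int (card \<sigma>) - 1 \<le> complex_dim \<Delta>"
      unfolding complex_dim_def using fin that by (intro Max_ge) auto
    then show ?thesis using dim by simp
  qed
  have facet: "\<exists>F\<in>\<Delta>. \<sigma> \<subseteq> F \<and> card F = d" if s: "\<sigma> \<in> \<Delta>" for \<sigma>
  proof -
    obtain F where F: "F \<in> \<Delta>" "\<sigma> \<subseteq> F" "\<And>G. G \<in> \<Delta> \<Longrightarrow> F \<subseteq> G \<Longrightarrow> F = G"
      using finite_has_maximal2[OF fin s] by metis
    then have "F \<in> facets \<Delta>" unfolding facets_def by blast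
    then have "int (card F) - 1 = int d - 1" using pure dim unfolding pure_complex_def by metis
    then show ?thesis using F by (intro bexI[of _ F]) auto
  qed
  have link_card: "card \<tau> + card \<rho> \<le> d" if "\<tau> \<in> link \<Delta> \<rho>" for \<tau> \<rho>
  proof -
    have t: "\<tau> \<inter> \<rho> = {}" "\<tau> \<union> \<rho> \<in> \<Delta>" using that by (auto simp: link_def)
    have "finite (\<tau> \<union> \<rho>)" using simplicial_complex_finite_face[OF sc t(2)] .
    then have "card (\<tau> \<union> \<rho>) = card \<tau> + card \<rho>" using t(1) by (intro card_Un_disjoint) auto
    then show ?thesis using le[OF t(2)] by simp
  qed
  have "card {x. x \<notin> \<rho> \<and> insert x \<rho> \<in> \<Delta>} = 2" if r: "\<rho> \<in> \<Delta>" "card \<rho> + 1 = d" for \<rho>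
  proof -
    have "\<rho> \<noteq> {}" using r d by auto
    have "card (\<Union>(link \<Delta> \<rho>)) = 2"
    proof (rule two_points_of_betti_0[where 'k = 'k])
      show "simplicial_complex (link \<Delta> \<rho>)" using simplicial_complex_link[OF sc r(1)] .
      show "reduced_betti TYPE('k) (link \<Delta> \<rho>) 0 = 1"
        using sphere[OF r(1) \<open>\<rho> \<noteq> {}\<close>] r(2) unfolding homology_of_sphere_def by auto
      show "card \<sigma> \<le> 1" if "\<sigma> \<in> link \<Delta> \<rho>" for \<sigma> using link_card[OF that] r(2) by simp
    qed
    moreover have "\<Union>(link \<Delta> \<rho>) = {x. x \<notin> \<rho> \<and> insert x \<rho> \<in> \<Delta>}"
    proof (intro equalityI subsetI)
      fix x assume "x \<in> \<Union>(link \<Delta> \<rho>)"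
      then obtain \<tau> where t: "x \<in> \<tau>" "\<tau> \<inter> \<rho> = {}" "\<tau> \<union> \<rho> \<in> \<Delta>" by (auto simp: link_def)
      have "insert x \<rho> \<in> \<Delta>" using t(1) by (intro simplicial_complex_subset[OF sc t(3)]) auto
      then show "x \<in> {x. x \<notin> \<rho> \<and> insert x \<rho> \<in> \<Delta>}" using t by auto
    next
      fix x assume "x \<in> {x. x \<notin> \<rho> \<and> insert x \<rho> \<in> \<Delta>}"
      then have "{x} \<in> link \<Delta> \<rho>" by (simp add: link_def)
      then show "x \<in> \<Union>(link \<Delta> \<rho>)" by blast
    qed
    ultimately show ?thesis by simp
  qed
  moreover have "connected_complex (link \<Delta> \<rho>)" if r: "\<rho> \<in> \<Delta>" "\<rho> \<noteq> {}" "card \<rho> + 2 \<le> d" for \<rho>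
  proof (rule connected_of_betti_0[where 'k = 'k])
    show "simplicial_complex (link \<Delta> \<rho>)" using simplicial_complex_link[OF sc r(1)] .
    show "reduced_betti TYPE('k) (link \<Delta> \<rho>) 0 = 0"
      using sphere[OF r(1,2)] r(3) unfolding homology_of_sphere_def by auto
  qed
  ultimately show ?thesis using sc le facet unfolding normal_pseudomanifold_def by blast
qed

section \<open>Walks through facets and the cycles carried by links\<close>

context
  fixes \<Delta> :: "'v set set" and d :: nat
  assumes pm: "normal_pseudomanifold d \<Delta>"
begin

lemma pm_complex: "simplicial_complex \<Delta>"
  using pm unfolding normal_pseudomanifold_def by blast

lemma pm_facet: "\<sigma> \<in> \<Delta> \<Longrightarrow> \<exists>F\<in>\<Delta>. \<sigma> \<subseteq> F \<and> card F = d"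
  using pm unfolding normal_pseudomanifold_def by blast

lemma pm_ridge: "\<rho> \<in> \<Delta> \<Longrightarrow> card \<rho> + 1 = d \<Longrightarrow> card {x. x \<notin> \<rho> \<and> insert x \<rho> \<in> \<Delta>} = 2"
  using pm unfolding normal_pseudomanifold_def by blast

lemma pm_connected: "\<rho> \<in> \<Delta> \<Longrightarrow> \<rho> \<noteq> {} \<Longrightarrow> card \<rho> + 2 \<le> d \<Longrightarrow> connected_complex (link \<Delta> \<rho>)"
  using pm unfolding normal_pseudomanifold_def by blast

lemmas pm_subset = simplicial_complex_subset[OF pm_complex]
  and pm_finite = simplicial_complex_finite_face[OF pm_complex]

text \<open>Induction on the codimension: a walk in the connected link of \<rho> is followed vertex
  by vertex, and at a vertex \<open>a\<close> the induction hypothesis moves freely among the facets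
  containing \<open>insert a \<rho>\<close>. Stating it for a family closed under crossing ridges
  avoids explicit chains of facets.\<close>

lemma pm_strongly_connected:
  assumes "\<rho> \<in> \<Delta>" "\<rho> \<noteq> {}" "card \<rho> + e = d"
    and "\<And>F G. F \<in> Y \<Longrightarrow> G \<in> \<Delta> \<Longrightarrow> card F = d \<Longrightarrow> card G = d \<Longrightarrow> \<rho> \<subseteq> F \<Longrightarrow> \<rho> \<subseteq> G \<Longrightarrow>
      card (F \<inter> G) + 1 = d \<Longrightarrow> G \<in> Y"
    and "F0 \<in> Y" "F0 \<in> \<Delta>" "card F0 = d" "\<rho> \<subseteq> F0" "G \<in> \<Delta>" "card G = d" "\<rho> \<subseteq> G"
  shows "G \<in> Y"
  using assms
proof (induction e arbitrary: \<rho> F0 G)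
  case 0
  note p = 0
  have "F0 = \<rho>" using p(3,7,8) pm_finite[OF p(6)] by (metis add_0_right card_subset_eq)
  moreover have "G = \<rho>" using p(3,10,11) pm_finite[OF p(9)] by (metis add_0_right card_subset_eq)
  ultimately show ?case using p(5) by simp
next
  case (Suc e)
  note p = Suc.prems
  have ins: "x \<notin> \<rho>" "insert x \<rho> \<in> \<Delta>" "card (insert x \<rho>) + e = d"
    if "H \<in> \<Delta>" "\<rho> \<subseteq> H" "x \<in> H - \<rho>" for x H
  proof -
    show "x \<notin> \<rho>" using that by blast
    show "insert x \<rho> \<in> \<Delta>" using that by (intro pm_subset[OF that(1)]) auto
    show "card (insert x \<rho>) + e = d" using that pm_finite[OF p(1)] p(3) by simp
  qed
  have ne: "\<exists>x. x \<in> H - \<rho>" if "card H = d" "\<rho> \<subseteq> H" for H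
  proof -
    have "H \<noteq> \<rho>" using that p(3) by auto
    then show ?thesis using that(2) by blast
  qed
  have IH: "H' \<in> Y" if H: "H \<in> Y" "H \<in> \<Delta>" "card H = d" "insert x \<rho> \<subseteq> H" "x \<notin> \<rho>"
    "H' \<in> \<Delta>" "card H' = d" "insert x \<rho> \<subseteq> H'" for x H H'
  proof (rule Suc.IH[of "insert x \<rho>" H])
    show "insert x \<rho> \<in> \<Delta>" "card (insert x \<rho>) + e = d" using ins[of H x] H by auto
    show "G \<in> Y" if "F \<in> Y" "G \<in> \<Delta>" "card F = d" "card G = d" "insert x \<rho> \<subseteq> F" "insert x \<rho> \<subseteq> G"
      "card (F \<inter> G) + 1 = d" for F G
      using p(4)[OF that(1-4) _ _ that(7)] that(5,6) by simp
  qed (use H in auto)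
  obtain x0 where x0: "x0 \<in> F0 - \<rho>" using ne[OF p(7,8)] by blast
  obtain y where y: "y \<in> G - \<rho>" using ne[OF p(10,11)] by blast
  show ?case
  proof (cases "e = 0")
    \<comment> \<open>Here \<rho> is a ridge: two different facets above it meet exactly in \<rho>,
      so they are adjacent.\<close>
    case True
    show ?thesis
    proof (cases "F0 = G")
      case False
      have "F0 \<inter> G = \<rho>"
      proof (rule ccontr)
        assume "F0 \<inter> G \<noteq> \<rho>"
        then obtain z where z: "z \<in> F0 \<inter> G - \<rho>" using p(8,11) by blast
        have "F0 = insert z \<rho>" "G = insert z \<rho>"
          using ins(3)[OF p(6,8), of z] ins(3)[OF p(9,11), of z] z True p(7,8,10,11)
            pm_finite[OF p(6)] pm_finite[OF p(9)] card_subset_eq[of F0 "insert z \<rho>"]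
            card_subset_eq[of G "insert z \<rho>"] by auto
        then show False using False by simp
      qed
      then show ?thesis using p(4)[of F0 G] p(3,5-11) True by simp
    qed (use p in simp)
  next
    case False
    define L where "L = link \<Delta> \<rho>"
    have conn: "connected_complex L" unfolding L_def using p False by (intro pm_connected) auto
    have inL: "x \<in> \<Union>L" if "H \<in> \<Delta>" "\<rho> \<subseteq> H" "x \<in> H - \<rho>" for x H
    proof -
      have "{x} \<in> L" using ins(1,2)[OF that] by (simp add: L_def link_def)
      then show ?thesis by blast
    qed
    have "(x0, y) \<in> {(a, b). {a, b} \<in> L}\<^sup>*"
      using conn inL[OF p(6,8) x0] inL[OF p(9,11) y] unfolding connected_complex_def by blast
    then have "\<exists>H\<in>Y. H \<in> \<Delta> \<and> card H = d \<and> insert y \<rho> \<subseteq> H"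
    proof induction
      case base
      show ?case using p x0 by (intro bexI[OF _ p(5)]) auto
    next
      case (step a b)
      then obtain H where H: "H \<in> Y" "H \<in> \<Delta>" "card H = d" "insert a \<rho> \<subseteq> H" by blast
      have "{a, b} \<in> L" using step.hyps(2) by simp
      then have ab: "a \<notin> \<rho>" "{a, b} \<union> \<rho> \<in> \<Delta>" by (auto simp: L_def link_def)
      \<comment> \<open>A facet containing both \<open>a\<close> and \<open>b\<close> passes the
        walk on from \<open>a\<close> to \<open>b\<close>.\<close>
      obtain H' where H': "H' \<in> \<Delta>" "{a, b} \<union> \<rho> \<subseteq> H'" "card H' = d" using pm_facet[OF ab(2)] by blast
      have "H' \<in> Y" by (rule IH[OF H ab(1) H'(1,3)]) (use H'(2) in auto)
      then show ?case using H' by (intro bexI[of _ H']) auto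
    qed
    then obtain H where H: "H \<in> Y" "H \<in> \<Delta>" "card H = d" "insert y \<rho> \<subseteq> H" by blast
    show ?thesis by (rule IH[OF H _ p(9,10)]) (use y p(11) in auto)
  qed
qed

text \<open>A ridge lies in two facets, so the parities vanish. A nonempty subcycle contains with
  one of these two facets also the other; it is closed under crossing ridges, and strong
  connectivity makes it everything.\<close>

lemma pm_link_minimal_cycle:
  assumes r: "\<rho> \<in> \<Delta>" "\<rho> \<noteq> {}" "card \<rho> + e = d" and e: "1 \<le> e"
  shows "minimal_cycle (\<Union>\<Delta>) e {\<sigma>\<in>link \<Delta> \<rho>. card \<sigma> = e}"
proof -
  define V where "V = \<Union>\<Delta>"
  define X where "X = {\<sigma>\<in>link \<Delta> \<rho>. card \<sigma> = e}"
  have finV: "finite V" unfolding V_def by (rule simplicial_complex_finite_Union[OF pm_complex])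
  have finr: "finite \<rho>" using pm_finite[OF r(1)] .
  have Xcard: "\<sigma> \<subseteq> V" "card \<sigma> = e" "\<sigma> \<inter> \<rho> = {}" "\<sigma> \<union> \<rho> \<in> \<Delta>" "finite \<sigma>" if "\<sigma> \<in> X" for \<sigma>
    using that pm_finite[of "\<sigma> \<union> \<rho>"] by (auto simp: X_def link_def V_def)
  have Xeq: "{x\<in>V - \<tau>. insert x \<tau> \<in> X} = {x. x \<notin> \<tau> \<union> \<rho> \<and> insert x (\<tau> \<union> \<rho>) \<in> \<Delta>}"
    and ridge: "\<tau> \<union> \<rho> \<in> \<Delta>" "card (\<tau> \<union> \<rho>) + 1 = d"
    if t: "z \<notin> \<tau>" "insert z \<tau> \<in> X" for \<tau> z
  proof -
    note zX = Xcard[OF t(2)]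
    have fint: "finite \<tau>" and tr: "\<tau> \<inter> \<rho> = {}" and ct: "card \<tau> + 1 = e" using zX t(1) by auto
    show td: "\<tau> \<union> \<rho> \<in> \<Delta>" by (rule pm_subset[OF zX(4)]) auto
    have "card (\<tau> \<union> \<rho>) = card \<tau> + card \<rho>" using fint finr tr by (rule card_Un_disjoint)
    then show "card (\<tau> \<union> \<rho>) + 1 = d" using ct r(3) by simp
    show "{x\<in>V - \<tau>. insert x \<tau> \<in> X} = {x. x \<notin> \<tau> \<union> \<rho> \<and> insert x (\<tau> \<union> \<rho>) \<in> \<Delta>}"
    proof (intro equalityI subsetI)
      fix x assume x: "x \<in> {x\<in>V - \<tau>. insert x \<tau> \<in> X}"
      then show "x \<in> {x. x \<notin> \<tau> \<union> \<rho> \<and> insert x (\<tau> \<union> \<rho>) \<in> \<Delta>}"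
        using Xcard(3,4)[of "insert x \<tau>"] by auto
    next
      fix x assume x: "x \<in> {x. x \<notin> \<tau> \<union> \<rho> \<and> insert x (\<tau> \<union> \<rho>) \<in> \<Delta>}"
      then have "x \<in> V" unfolding V_def by blast
      then show "x \<in> {x\<in>V - \<tau>. insert x \<tau> \<in> X}"
        using x tr ct fint by (auto simp: X_def link_def)
    qed
  qed
  have par: "parity V Z \<tau> = of_nat (card {x\<in>V - \<tau>. insert x \<tau> \<in> Z})" for Z \<tau>
  proof -
    have "parity V Z \<tau> = (\<Sum>x\<in>{x\<in>V - \<tau>. insert x \<tau> \<in> Z}. 1)"
      unfolding parity_def using finV by (intro sum.mono_neutral_cong_right) auto
    then show ?thesis by simp
  qed
  have "parity V X \<tau> = 0" for \<tau>
  proof (rule ccontr)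
    assume nz: "parity V X \<tau> \<noteq> 0"
    then obtain z where z: "z \<notin> \<tau>" "insert z \<tau> \<in> X" by (rule parity_nonzeroE)
    have "card {x\<in>V - \<tau>. insert x \<tau> \<in> X} = 2" unfolding Xeq[OF z] by (rule pm_ridge[OF ridge[OF z]])
    then show False using nz unfolding par by simp
  qed
  then have cyc: "mod2_cycle V e X" using Xcard(1,2) unfolding mod2_cycle_def by blast
  have neX: "X \<noteq> {}"
  proof -
    obtain F where F: "F \<in> \<Delta>" "\<rho> \<subseteq> F" "card F = d" using pm_facet[OF r(1)] by blast
    have "card (F - \<rho>) = e" using F r(3) finr by (simp add: card_Diff_subset)
    moreover have "F - \<rho> \<union> \<rho> = F" using F(2) by blast
    ultimately have "F - \<rho> \<in> X" using F(1) by (auto simp: X_def link_def)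
    then show ?thesis by blast
  qed
  have "Y = X" if Y: "Y \<subseteq> X" "mod2_cycle V e Y" "Y \<noteq> {}" for Y
  proof -
    define Y' where "Y' = (\<lambda>\<sigma>. \<sigma> \<union> \<rho>) ` Y"
    obtain \<sigma>0 where s0: "\<sigma>0 \<in> Y" using Y(3) by blast
    have cardU: "card (\<sigma> \<union> \<rho>) = d" if "\<sigma> \<in> X" for \<sigma>
      using Xcard[OF that] finr r(3) by (simp add: card_Un_disjoint)
    have "G \<in> Y'" if G: "G \<in> \<Delta>" "card G = d" "\<rho> \<subseteq> G" for G
    proof (rule pm_strongly_connected[OF r, of Y' "\<sigma>0 \<union> \<rho>" G])
      show "\<sigma>0 \<union> \<rho> \<in> Y'" using s0 by (simp add: Y'_def)
      show "\<sigma>0 \<union> \<rho> \<in> \<Delta>" "card (\<sigma>0 \<union> \<rho>) = d" using s0 Y(1) Xcard(4) cardU by blast+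
      show "\<rho> \<subseteq> \<sigma>0 \<union> \<rho>" by blast
      fix F G assume FG: "F \<in> Y'" "G \<in> \<Delta>" "card F = d" "card G = d" "\<rho> \<subseteq> F" "\<rho> \<subseteq> G" "card (F \<inter> G) + 1 = d"
      obtain \<sigma> where s: "\<sigma> \<in> Y" "F = \<sigma> \<union> \<rho>" using FG(1) unfolding Y'_def by blast
      have sX: "\<sigma> \<in> X" using s Y(1) by blast
      have finF: "finite F" "finite G" using pm_finite FG(2) s(2) Xcard(4)[OF sX] by auto
      have "card (F - F \<inter> G) = 1" "card (G - F \<inter> G) = 1"
        using FG finF by (simp_all add: card_Diff_subset_Int Int_absorb1 Int_commute)
      then obtain x y where x: "F - F \<inter> G = {x}" and y: "G - F \<inter> G = {y}"
        using card_1_singletonE by metis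
      define \<tau> where "\<tau> = F \<inter> G - \<rho>"
      have xr: "x \<notin> \<rho>" "y \<notin> \<rho>" using x y FG(5,6) by blast+
      have xt: "x \<notin> \<tau>" "y \<notin> \<tau>" "x \<noteq> y" using x y by (auto simp: \<tau>_def)
      have Feq: "F = insert x (\<tau> \<union> \<rho>)" using x FG(5,6) unfolding \<tau>_def by blast
      have Geq: "G = insert y (\<tau> \<union> \<rho>)" using y FG(5,6) unfolding \<tau>_def by blast
      have seq: "\<sigma> = insert x \<tau>"
      proof -
        have "\<sigma> = F - \<rho>" using s(2) Xcard(3)[OF sX] by blast
        also have "\<dots> = insert x \<tau>" unfolding Feq using xr by (auto simp: \<tau>_def)
        finally show ?thesis .
      qed
      have xX: "insert x \<tau> \<in> X" using sX seq by simp
      define W where "W = {x. x \<notin> \<tau> \<union> \<rho> \<and> insert x (\<tau> \<union> \<rho>) \<in> \<Delta>}"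
      have W2: "card W = 2" unfolding W_def by (rule pm_ridge[OF ridge[OF xt(1) xX]])
      have "F \<in> \<Delta>" using s(2) Xcard(4)[OF sX] by simp
      then have xyW: "x \<in> W" "y \<in> W" using Feq Geq FG(2) xr xt unfolding W_def by auto
      have Wxy: "W = {x, y}"
      proof (rule sym, rule card_subset_eq)
        show "finite W" by (rule card_ge_0_finite) (use W2 in simp)
        show "{x, y} \<subseteq> W" using xyW by blast
        show "card {x, y} = card W" using W2 xt(3) by simp
      qed
      define T where "T = {z\<in>V - \<tau>. insert z \<tau> \<in> Y}"
      have "T \<subseteq> {z\<in>V - \<tau>. insert z \<tau> \<in> X}" using Y(1) by (auto simp: T_def)
      then have TW: "T \<subseteq> {x, y}" using Xeq[OF xt(1) xX] Wxy unfolding W_def by simp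
      have "x \<in> V" using Xcard(1)[OF xX] by blast
      then have xT: "x \<in> T" using s(1) seq xt by (simp add: T_def)
      \<comment> \<open>The subcycle contains an even number of the two facets at this ridge, and
        one of them already.\<close>
      have "of_nat (card T) = (0 :: bit)"
        using Y(2) par[of Y \<tau>] unfolding mod2_cycle_def T_def by simp
      then have "T \<noteq> {x}" by auto
      then have "y \<in> T" using TW xT by blast
      then have "insert y \<tau> \<in> Y" by (simp add: T_def)
      moreover have "G = insert y \<tau> \<union> \<rho>" using Geq by simp
      ultimately show "G \<in> Y'" unfolding Y'_def by blast
    qed (use G in auto)
    then have all: "\<sigma> \<in> Y" if s: "\<sigma> \<in> X" for \<sigma>
    proof -
      have "\<sigma> \<union> \<rho> \<in> Y'" if "\<And>G. G \<in> \<Delta> \<Longrightarrow> card G = d \<Longrightarrow> \<rho> \<subseteq> G \<Longrightarrow> G \<in> Y'"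
        using that[of "\<sigma> \<union> \<rho>"] Xcard(4)[OF s] cardU[OF s] by blast
      then obtain \<sigma>' where s': "\<sigma>' \<in> Y" "\<sigma> \<union> \<rho> = \<sigma>' \<union> \<rho>"
        using \<open>\<And>G. G \<in> \<Delta> \<Longrightarrow> card G = d \<Longrightarrow> \<rho> \<subseteq> G \<Longrightarrow> G \<in> Y'\<close> unfolding Y'_def by blast
      have "\<sigma>' \<in> X" using s' Y(1) by blast
      then have "\<sigma>' = \<sigma>" using s'(2) Xcard(3)[OF s] Xcard(3)[of \<sigma>'] by blast
      then show ?thesis using s' by simp
    qed
    then show ?thesis using Y(1) by blast
  qed
  then have "minimal_cycle V e X" using cyc neX unfolding minimal_cycle_def by blast
  then show ?thesis unfolding V_def X_def .
qed

end

section \<open>Edge bounds\<close>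

definition face_edges :: "'v set set \<Rightarrow> 'v set set" where
  "face_edges X = {\<tau>. card \<tau> = 2 \<and> (\<exists>\<sigma>\<in>X. \<tau> \<subseteq> \<sigma>)}"

text \<open>One ordered pair for each edge, so that there are no more linear equations than
  edges.\<close>

lemma oriented_edges:
  assumes "finite E" "\<And>\<tau>. \<tau> \<in> E \<Longrightarrow> card \<tau> = 2"
  shows "\<exists>I. finite I \<and> card I \<le> card E \<and> (\<forall>x y. (x, y) \<in> I \<longrightarrow> {x, y} \<in> E \<and> x \<noteq> y) \<and>
    (\<forall>x y. {x, y} \<in> E \<longrightarrow> x \<noteq> y \<longrightarrow> (x, y) \<in> I \<or> (y, x) \<in> I)"
proof -
  have "\<forall>\<tau>\<in>E. \<exists>xy. \<tau> = {fst xy, snd xy} \<and> fst xy \<noteq> snd xy"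
  proof
    fix \<tau> assume "\<tau> \<in> E"
    then obtain x y where "\<tau> = {x, y}" "x \<noteq> y" using assms(2) card_2_iff by metis
    then show "\<exists>xy. \<tau> = {fst xy, snd xy} \<and> fst xy \<noteq> snd xy" by (intro exI[of _ "(x, y)"]) simp
  qed
  then obtain r where r: "\<And>\<tau>. \<tau> \<in> E \<Longrightarrow> \<tau> = {fst (r \<tau>), snd (r \<tau>)} \<and> fst (r \<tau>) \<noteq> snd (r \<tau>)"
    by metis
  show ?thesis
  proof (intro exI[of _ "r ` E"] conjI[of "finite (r ` E)"] conjI[of "card (r ` E) \<le> card E"]
      conjI[of "\<forall>x y. (x, y) \<in> r ` E \<longrightarrow> _ x y"] allI impI)
    show "finite (r ` E)" "card (r ` E) \<le> card E" using assms(1) by (auto intro: card_image_le)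
    show "{x, y} \<in> E \<and> x \<noteq> y" if xy: "(x, y) \<in> r ` E" for x y
    proof -
      obtain \<tau> where t: "\<tau> \<in> E" "r \<tau> = (x, y)" using xy by force
      then show ?thesis using r[OF t(1)] by simp
    qed
    show "(x, y) \<in> r ` E \<or> (y, x) \<in> r ` E" if e: "{x, y} \<in> E" "x \<noteq> y" for x y
    proof -
      obtain a b where ab: "r {x, y} = (a, b)" by force
      then have "{x, y} = {a, b}" "a \<noteq> b" using r[OF e(1)] by auto
      then have "(x, y) = (a, b) \<or> (y, x) = (a, b)" by (auto simp: doubleton_eq_iff)
      moreover have "(a, b) \<in> r ` E" using e(1) ab by (metis imageI)
      ultimately show ?thesis by auto
    qed
  qed
qed

text \<open>With n vertices, pinning \<sigma> leaves e (n - e) unknowns and one equation for each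
  edge not inside \<sigma>. The inequality is rearranged to avoid subtraction of natural numbers;
  the constant e e - (e choose 2) equals (e + 1 choose 2).\<close>

lemma rigid_edge_bound:
  fixes p :: "'v \<Rightarrow> nat \<Rightarrow> 'a::field"
  assumes fin: "finite (\<Union>X)" and rig: "rigid e p X"
    and s: "\<sigma> \<in> X" "card \<sigma> = e" "separating e p \<sigma>"
  shows "e * card (\<Union>X) + (e choose 2) \<le> card (face_edges X) + e * e"
proof -
  have fins: "finite \<sigma>" using fin s(1) by (meson Union_upper finite_subset)
  have finE: "finite (face_edges X)"
    by (rule finite_subset[of _ "Pow (\<Union>X)"]) (use fin in \<open>auto simp: face_edges_def\<close>)
  define E where "E = face_edges X - {\<tau>. \<tau> \<subseteq> \<sigma> \<and> card \<tau> = 2}"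
  have E2: "finite E" "\<And>\<tau>. \<tau> \<in> E \<Longrightarrow> card \<tau> = 2" using finE by (auto simp: E_def face_edges_def)
  obtain I where I: "finite I" "card I \<le> card E" "\<And>x y. (x, y) \<in> I \<Longrightarrow> {x, y} \<in> E \<and> x \<noteq> y"
    "\<And>x y. {x, y} \<in> E \<Longrightarrow> x \<noteq> y \<Longrightarrow> (x, y) \<in> I \<or> (y, x) \<in> I"
    using oriented_edges[OF E2] by blast
  have "pinned e p X \<sigma>" using rigid_imp_pinned[OF rig s(3)] s(1) by blast
  moreover have "pinned e p X \<sigma> \<longleftrightarrow> trivial_kernel I ((\<Union>X - \<sigma>) \<times> {..<e}) (rigidity_coeff p)"
  proof (rule pinned_iff_trivial_kernel[OF fin])
    show "I \<subseteq> {(x, y). \<exists>\<tau>\<in>X. x \<in> \<tau> \<and> y \<in> \<tau>}"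
    proof
      fix xy assume xy: "xy \<in> I"
      obtain x y where e: "xy = (x, y)" by force
      then have "{x, y} \<in> face_edges X" using I(3)[of x y] xy by (simp add: E_def)
      then show "xy \<in> {(x, y). \<exists>\<tau>\<in>X. x \<in> \<tau> \<and> y \<in> \<tau>}" unfolding e face_edges_def by auto
    qed
    show "x = y \<or> x \<in> \<sigma> \<and> y \<in> \<sigma> \<or> (x, y) \<in> I \<or> (y, x) \<in> I"
      if t: "\<tau> \<in> X" "x \<in> \<tau>" "y \<in> \<tau>" for \<tau> x y
    proof -
      have "{x, y} \<in> E" if "x \<noteq> y" "\<not> (x \<in> \<sigma> \<and> y \<in> \<sigma>)"
        using t that by (auto simp: E_def face_edges_def)
      then show ?thesis using I(4) by blast
    qed
  qed
  ultimately have "trivial_kernel I ((\<Union>X - \<sigma>) \<times> {..<e}) (rigidity_coeff p)" by (rule iffD1[rotated])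
  then have "card ((\<Union>X - \<sigma>) \<times> {..<e}) \<le> card I"
    by (rule trivial_kernel_card[OF _ I(1), rotated]) (use fin in simp)
  moreover have "card (\<Union>X - \<sigma>) = card (\<Union>X) - e"
    using s(1) unfolding s(2)[symmetric] by (intro card_Diff_subset fins) blast
  ultimately have "(card (\<Union>X) - e) * e \<le> card E"
    using I(2) by (simp add: card_cartesian_product)
  moreover have "card E = card (face_edges X) - (e choose 2)"
  proof -
    have sub: "{\<tau>. \<tau> \<subseteq> \<sigma> \<and> card \<tau> = 2} \<subseteq> face_edges X" using s(1) by (auto simp: face_edges_def)
    have "finite {\<tau>. \<tau> \<subseteq> \<sigma> \<and> card \<tau> = 2}" using finE sub by (rule finite_subset[rotated])
    then show ?thesis unfolding E_def using sub n_subsets[OF fins, of 2] s(2) by (simp add: card_Diff_subset)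
  qed
  moreover have "e choose 2 \<le> card (face_edges X)"
  proof -
    have "card {\<tau>. \<tau> \<subseteq> \<sigma> \<and> card \<tau> = 2} \<le> card (face_edges X)"
      using finE s(1) by (intro card_mono) (auto simp: face_edges_def)
    then show ?thesis using n_subsets[OF fins, of 2] s(2) by simp
  qed
  moreover obtain n where "card (\<Union>X) = e + n"
    using s(1,2) fin by (metis Union_upper card_mono le_Suc_ex)
  ultimately show ?thesis by (simp add: algebra_simps)
qed

definition link_facets :: "'v set set \<Rightarrow> 'v set \<Rightarrow> nat \<Rightarrow> 'v set set" where
  "link_facets \<Delta> \<rho> e = {\<sigma>\<in>link \<Delta> \<rho>. card \<sigma> = e}"

context
  fixes \<Delta> :: "'v set set" and d :: nat
  assumes pm: "normal_pseudomanifold d \<Delta>"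
begin

lemma pm_link_facet_above:
  assumes r: "\<rho> \<in> \<Delta>" "card \<rho> + e = d" and t: "\<tau> \<in> link \<Delta> \<rho>"
  obtains \<sigma> where "\<sigma> \<in> link_facets \<Delta> \<rho> e" "\<tau> \<subseteq> \<sigma>"
proof -
  have t': "\<tau> \<inter> \<rho> = {}" "\<tau> \<union> \<rho> \<in> \<Delta>" using t by (auto simp: link_def)
  obtain F where F: "F \<in> \<Delta>" "\<tau> \<union> \<rho> \<subseteq> F" "card F = d" using pm_facet[OF pm t'(2)] by blast
  have "finite \<rho>" using pm_finite[OF pm r(1)] .
  then have "card (F - \<rho>) = e" using F r(2) by (simp add: card_Diff_subset)
  moreover have "(F - \<rho>) \<union> \<rho> = F" using F(2) by blast
  ultimately have "F - \<rho> \<in> link_facets \<Delta> \<rho> e" using F(1) by (auto simp: link_facets_def link_def)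
  moreover have "\<tau> \<subseteq> F - \<rho>" using F(2) t'(1) by blast
  ultimately show thesis by (rule that)
qed

lemma pm_generic_rigid_link:
  assumes "\<rho> \<in> \<Delta>" "\<rho> \<noteq> {}" "card \<rho> + e = d" "3 \<le> e"
  shows "generic (\<lambda>p :: 'v \<Rightarrow> nat \<Rightarrow> complex. rigid e p (link_facets \<Delta> \<rho> e))"
  unfolding link_facets_def
  using assms
  by (intro minimal_cycle_generic_rigid[OF simplicial_complex_finite_Union[OF pm_complex[OF pm]]]
      pm_link_minimal_cycle[OF pm]) auto

lemma pm_link_edge_bound:
  assumes r: "\<rho> \<in> \<Delta>" "\<rho> \<noteq> {}" "card \<rho> + e = d" "3 \<le> e"
  shows "e * card {x. x \<notin> \<rho> \<and> insert x \<rho> \<in> \<Delta>} + (e choose 2) \<le>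
    card {\<tau>\<in>link \<Delta> \<rho>. card \<tau> = 2} + e * e"
proof -
  define X where "X = link_facets \<Delta> \<rho> e"
  have finV: "finite (\<Union>\<Delta>)" by (rule simplicial_complex_finite_Union[OF pm_complex[OF pm]])
  have sub: "\<tau> \<in> link \<Delta> \<rho>" if "\<sigma> \<in> X" "\<tau> \<subseteq> \<sigma>" for \<sigma> \<tau>
  proof -
    have "\<sigma> \<in> link \<Delta> \<rho>" using that(1) by (simp add: X_def link_facets_def)
    then show ?thesis
      using that(2) simplicial_complex_subset[OF simplicial_complex_link[OF pm_complex[OF pm] r(1)]] by blast
  qed
  have "{} \<in> link \<Delta> \<rho>" using r(1) by (simp add: link_def)
  then obtain \<sigma> where s: "\<sigma> \<in> X" unfolding X_def using pm_link_facet_above[OF r(1,3)] by blast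
  have scard: "card \<sigma> = e" using s by (simp add: X_def link_facets_def)
  have "finite \<sigma>"
  proof -
    have "\<sigma> \<union> \<rho> \<in> \<Delta>" using s by (simp add: X_def link_facets_def link_def)
    then show ?thesis using pm_finite[OF pm] by blast
  qed
  then have "generic (\<lambda>p :: 'v \<Rightarrow> nat \<Rightarrow> complex. rigid e p X \<and> separating e p \<sigma>)"
    unfolding X_def by (intro generic_conj pm_generic_rigid_link r generic_separating scard)
  then obtain p :: "'v \<Rightarrow> nat \<Rightarrow> complex" where p: "rigid e p X" "separating e p \<sigma>"
    using generic_ex by blast
  have UX: "\<Union>X = {x. x \<notin> \<rho> \<and> insert x \<rho> \<in> \<Delta>}"
  proof (intro equalityI subsetI)
    fix x assume "x \<in> \<Union>X"
    then obtain \<sigma> where "\<sigma> \<in> X" "x \<in> \<sigma>" by blast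
    then have "{x} \<in> link \<Delta> \<rho>" using sub[of \<sigma> "{x}"] by simp
    then show "x \<in> {x. x \<notin> \<rho> \<and> insert x \<rho> \<in> \<Delta>}" by (simp add: link_def)
  next
    fix x assume "x \<in> {x. x \<notin> \<rho> \<and> insert x \<rho> \<in> \<Delta>}"
    then have "{x} \<in> link \<Delta> \<rho>" by (simp add: link_def)
    then obtain \<sigma> where "\<sigma> \<in> X" "{x} \<subseteq> \<sigma>" unfolding X_def using pm_link_facet_above[OF r(1,3)] by blast
    then show "x \<in> \<Union>X" by blast
  qed
  have "face_edges X = {\<tau>\<in>link \<Delta> \<rho>. card \<tau> = 2}"
  proof (intro equalityI subsetI)
    fix \<tau> assume "\<tau> \<in> face_edges X"
    then show "\<tau> \<in> {\<tau>\<in>link \<Delta> \<rho>. card \<tau> = 2}" using sub by (auto simp: face_edges_def)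
  next
    fix \<tau> assume t: "\<tau> \<in> {\<tau>\<in>link \<Delta> \<rho>. card \<tau> = 2}"
    then obtain \<sigma> where "\<sigma> \<in> X" "\<tau> \<subseteq> \<sigma>" unfolding X_def using pm_link_facet_above[OF r(1,3)] by blast
    then show "\<tau> \<in> face_edges X" using t by (auto simp: face_edges_def)
  qed
  moreover have "finite (\<Union>X)" unfolding UX by (rule finite_subset[OF _ finV]) auto
  ultimately show ?thesis using rigid_edge_bound[OF _ p(1) s scard p(2)] UX by simp
qed

text \<open>
  Motions twisted by a rank one local system: over each star they are given by a symmetric
  matrix, and the matrices form a global section of the local system, so they vanish when the
  monodromy is nontrivial. Hence the edges impose \<open>d f\<^sub>0\<close> independent conditions.
\<close>

lemma pm_edge_bound_of_monodromy:
  assumes d: "4 \<le> d" and conn: "connected_complex \<Delta>"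
    and chi: "\<And>u v. {u, v} \<in> \<Delta> \<Longrightarrow> \<chi> u v \<noteq> (0 :: complex)"
      "\<And>u v w. {u, v, w} \<in> \<Delta> \<Longrightarrow> \<chi> u v * \<chi> v w = \<chi> u w"
      "\<not> (\<exists>s. \<forall>u v. {u, v} \<in> \<Delta> \<longrightarrow> s u \<noteq> 0 \<and> s u = \<chi> u v * s v)"
  shows "d * card (\<Union>\<Delta>) \<le> card {\<tau>\<in>\<Delta>. card \<tau> = 2}"
proof -
  define V where "V = \<Union>\<Delta>"
  note sc = pm_complex[OF pm]
  have finV: "finite V" unfolding V_def by (rule simplicial_complex_finite_Union[OF sc])
  have finD: "finite \<Delta>" using sc unfolding simplicial_complex_def by blast
  have vert: "{v} \<in> \<Delta>" if v: "v \<in> V" for v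
  proof -
    obtain \<sigma> where "\<sigma> \<in> \<Delta>" "v \<in> \<sigma>" using v unfolding V_def by blast
    then show ?thesis using pm_subset[OF pm, of \<sigma> "{v}"] by simp
  qed
  have chi1: "\<chi> v v = 1" if "v \<in> V" for v
  proof -
    have "{v, v, v} \<in> \<Delta>" "{v, v} \<in> \<Delta>" using vert[OF that] by auto
    then have "\<chi> v v * \<chi> v v = \<chi> v v" "\<chi> v v \<noteq> 0" using chi(1,2) by blast+
    then show ?thesis by simp
  qed
  \<comment> \<open>The facets containing \<open>v\<close>, written as a cone over the link, so that
    coning gives rigidity in dimension \<open>d\<close>.\<close>
  define star where "star v = insert v ` link_facets \<Delta> {v} (d - 1)" for v
  have starD: "F \<in> star v \<longleftrightarrow> F \<in> \<Delta> \<and> v \<in> F \<and> card F = d" for F v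
  proof
    assume "F \<in> star v"
    then obtain \<sigma> where s: "\<sigma> \<in> link \<Delta> {v}" "card \<sigma> = d - 1" "F = insert v \<sigma>"
      by (auto simp: star_def link_facets_def)
    then have f: "F \<in> \<Delta>" "v \<notin> \<sigma>" by (auto simp: link_def)
    then have "finite F" using pm_finite[OF pm] by blast
    then show "F \<in> \<Delta> \<and> v \<in> F \<and> card F = d" using s f d by auto
  next
    assume F: "F \<in> \<Delta> \<and> v \<in> F \<and> card F = d"
    then have "finite F" using pm_finite[OF pm] by blast
    then have "card (F - {v}) = d - 1" using F by simp
    moreover have "F = insert v (F - {v})" using F by blast
    ultimately show "F \<in> star v" using F unfolding star_def link_facets_def link_def
      by (intro image_eqI[of _ _ "F - {v}"]) auto
  qed
  have star_gen: "generic (\<lambda>p :: 'v \<Rightarrow> nat \<Rightarrow> complex. rigid d p (star v))" if v: "v \<in> V" for v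
  proof -
    have X: "generic (\<lambda>p :: 'v \<Rightarrow> nat \<Rightarrow> complex. rigid (d - 1) p (link_facets \<Delta> {v} (d - 1)))"
      using d vert[OF v] by (intro pm_generic_rigid_link) auto
    have "card {v} + (d - 1) = d" "{} \<in> link \<Delta> {v}" using d vert[OF v] by (auto simp: link_def)
    then obtain \<sigma> where s: "\<sigma> \<in> link_facets \<Delta> {v} (d - 1)"
      by (rule pm_link_facet_above[OF vert[OF v]])
    have sub: "\<Union>(link_facets \<Delta> {v} (d - 1)) \<subseteq> V - {v}"
      unfolding link_facets_def link_def V_def by auto
    have "generic (\<lambda>p :: 'v \<Rightarrow> nat \<Rightarrow> complex. rigid (Suc (d - 1)) p (star v))"
      unfolding star_def
    proof (rule generic_rigid_cone[OF _ s _ _ X])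
      show "finite (\<Union>(link_facets \<Delta> {v} (d - 1)))" using sub finV by (meson finite_Diff finite_subset)
      show "card \<sigma> = d - 1" using s by (simp add: link_facets_def)
      show "v \<notin> \<Union>(link_facets \<Delta> {v} (d - 1))" using sub by blast
    qed
    then show ?thesis using d by simp
  qed
  have "generic (\<lambda>p :: 'v \<Rightarrow> nat \<Rightarrow> complex. (\<forall>v\<in>V. rigid d p (star v)) \<and>
      (\<forall>\<sigma>\<in>{\<sigma>. \<sigma> \<subseteq> V \<and> card \<sigma> = d}. separating d p \<sigma>))"
    using finV star_gen
    by (intro generic_conj generic_ball generic_separating) (auto intro: finite_subset)
  then obtain p :: "'v \<Rightarrow> nat \<Rightarrow> complex" where p: "\<And>v. v \<in> V \<Longrightarrow> rigid d p (star v)"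
    "\<And>\<sigma>. \<sigma> \<subseteq> V \<Longrightarrow> card \<sigma> = d \<Longrightarrow> separating d p \<sigma>"
    using generic_ex by blast
  define E where "E = {\<tau>\<in>\<Delta>. card \<tau> = 2}"
  have E2: "finite E" "\<And>\<tau>. \<tau> \<in> E \<Longrightarrow> card \<tau> = 2" using finD by (auto simp: E_def)
  obtain I where I: "finite I" "card I \<le> card E" "\<And>x y. (x, y) \<in> I \<Longrightarrow> {x, y} \<in> E \<and> x \<noteq> y"
    "\<And>x y. {x, y} \<in> E \<Longrightarrow> x \<noteq> y \<Longrightarrow> (x, y) \<in> I \<or> (y, x) \<in> I"
    using oriented_edges[OF E2] by blast
  \<comment> \<open>The row of the twisted equation
    \<open>\<chi> x y * dot d (p x) (m y) = dot d (p y) (m x)\<close>. Nothing is pinned: every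
    vertex keeps its \<open>d\<close> columns.\<close>
  define A where "A xy zi = (if fst zi = snd xy then \<chi> (fst xy) (snd xy) * p (fst xy) (snd zi) else 0) -
    (if fst zi = fst xy then p (snd xy) (snd zi) else 0)" for xy :: "'v \<times> 'v" and zi :: "'v \<times> nat"
  have "trivial_kernel I (V \<times> {..<d}) A"
    unfolding trivial_kernel_def
  proof (intro allI impI)
    fix \<mu> assume mu: "\<forall>xy\<in>I. (\<Sum>zi\<in>V \<times> {..<d}. A xy zi * \<mu> zi) = 0"
    define m where "m x i = \<mu> (x, i)" for x i
    have eqI: "\<chi> x y * dot d (p x) (m y) = dot d (p y) (m x)" if xy: "(x, y) \<in> I" for x y
    proof -
      have xyV: "x \<in> V" "y \<in> V" using I(3)[OF xy] by (auto simp: E_def V_def)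
      have "(\<Sum>zi\<in>V \<times> {..<d}. A (x, y) zi * \<mu> zi) =
        (\<Sum>z\<in>V. \<Sum>i<d. ((if z = y then \<chi> x y * p x i else 0) - (if z = x then p y i else 0)) * m z i)"
        by (simp add: sum.cartesian_product A_def m_def case_prod_beta cong: if_cong)
      also have "\<dots> = (\<Sum>z\<in>V. \<Sum>i<d. (if z = y then \<chi> x y * p x i else 0) * m z i) -
         (\<Sum>z\<in>V. \<Sum>i<d. (if z = x then p y i else 0) * m z i)"
        by (simp add: left_diff_distrib sum_subtractf)
      also have "\<dots> = dot d (\<lambda>i. \<chi> x y * p x i) (m y) - dot d (p y) (m x)"
        by (simp only: sum_unit_row[of V x d m "p y", OF finV disjI1[OF xyV(1)]]
            sum_unit_row[of V y d m "\<lambda>i. \<chi> x y * p x i", OF finV disjI1[OF xyV(2)]])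
      also have "dot d (\<lambda>i. \<chi> x y * p x i) (m y) = \<chi> x y * dot d (p x) (m y)"
        unfolding dot_def sum_distrib_left mult.assoc ..
      finally show ?thesis using mu xy by simp
    qed
    have eq: "\<chi> x y * dot d (p x) (m y) = dot d (p y) (m x)" if e: "{x, y} \<in> \<Delta>" for x y
    proof (cases "x = y")
      case True
      have "x \<in> V" using e by (auto simp: V_def)
      then show ?thesis using True chi1 by simp
    next
      case False
      then have "{x, y} \<in> E" using e by (simp add: E_def)
      then consider "(x, y) \<in> I" | "(y, x) \<in> I" using I(4) False by blast
      then show ?thesis
      proof cases
        case 1
        then show ?thesis by (rule eqI)
      next
        case 2
        \<comment> \<open>Both orientations of an edge give the same equation, because
          \<open>\<chi> x y * \<chi> y x = 1\<close>.\<close>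
        have "{x, y, x} \<in> \<Delta>" using e by (simp add: insert_commute)
        then have "\<chi> x y * \<chi> y x = \<chi> x x" by (rule chi(2))
        also have "\<dots> = 1" using e by (intro chi1) (auto simp: V_def)
        finally have c: "\<chi> x y * \<chi> y x = 1" .
        have "\<chi> x y * dot d (p x) (m y) = (\<chi> x y * \<chi> y x) * dot d (p y) (m x)"
          unfolding eqI[OF 2, symmetric] by (simp only: mult.assoc)
        then show ?thesis by (simp add: c)
      qed
    qed
    \<comment> \<open>The motion transported to the fibre at \<open>v\<close>. On the star of
      \<open>v\<close> the cocycle relation turns it into an ordinary motion.\<close>
    define n where "n v u i = \<chi> v u * m u i" for v u i
    have dotn: "dot d x (n v u) = \<chi> v u * dot d x (m u)" for x v u
      unfolding dot_def n_def sum_distrib_left by (rule sum.cong[OF refl]) (rule mult.left_commute)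
    have "motion d p (star v) (n v)" if v: "v \<in> V" for v
      unfolding motion_def
    proof (intro ballI)
      fix F u w assume F: "F \<in> star v" "u \<in> F" "w \<in> F"
      then have FD: "F \<in> \<Delta>" "v \<in> F" using starD by auto
      have t: "{v, u, w} \<in> \<Delta>" "{u, w} \<in> \<Delta>" using F FD by (auto intro: pm_subset[OF pm FD(1)])
      have "dot d (p u) (n v w) = \<chi> v u * (\<chi> u w * dot d (p u) (m w))"
        unfolding dotn chi(2)[OF t(1), symmetric] by (rule mult.assoc)
      also have "\<dots> = dot d (p w) (n v u)" unfolding eq[OF t(2)] dotn ..
      finally show "dot d (p u) (n v w) = dot d (p w) (n v u)" .
    qed
    then have "\<exists>S. agrees d p (n v) S (\<Union>(star v))" if "v \<in> V" for v
      using p(1)[OF that] that unfolding rigid_def by blast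
    then obtain S where S: "\<And>v. v \<in> V \<Longrightarrow> agrees d p (n v) (S v) (\<Union>(star v))" by metis
    \<comment> \<open>On a facet containing the edge both matrices describe the same motion up to
      the transport factor, and the facet is placed on a basis.\<close>
    have glue: "S v i j = \<chi> v w * S w i j" if e: "{v, w} \<in> \<Delta>" and ij: "i < d" "j < d" for v w i j
    proof -
      obtain F where F: "F \<in> \<Delta>" "{v, w} \<subseteq> F" "card F = d" using pm_facet[OF pm e] by blast
      have vw: "v \<in> V" "w \<in> V" using e by (auto simp: V_def)
      have Fs: "F \<in> star v" "F \<in> star w" using F starD by auto
      have 1: "agrees d p (n v) (S v) F" using S[OF vw(1)] Fs(1) by (auto intro: agrees_mono)
      have 2: "agrees d p (n w) (S w) F" using S[OF vw(2)] Fs(2) by (auto intro: agrees_mono)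
      have "agrees d p (n v) (\<lambda>i j. \<chi> v w * S w i j) F"
        unfolding agrees_def
      proof (intro ballI allI impI)
        fix u i assume u: "u \<in> F" "i < d"
        have t: "{v, w, u} \<in> \<Delta>" using F u by (auto intro: pm_subset[OF pm F(1)])
        have "n v u i = \<chi> v w * n w u i" unfolding n_def chi(2)[OF t, symmetric] by (rule mult.assoc)
        also have "n w u i = dot d (S w i) (p u)" using 2 u unfolding agrees_def by blast
        also have "\<chi> v w * \<dots> = dot d (\<lambda>j. \<chi> v w * S w i j) (p u)"
          unfolding dot_def sum_distrib_left mult.assoc ..
        finally show "n v u i = dot d (\<lambda>j. \<chi> v w * S w i j) (p u)" .
      qed
      from agrees_unique[OF 1 this _ ij] p(2) F show ?thesis unfolding V_def by blast
    qed
    \<comment> \<open>A nonzero entry would propagate along edges, and as a function of the vertex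
      it would be a nowhere vanishing section.\<close>
    have S0: "S v i j = 0" if v: "v \<in> V" and ij: "i < d" "j < d" for v i j
    proof (rule ccontr)
      assume nz: "S v i j \<noteq> 0"
      have "S u i j \<noteq> 0" if u: "u \<in> V" for u
      proof -
        have "(v, u) \<in> {(a, b). {a, b} \<in> \<Delta>}\<^sup>*"
          using conn v u unfolding connected_complex_def V_def by blast
        then show ?thesis
        proof induction
          case (step a b)
          then have "S a i j = \<chi> a b * S b i j" using glue[OF _ ij] by simp
          then show ?case using step.IH by auto
        qed (rule nz)
      qed
      moreover have "u \<in> V" if "{u, w} \<in> \<Delta>" for u w using that by (auto simp: V_def)
      ultimately have "\<forall>u w. {u, w} \<in> \<Delta> \<longrightarrow> S u i j \<noteq> 0 \<and> S u i j = \<chi> u w * S w i j"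
        using glue[OF _ ij] by blast
      then have "\<exists>s. \<forall>u w. {u, w} \<in> \<Delta> \<longrightarrow> s u \<noteq> 0 \<and> s u = \<chi> u w * s w"
        by (rule exI[of _ "\<lambda>u. S u i j"])
      then show False using chi(3) by contradiction
    qed
    show "\<forall>zi\<in>V \<times> {..<d}. \<mu> zi = 0"
    proof
      fix zi assume "zi \<in> V \<times> {..<d}"
      then obtain v i where zi: "zi = (v, i)" "v \<in> V" "i < d" by auto
      obtain F where "F \<in> \<Delta>" "{v} \<subseteq> F" "card F = d" using pm_facet[OF pm vert[OF zi(2)]] by blast
      then have "v \<in> \<Union>(star v)" using starD by blast
      then have "n v v i = dot d (S v i) (p v)" using S[OF zi(2)] zi(3) unfolding agrees_def by blast
      also have "\<dots> = 0" using S0[OF zi(2,3)] by (simp add: dot_def)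
      finally show "\<mu> zi = 0" using chi1[OF zi(2)] by (simp add: n_def m_def zi(1))
    qed
  qed
  then have "card (V \<times> {..<d}) \<le> card I"
    by (rule trivial_kernel_card[OF _ I(1), rotated]) (use finV in simp)
  then show ?thesis using I(2) by (simp add: V_def E_def card_cartesian_product mult.commute)
qed

end

section \<open>Face numbers\<close>

definition link_vertices :: "'v set set \<Rightarrow> 'v set \<Rightarrow> 'v set" where
  "link_vertices \<Delta> \<rho> = {x. x \<notin> \<rho> \<and> insert x \<rho> \<in> \<Delta>}"

definition link_faces :: "'v set set \<Rightarrow> 'v set \<Rightarrow> nat \<Rightarrow> 'v set set" where
  "link_faces \<Delta> \<rho> j = {\<tau>\<in>link \<Delta> \<rho>. card \<tau> = j}"

text \<open>Affine bounds can be summed over links when only the sum of their numbers of vertices is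
  known, and \<open>0 \<le> a\<close> keeps the inequality when that sum is bounded below.\<close>

lemma stacked_phi_affine:
  assumes "1 \<le> j" "j < e"
  obtains a b where "0 \<le> a" "\<And>N. stacked_phi j N e = a * int N - b"
proof (cases "j + 2 \<le> e")
  case True
  then show thesis
    using assms by (intro that[of "int (e choose j)" "int ((e + 1) choose (j + 1)) * int j"])
      (auto simp: stacked_phi_def)
next
  case False
  then show thesis
    using assms by (intro that[of "int e - 1" "(int e + 1) * (int e - 2)"])
      (auto simp: stacked_phi_def)
qed

lemma int_choose_two: "2 * int (n choose 2) = int n * (int n - 1)"
proof (induction n)
  case (Suc n)
  have "Suc n choose 2 = n + (n choose 2)" by (simp add: numeral_2_eq_2)
  then have "2 * int (Suc n choose 2) = 2 * int n + 2 * int (n choose 2)" by simp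
  then show ?case unfolding Suc.IH by (simp add: algebra_simps)
qed simp

text \<open>
  The right-hand side is the sum of \<open>a N\<^sub>x - b\<close> over the \<open>N\<close> vertex links of a stacked sphere,
  whose degrees \<open>N\<^sub>x\<close> add up to \<open>2 e N - e (e + 1)\<close>.
\<close>

lemma stacked_phi_recursion:
  assumes i: "2 \<le> i" "i < e" and ab: "\<And>N. stacked_phi (i - 1) N (e - 1) = a * int N - b"
  shows "(int i + 1) * stacked_phi i N e = a * (2 * int e * int N - int e * (int e + 1)) - b * int N"
proof -
  obtain k where "i = 2 + k" using le_Suc_ex[OF i(1)] ..
  then have k: "i = Suc (Suc k)" by simp
  obtain n where n: "e = Suc n" using i(2) by (cases e) auto
  \<comment> \<open>The values for 0 and 1 vertices determine the two affine coefficients.\<close>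
  have sp: "stacked_phi (i - 1) 0 (e - 1) = - b" "stacked_phi (i - 1) 1 (e - 1) = a - b"
    using ab[of 0] ab[of 1] by auto
  show ?thesis
  proof (cases "i + 2 \<le> e")
    case True
    have a: "a = int (n choose Suc k)" and b: "b = int (Suc n choose Suc (Suc k)) * int (Suc k)"
      using sp True unfolding k n by (auto simp: stacked_phi_def)
    \<comment> \<open>Two absorption identities reduce the other binomial coefficients to
      \<open>B\<close>.\<close>
    have 1: "int (Suc n) * a = int (Suc (Suc k)) * int (Suc n choose Suc (Suc k))"
      unfolding a using arg_cong[OF Suc_times_binomial_eq[of n "Suc k"], of int]
      unfolding of_nat_mult by (simp only: mult.commute)
    have 2: "int (Suc (Suc (Suc k))) * int (Suc (Suc n) choose Suc (Suc (Suc k))) =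
        int (Suc (Suc n)) * int (Suc n choose Suc (Suc k))"
      using arg_cong[OF Suc_times_binomial_eq[of "Suc n" "Suc (Suc k)"], of int]
      unfolding of_nat_mult by (simp only: mult.commute)
    define B where "B = int (Suc n choose Suc (Suc k))"
    define C where "C = int (Suc (Suc n) choose Suc (Suc (Suc k)))"
    have phi: "stacked_phi i N e = B * int N - C * (int k + 2)"
      using True unfolding k n by (simp add: stacked_phi_def B_def C_def)
    have b': "b = B * (int k + 1)" unfolding b B_def by simp
    have h1: "(int n + 1) * a = (int k + 2) * B" using 1 unfolding B_def
      by (simp del: binomial_Suc_Suc add: add.commute)
    have h2: "(int k + 3) * C = (int n + 2) * B" using 2 unfolding B_def C_def
      by (simp del: binomial_Suc_Suc add: add.commute)
    have "(int i + 1) * stacked_phi i N e = (int k + 3) * B * int N - (int k + 2) * ((int k + 3) * C)"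
      unfolding phi unfolding k by (simp add: algebra_simps)
    also have "\<dots> = (int k + 3) * B * int N - (int n + 2) * ((int k + 2) * B)"
      unfolding h2 by (simp add: algebra_simps)
    also have "\<dots> = 2 * ((int k + 2) * B) * int N - (int n + 2) * ((int k + 2) * B) - b * int N"
      unfolding b' by (simp add: algebra_simps)
    also have "\<dots> = a * (2 * int e * int N - int e * (int e + 1)) - b * int N"
      unfolding h1[symmetric] n by (simp add: algebra_simps)
    finally show ?thesis .
  next
    case False
    \<comment> \<open>The case of facets, i + 1 = e, where \<open>stacked_phi\<close> switches to
      its separate formula.\<close>
    then have n': "n = Suc (Suc k)" using i unfolding k n by simp
    have b: "b = (int k + 3) * int k" and a: "a = int k + 1"
      using sp unfolding k n n' by (auto simp: stacked_phi_def algebra_simps)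
    have phi: "stacked_phi i N e = (int k + 2) * int N - (int k + 4) * (int k + 1)"
      unfolding k n n' by (simp add: stacked_phi_def algebra_simps)
    show ?thesis unfolding phi a b unfolding k n n' by (simp add: algebra_simps)
  qed
qed

text \<open>The sign matters when the number of vertices in front of this factor is replaced by its
  lower bound 2 d + 1.\<close>

lemma stacked_phi_kuehnel_nonneg:
  assumes "j + 2 \<le> d"
  shows "0 \<le> stacked_phi j (2 * d) (d - 1)"
proof (cases "j = 0")
  case False
  obtain n where n: "d = Suc n" using assms by (cases d) auto
  show ?thesis
  proof (cases "j + 2 \<le> n")
    case True
    have "int (Suc j) * int (Suc n choose Suc j) = int (Suc n) * int (n choose j)"
      using arg_cong[OF Suc_times_binomial_eq[of n j], of int]
      unfolding of_nat_mult by (simp only: mult.commute)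
    then have e: "(int j + 1) * int (Suc n choose Suc j) = (int n + 1) * int (n choose j)"
      by (simp del: binomial_Suc_Suc add: add.commute)
    have "int (Suc n choose Suc j) * int j \<le> (int j + 1) * int (Suc n choose Suc j)"
      by (simp add: algebra_simps)
    also have "\<dots> \<le> int (n choose j) * int (2 * Suc n)" unfolding e by (simp add: algebra_simps)
    finally show ?thesis using False True n by (simp add: stacked_phi_def)
  next
    case False
    then have "n = Suc j" using assms n by simp
    then show ?thesis using \<open>j \<noteq> 0\<close> n by (simp add: stacked_phi_def algebra_simps)
  qed
qed (simp add: stacked_phi_def)

section \<open>Summation of face bounds over links\<close>

context
  fixes \<Delta> :: "'v set set" and d :: nat
  assumes pm: "normal_pseudomanifold d \<Delta>"
begin

lemma pm_finite_link_vertices: "finite (link_vertices \<Delta> \<rho>)"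
  by (rule finite_subset[OF _ simplicial_complex_finite_Union[OF pm_complex[OF pm]]])
    (auto simp: link_vertices_def)

text \<open>Double counting of pairs of a vertex and a face through it. Removing the vertex
  identifies the faces through \<open>x\<close> with faces of the link of
  \<open>insert x \<rho>\<close>.\<close>

lemma pm_sum_link_faces:
  assumes r: "\<rho> \<in> \<Delta>"
  shows "(\<Sum>x\<in>link_vertices \<Delta> \<rho>. card (link_faces \<Delta> (insert x \<rho>) j)) =
    (j + 1) * card (link_faces \<Delta> \<rho> (j + 1))"
proof -
  have scl: "simplicial_complex (link \<Delta> \<rho>)" by (rule simplicial_complex_link[OF pm_complex[OF pm] r])
  then have "finite (link \<Delta> \<rho>)" unfolding simplicial_complex_def by blast
  then have fin: "finite (link_faces \<Delta> \<rho> (j + 1))" by (simp add: link_faces_def)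
  have finf: "finite \<tau>" if "\<tau> \<in> link \<Delta> \<rho>" for \<tau> using simplicial_complex_finite_face[OF scl that] .
  have tv: "\<tau> \<subseteq> link_vertices \<Delta> \<rho>" if "\<tau> \<in> link \<Delta> \<rho>" for \<tau>
  proof
    fix x assume "x \<in> \<tau>"
    then have "{x} \<in> link \<Delta> \<rho>" using simplicial_complex_subset[OF scl that, of "{x}"] by simp
    then show "x \<in> link_vertices \<Delta> \<rho>" by (simp add: link_def link_vertices_def)
  qed
  have "card (link_faces \<Delta> (insert x \<rho>) j) = card {\<tau>\<in>link_faces \<Delta> \<rho> (j + 1). x \<in> \<tau>}"
    if x: "x \<in> link_vertices \<Delta> \<rho>" for x
  proof (rule bij_betw_same_card[of "insert x"], rule bij_betwI')
    have xr: "x \<notin> \<rho>" using x by (simp add: link_vertices_def)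
    have mem: "\<tau> \<in> link_faces \<Delta> (insert x \<rho>) j \<longleftrightarrow>
        x \<notin> \<tau> \<and> \<tau> \<inter> \<rho> = {} \<and> insert x (\<tau> \<union> \<rho>) \<in> \<Delta> \<and> card \<tau> = j" for \<tau>
      by (auto simp: link_faces_def link_def)
    have mem': "\<tau> \<in> {\<tau>\<in>link_faces \<Delta> \<rho> (j + 1). x \<in> \<tau>} \<longleftrightarrow>
        x \<in> \<tau> \<and> \<tau> \<inter> \<rho> = {} \<and> \<tau> \<union> \<rho> \<in> \<Delta> \<and> card \<tau> = j + 1" for \<tau>
      by (auto simp: link_faces_def link_def)
    show "(insert x \<sigma> = insert x \<tau>) = (\<sigma> = \<tau>)"
      if "\<sigma> \<in> link_faces \<Delta> (insert x \<rho>) j" "\<tau> \<in> link_faces \<Delta> (insert x \<rho>) j" for \<sigma> \<tau>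
      using that unfolding mem by (simp add: insert_ident)
    show "insert x \<sigma> \<in> {\<tau>\<in>link_faces \<Delta> \<rho> (j + 1). x \<in> \<tau>}"
      if s: "\<sigma> \<in> link_faces \<Delta> (insert x \<rho>) j" for \<sigma>
    proof -
      have s': "x \<notin> \<sigma>" "\<sigma> \<inter> \<rho> = {}" "insert x (\<sigma> \<union> \<rho>) \<in> \<Delta>" "card \<sigma> = j" using s unfolding mem by auto
      have "finite \<sigma>" using pm_finite[OF pm s'(3)] by simp
      then show ?thesis using s' xr unfolding mem' by simp
    qed
    show "\<exists>\<sigma>\<in>link_faces \<Delta> (insert x \<rho>) j. \<tau> = insert x \<sigma>"
      if t: "\<tau> \<in> {\<tau>\<in>link_faces \<Delta> \<rho> (j + 1). x \<in> \<tau>}" for \<tau>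
    proof
      have t': "x \<in> \<tau>" "\<tau> \<inter> \<rho> = {}" "\<tau> \<union> \<rho> \<in> \<Delta>" "card \<tau> = j + 1" using t unfolding mem' by auto
      show "\<tau> = insert x (\<tau> - {x})" using t'(1) by blast
      have "finite \<tau>" using pm_finite[OF pm t'(3)] by blast
      then have "card (\<tau> - {x}) = j" using t' by simp
      moreover have "insert x (\<tau> - {x} \<union> \<rho>) = \<tau> \<union> \<rho>" using t'(1) by blast
      ultimately show "\<tau> - {x} \<in> link_faces \<Delta> (insert x \<rho>) j" unfolding mem using t' by auto
    qed
  qed
  then have "(\<Sum>x\<in>link_vertices \<Delta> \<rho>. card (link_faces \<Delta> (insert x \<rho>) j)) =
      (\<Sum>x\<in>link_vertices \<Delta> \<rho>. card {\<tau>\<in>link_faces \<Delta> \<rho> (j + 1). x \<in> \<tau>})"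
    by (intro sum.cong) auto
  also have "\<dots> = (\<Sum>\<tau>\<in>link_faces \<Delta> \<rho> (j + 1). j + 1)"
  proof (rule sum_multicount_gen[OF pm_finite_link_vertices fin])
    show "\<forall>\<tau>\<in>link_faces \<Delta> \<rho> (j + 1). card {x\<in>link_vertices \<Delta> \<rho>. x \<in> \<tau>} = j + 1"
    proof
      fix \<tau> assume t: "\<tau> \<in> link_faces \<Delta> \<rho> (j + 1)"
      then have "{x\<in>link_vertices \<Delta> \<rho>. x \<in> \<tau>} = \<tau>" using tv by (auto simp: link_faces_def)
      then show "card {x\<in>link_vertices \<Delta> \<rho>. x \<in> \<tau>} = j + 1" using t by (simp add: link_faces_def)
    qed
  qed
  finally show ?thesis by simp
qed

lemma pm_card_link_faces_1:
  assumes "\<rho> \<in> \<Delta>"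
  shows "card (link_faces \<Delta> \<rho> 1) = card (link_vertices \<Delta> \<rho>)"
proof -
  have "link_faces \<Delta> \<rho> 1 = (\<lambda>x. {x}) ` link_vertices \<Delta> \<rho>"
  proof (intro equalityI subsetI)
    fix \<tau> assume "\<tau> \<in> link_faces \<Delta> \<rho> 1"
    then obtain x where "\<tau> = {x}" "{x} \<in> link \<Delta> \<rho>"
      unfolding link_faces_def by (metis (mono_tags, lifting) card_1_singletonE mem_Collect_eq)
    then show "\<tau> \<in> (\<lambda>x. {x}) ` link_vertices \<Delta> \<rho>" by (simp add: link_def link_vertices_def)
  qed (auto simp: link_faces_def link_def link_vertices_def)
  then show ?thesis by (simp add: card_image)
qed

lemma pm_insert_vertex:
  assumes "\<rho> \<in> \<Delta>" "x \<in> link_vertices \<Delta> \<rho>"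
  shows "insert x \<rho> \<in> \<Delta>" "card (insert x \<rho>) = card \<rho> + 1"
  using assms pm_finite[OF pm assms(1)] by (auto simp: link_vertices_def)

text \<open>The degrees add up to twice the number of edges, so an affine bound in the degree can be summed.\<close>

lemma pm_link_faces_sum_bound:
  assumes r: "\<rho> \<in> \<Delta>" and i: "1 \<le> i"
    and lb: "\<And>x. x \<in> link_vertices \<Delta> \<rho> \<Longrightarrow>
      a * int (card (link_vertices \<Delta> (insert x \<rho>))) - b \<le> int (card (link_faces \<Delta> (insert x \<rho>) i))"
  shows "a * (2 * int (card (link_faces \<Delta> \<rho> 2))) - b * int (card (link_vertices \<Delta> \<rho>)) \<le>
    (int i + 1) * int (card (link_faces \<Delta> \<rho> (i + 1)))"
proof -
  let ?W = "link_vertices \<Delta> \<rho>"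
  have "(\<Sum>x\<in>?W. card (link_vertices \<Delta> (insert x \<rho>))) = (\<Sum>x\<in>?W. card (link_faces \<Delta> (insert x \<rho>) 1))"
    by (intro sum.cong refl pm_card_link_faces_1[symmetric] pm_insert_vertex(1)[OF r])
  also have "\<dots> = 2 * card (link_faces \<Delta> \<rho> 2)"
    using pm_sum_link_faces[OF r, of 1] by (simp add: numeral_2_eq_2)
  finally have "2 * int (card (link_faces \<Delta> \<rho> 2)) =
      (\<Sum>x\<in>?W. int (card (link_vertices \<Delta> (insert x \<rho>))))"
    by (simp flip: of_nat_sum)
  then have "a * (2 * int (card (link_faces \<Delta> \<rho> 2))) - b * int (card ?W) =
      (\<Sum>x\<in>?W. a * int (card (link_vertices \<Delta> (insert x \<rho>))) - b)"
    by (simp add: sum_subtractf sum_distrib_left mult.commute)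
  also have "\<dots> \<le> (\<Sum>x\<in>?W. int (card (link_faces \<Delta> (insert x \<rho>) i)))"
    by (rule sum_mono) (rule lb)
  also have "\<dots> = int ((i + 1) * card (link_faces \<Delta> \<rho> (i + 1)))"
    using pm_sum_link_faces[OF r, of i] by (simp flip: of_nat_sum)
  finally show ?thesis by (simp add: algebra_simps)
qed

lemma pm_link_edges_ge:
  assumes "\<rho> \<in> \<Delta>" "\<rho> \<noteq> {}" "card \<rho> + e = d" "3 \<le> e"
  shows "2 * int e * int (card (link_vertices \<Delta> \<rho>)) - int e * (int e + 1) \<le>
    2 * int (card (link_faces \<Delta> \<rho> 2))"
proof -
  define N where "N = card (link_vertices \<Delta> \<rho>)"
  define M where "M = card (link_faces \<Delta> \<rho> 2)"
  have "e * N + (e choose 2) \<le> M + e * e"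
    using pm_link_edge_bound[OF pm assms] unfolding N_def M_def link_vertices_def link_faces_def .
  then have "int (e * N + (e choose 2)) \<le> int (M + e * e)" by (simp only: of_nat_le_iff)
  then have "int e * int N + int (e choose 2) \<le> int M + int e * int e" by simp
  then have "2 * (int e * int N) + 2 * int (e choose 2) \<le> 2 * int M + 2 * (int e * int e)" by simp
  then have "2 * int e * int N - int e * (int e + 1) \<le> 2 * int M"
    unfolding int_choose_two by (simp add: algebra_simps)
  then show ?thesis unfolding N_def M_def .
qed

text \<open>For edges this is the rigidity bound, or the equality of edges and vertices when links
  are 1-dimensional. For higher faces the bounds for links of one more vertex are summed, the edge
  bound controls the degree sum, and \<open>stacked_phi_recursion\<close> evaluates the
  result.\<close>

lemma pm_link_faces_ge:
  assumes "\<rho> \<in> \<Delta>" "\<rho> \<noteq> {}" "card \<rho> + e = d" "2 \<le> e" "i < e"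
  shows "stacked_phi i (card (link_vertices \<Delta> \<rho>)) e \<le> int (card (link_faces \<Delta> \<rho> (i + 1)))"
  using assms
proof (induction e arbitrary: \<rho> i rule: less_induct)
  case (less e)
  note p = less.prems
  define N where "N = card (link_vertices \<Delta> \<rho>)"
  define M where "M = card (link_faces \<Delta> \<rho> 2)"
  consider "i = 0" | "i = 1" "e = 2" | "i = 1" "3 \<le> e" | "2 \<le> i" "3 \<le> e" using p by linarith
  then show ?case
  proof cases
    case 1
    then show ?thesis using pm_card_link_faces_1[OF p(1)] by (simp add: stacked_phi_def)
  next
    case 2
    \<comment> \<open>Every vertex of a 1-dimensional link lies in two of its edges.\<close>
    have "2 * M = (\<Sum>x\<in>link_vertices \<Delta> \<rho>. card (link_faces \<Delta> (insert x \<rho>) 1))"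
      using pm_sum_link_faces[OF p(1), of 1] by (simp add: M_def numeral_2_eq_2)
    also have "\<dots> = (\<Sum>x\<in>link_vertices \<Delta> \<rho>. 2)"
    proof (rule sum.cong[OF refl])
      fix x assume x: "x \<in> link_vertices \<Delta> \<rho>"
      note ix = pm_insert_vertex[OF p(1) x]
      have "card (insert x \<rho>) + 1 = d" using ix(2) p(3) 2 by simp
      then show "card (link_faces \<Delta> (insert x \<rho>) 1) = 2"
        unfolding pm_card_link_faces_1[OF ix(1)] link_vertices_def by (rule pm_ridge[OF pm ix(1)])
    qed
    finally have "M = N" by (simp add: N_def)
    then show ?thesis using 2 by (simp add: stacked_phi_def M_def N_def numeral_2_eq_2)
  next
    case 3
    have "2 * (int e * int N) - int e * (int e + 1) \<le> 2 * int M"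
      using pm_link_edges_ge[OF p(1-3) 3(2)] by (simp add: N_def M_def mult.assoc)
    moreover have "2 * int ((e + 1) choose 2) = (int e + 1) * int e"
      using int_choose_two[of "e + 1"] by simp
    ultimately have "2 * (int e * int N - int ((e + 1) choose 2)) \<le> 2 * int M"
      by (simp add: algebra_simps)
    then have "int e * int N - int ((e + 1) choose 2) \<le> int M" by simp
    then show ?thesis using 3 by (simp add: stacked_phi_def N_def M_def numeral_2_eq_2)
  next
    case 4
    have j: "1 \<le> i - 1" "i - 1 < e - 1" using 4 p(5) by auto
    obtain a b where ab: "0 \<le> a" "\<And>N. stacked_phi (i - 1) N (e - 1) = a * int N - b"
      using stacked_phi_affine[OF j] by metis
    have "a * (2 * int M) - b * int N \<le> (int i + 1) * int (card (link_faces \<Delta> \<rho> (i + 1)))"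
      unfolding M_def N_def
    proof (rule pm_link_faces_sum_bound[OF p(1)])
      show "1 \<le> i" using 4 by simp
      fix x assume x: "x \<in> link_vertices \<Delta> \<rho>"
      note ix = pm_insert_vertex[OF p(1) x]
      have "stacked_phi (i - 1) (card (link_vertices \<Delta> (insert x \<rho>))) (e - 1) \<le>
          int (card (link_faces \<Delta> (insert x \<rho>) (i - 1 + 1)))"
        using ix p(3) 4 j by (intro less.IH) auto
      then show "a * int (card (link_vertices \<Delta> (insert x \<rho>))) - b \<le>
          int (card (link_faces \<Delta> (insert x \<rho>) i))"
        using 4 unfolding ab(2) by simp
    qed
    moreover have "a * (2 * int e * int N - int e * (int e + 1)) \<le> a * (2 * int M)"
      using pm_link_edges_ge[OF p(1-3) 4(2)] ab(1) unfolding N_def M_def by (rule mult_left_mono)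
    ultimately have "(int i + 1) * stacked_phi i N e \<le> (int i + 1) * int (card (link_faces \<Delta> \<rho> (i + 1)))"
      unfolding stacked_phi_recursion[OF 4(1) p(5) ab(2)] by linarith
    then show ?thesis unfolding N_def by (simp add: mult_le_cancel_left_pos)
  qed
qed

text \<open>With N vertices the degree sum is at least 2 d N, so the affine bounds for the vertex
  links add up to at least N times their value at 2 d.\<close>

lemma pm_face_number_ge:
  assumes d: "4 \<le> d" and edges: "d * card (\<Union>\<Delta>) \<le> card {\<tau>\<in>\<Delta>. card \<tau> = 2}"
    and ne: "\<Delta> \<noteq> {{}}" and i: "i \<le> d - 1"
  shows "kuehnel_face_number d i \<le> real (face_number \<Delta> i)"
proof -
  note sc = pm_complex[OF pm]
  have e: "{} \<in> \<Delta>" using sc unfolding simplicial_complex_def by blast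
  have link0: "link \<Delta> {} = \<Delta>" by (simp add: link_def)
  have finV: "finite (\<Union>\<Delta>)" by (rule simplicial_complex_finite_Union[OF sc])
  define N where "N = card (\<Union>\<Delta>)"
  have lv: "link_vertices \<Delta> {} = \<Union>\<Delta>"
  proof (intro equalityI subsetI)
    fix x assume "x \<in> \<Union>\<Delta>"
    then obtain \<sigma> where "\<sigma> \<in> \<Delta>" "x \<in> \<sigma>" by blast
    then have "{x} \<in> \<Delta>" using simplicial_complex_subset[OF sc, of \<sigma> "{x}"] by simp
    then show "x \<in> link_vertices \<Delta> {}" by (simp add: link_vertices_def)
  qed (auto simp: link_vertices_def)
  have fn: "face_number \<Delta> j = card (link_faces \<Delta> {} (j + 1))" for j
    by (simp add: face_number_def link_faces_def link0)
  have f1: "int d * int N \<le> int (card (link_faces \<Delta> {} 2))"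
    using edges unfolding link_faces_def link0 N_def by (simp flip: of_nat_mult)
  obtain \<sigma> where "\<sigma> \<in> \<Delta>" "\<sigma> \<noteq> {}" using ne e by blast
  then have "\<Union>\<Delta> \<noteq> {}" by blast
  then have Npos: "0 < N" using finV by (simp add: N_def card_gt_0_iff)
  \<comment> \<open>There are at most \<open>N choose 2\<close> edges, and
    \<open>d * N \<le> N choose 2\<close> is the bound \<open>2 * d + 1 \<le> N\<close>. If N = 2 d
    + 1, all pairs of vertices are edges, as in M^d.\<close>
  have "card {\<tau>\<in>\<Delta>. card \<tau> = 2} \<le> card {\<tau>. \<tau> \<subseteq> \<Union>\<Delta> \<and> card \<tau> = 2}"
    using finV by (intro card_mono) auto
  also have "\<dots> = N choose 2" using n_subsets[OF finV] by (simp add: N_def)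
  finally have "int d * int N \<le> int (N choose 2)"
    using edges by (simp add: N_def flip: of_nat_mult)
  then have "int N * (2 * int d) \<le> int N * (int N - 1)"
    using int_choose_two[of N] by (simp add: algebra_simps)
  then have N: "2 * int d + 1 \<le> int N" using Npos by (simp add: mult_le_cancel_left_pos)
  show ?thesis
  proof (cases "i = 0")
    case True
    have "face_number \<Delta> 0 = N" using pm_card_link_faces_1[OF e] unfolding fn lv N_def by simp
    then show ?thesis using True N by (simp add: kuehnel_face_number_def)
  next
    case False
    define \<Phi> where "\<Phi> = stacked_phi (i - 1) (2 * d) (d - 1)"
    have \<Phi>0: "0 \<le> \<Phi>" unfolding \<Phi>_def using i False d by (intro stacked_phi_kuehnel_nonneg) simp
    have "\<exists>a b. 0 \<le> a \<and> (\<forall>N. stacked_phi (i - 1) N (d - 1) = a * int N - b)"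
    proof (cases "i = 1")
      case True
      then show ?thesis by (intro exI[of _ 1] exI[of _ 0]) (simp add: stacked_phi_def)
    next
      case i1: False
      have "1 \<le> i - 1" "i - 1 < d - 1" using False i1 i d by auto
      then show ?thesis using stacked_phi_affine[of "i - 1" "d - 1"] by metis
    qed
    then obtain a b where ab: "0 \<le> a" "\<And>N. stacked_phi (i - 1) N (d - 1) = a * int N - b" by blast
    have "a * (2 * int (card (link_faces \<Delta> {} 2))) - b * int (card (link_vertices \<Delta> {})) \<le>
        (int i + 1) * int (card (link_faces \<Delta> {} (i + 1)))"
    proof (rule pm_link_faces_sum_bound[OF e])
      show "1 \<le> i" using False by simp
      fix x assume x: "x \<in> link_vertices \<Delta> {}"
      note ix = pm_insert_vertex[OF e x]
      have "stacked_phi (i - 1) (card (link_vertices \<Delta> {x})) (d - 1) \<le>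
          int (card (link_faces \<Delta> {x} (i - 1 + 1)))"
        using ix d i False by (intro pm_link_faces_ge) auto
      then show "a * int (card (link_vertices \<Delta> (insert x {}))) - b \<le>
          int (card (link_faces \<Delta> (insert x {}) i))"
        using False unfolding ab(2) by simp
    qed
    moreover have "a * (2 * (int d * int N)) \<le> a * (2 * int (card (link_faces \<Delta> {} 2)))"
      using f1 ab(1) by (intro mult_left_mono) auto
    \<comment> \<open>\<open>a * (2 * d) - b\<close> is the value for a stacked sphere with 2 d
      vertices, the vertex link of M^d.\<close>
    moreover have "a * (2 * (int d * int N)) - b * int N = int N * \<Phi>"
      unfolding \<Phi>_def ab(2) by (simp add: algebra_simps)
    ultimately have 1: "int N * \<Phi> \<le> (int i + 1) * int (face_number \<Delta> i)"
      unfolding fn lv N_def by linarith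
    have "(2 * int d + 1) * \<Phi> \<le> int N * \<Phi>" using N \<Phi>0 by (rule mult_right_mono)
    then have "(2 * int d + 1) * \<Phi> \<le> (int i + 1) * int (face_number \<Delta> i)" using 1 by linarith
    then have "real_of_int ((2 * int d + 1) * \<Phi>) \<le> real_of_int ((int i + 1) * int (face_number \<Delta> i))"
      by (simp only: of_int_le_iff)
    then have "(2 * real d + 1) * of_int \<Phi> \<le> (real i + 1) * real (face_number \<Delta> i)" by simp
    then have "(2 * real d + 1) * of_int \<Phi> / (real i + 1) \<le> real (face_number \<Delta> i)"
      by (simp add: divide_le_eq mult.commute)
    then show ?thesis using False by (simp add: kuehnel_face_number_def \<Phi>_def)
  qed
qed

end

theorem theorem4p7:
  fixes \<Delta> :: "'v set set" and d :: nat
  assumes "d \<ge> 4"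
    and "homology_manifold_without_boundary TYPE('k::field) \<Delta>"
    and "complex_dim \<Delta> = int d - 1"
    and "reduced_betti TYPE('k) \<Delta> 1 \<noteq> 0"
  shows "\<forall>i\<le>d - 1. real (face_number \<Delta> i) \<ge> kuehnel_face_number d i"
proof -
  have sc: "simplicial_complex \<Delta>" and conn: "connected_complex \<Delta>"
    using assms(2) unfolding homology_manifold_without_boundary_def homology_manifold_def by auto
  have pm: "normal_pseudomanifold d \<Delta>"
    using assms(1) by (intro normal_pseudomanifold_of_homology_manifold[OF assms(2,3)]) simp
  show ?thesis
  proof (rule multiplicative_cocycle_of_betti[OF sc conn assms(4)])
    fix \<chi> :: "'v \<Rightarrow> 'v \<Rightarrow> complex"
    assume chi: "\<And>u v. {u, v} \<in> \<Delta> \<Longrightarrow> \<chi> u v \<noteq> 0"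
      "\<And>u v w. {u, v, w} \<in> \<Delta> \<Longrightarrow> \<chi> u v * \<chi> v w = \<chi> u w"
      "\<not> (\<exists>s. \<forall>u v. {u, v} \<in> \<Delta> \<longrightarrow> s u \<noteq> 0 \<and> s u = \<chi> u v * s v)"
    have "d * card (\<Union>\<Delta>) \<le> card {\<tau>\<in>\<Delta>. card \<tau> = 2}"
      by (rule pm_edge_bound_of_monodromy[OF pm assms(1) conn chi])
    \<comment> \<open>If the empty face were the only one, there would be no \<open>{u, v}\<close>
      in \<Delta>, and any \<open>s\<close> would satisfy the condition vacuously.\<close>
    moreover have "\<Delta> \<noteq> {{}}" using chi(3) by auto
    ultimately show ?thesis using pm_face_number_ge[OF pm assms(1)] by blast
  qed
qed

end
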